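(* Let $H$ be a Hopf algebra with bijective antipode over a field $\Bbbk$, $V$ an $H$-module, $M$ an extension of $V$ by $H$, and let $\mathfrak{X}=\{x_i\}_{i\in I}\subset M$ and the basis $\mathfrak{H}\ni 1$ of $H$ be fixed as in the context. Let $\langle\mathfrak{X}\rangle$ be the subset of $T(V)\#_MH$ formed by the monomials (words) in $\mathfrak{X}$. Then: (a) $\langle\mathfrak{X}\rangle\mathfrak{H}=\{Ah\mid A\in\langle\mathfrak{X}\rangle,\ h\in\mathfrak{H}\}$ is a basis of $T(V)\#_MH$. (b) The linear endomorphism $\phi$ of $T(V)\#_MH$ defined by $\phi(Ah)=hA$ for $A\in\langle\mathfrak{X}\rangle$ and $h\in\mathfrak{H}$ is a (linear) isomorphism. (c) $T(V)\#_MH$ is a graded vector space whose homogeneous component of degree $n\in\mathbb{N}$ (including $n=0$) is the linear span of $\{Ah\mid A\in\langle\mathfrak{X}\rangle \text{ of length } n,\ h\in\mathfrak{H}\}$. (d) $T(V)$ and $H$ are subalgebras of $T(V)\#_MH$ (that is, the natural algebra maps $T(V)\to T(V)\#_MH$, $x_i\mapsto x_i$, and $H\to T(V)\#_MH$ are injective).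
   Context: $H$ is a Hopf algebra with bijective antipode over a field $\Bbbk$, with Sweedler notation $\Delta(h)=h_{(1)}\otimes h_{(2)}$; $H$ is regarded as an $H$-module via the adjoint action $h\cdot k=h_{(1)}kS(h_{(2)})$. $V$ is an $H$-module. An extension of $V$ by $H$ is an $H$-module $M$ fitting in a short exact sequence of $H$-modules $0\to H\to M\to V\to 0$. Fix a linearly independent set $\mathfrak{X}=\{x_i\}_{i\in I}\subset M$ with $M=\Bbbk\mathfrak{X}\oplus H$ as vector spaces; the images of the $x_i$ in $V$ form a basis of $V$, denoted in the same way. Fix a basis $\mathfrak{H}$ of $H$ with $1\in\mathfrak{H}$. $T_H(M)$ is the quotient of the tensor algebra $T(M)$ by the relations of $H$, i.e. the unital algebra generated by $\mathfrak{X}$ and $\mathfrak{H}$ (with $1\in\mathfrak{H}$ the unit) subject only to the relations expressing the multiplication of $H$ in the basis $\mathfrak{H}$; it contains $H$ as a subalgebra and $M=\Bbbk\mathfrak{X}\oplus H$ as a subspace. The algebra $T(V)\#_MH$ is the quotient of $T_H(M)$ by the ideal $J_M$ generated by the elements $hx-(h_{(1)}\cdot x)h_{(2)}$ for all $h\in H$, $x\in M$, where $h_{(1)}\cdot x\in M$ is the action of $H$ on $M$. *)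

theory Defs
  imports Complex_Main "HOL-Algebra.QuotRing" "HOL-Algebra.Module" "HOL-Library.Poly_Mapping"
begin

section \<open>Linear algebra in \<open>\<Bbbk>\<close>-algebras with explicit carrier\<close>

text \<open>
  A \<open>\<Bbbk>\<close>-algebra with explicit carrier is a record of type \<^typ>\<open>('k, 'a) module\<close>: its ring part carries
  the (noncommutative, unital) multiplication, and scalars range over a type \<open>'k\<close> of sort \<open>field\<close>.
  The library locale \<open>algebra\<close> is not used, since it demands a commutative multiplication.
\<close>

definition type_algebra :: "('k::field \<Rightarrow> 'a::ring_1 \<Rightarrow> 'a) \<Rightarrow> ('k, 'a) module" where
  "type_algebra s =
     \<lparr>carrier = UNIV, mult = (*), one = 1, zero = 0, add = (+), smult = s\<rparr>"

definition alg_span :: "('k::field, 'a) module \<Rightarrow> 'a set \<Rightarrow> 'a set" where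
  "alg_span A B = {\<Oplus>\<^bsub>A\<^esub>b\<in>S. c b \<odot>\<^bsub>A\<^esub> b | c S. finite S \<and> S \<subseteq> B}"

definition alg_independent :: "('k::field, 'a) module \<Rightarrow> 'a set \<Rightarrow> bool" where
  "alg_independent A B \<longleftrightarrow>
     (\<forall>S c. finite S \<and> S \<subseteq> B \<and> (\<Oplus>\<^bsub>A\<^esub>b\<in>S. c b \<odot>\<^bsub>A\<^esub> b) = \<zero>\<^bsub>A\<^esub> \<longrightarrow> (\<forall>b\<in>S. c b = 0))"

definition alg_basis :: "('k::field, 'a) module \<Rightarrow> 'a set \<Rightarrow> bool" where
  "alg_basis A B \<longleftrightarrow> B \<subseteq> carrier A \<and> alg_independent A B \<and> alg_span A B = carrier A"

definition alg_subspace :: "('k::field, 'a) module \<Rightarrow> 'a set \<Rightarrow> bool" where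
  "alg_subspace A U \<longleftrightarrow> U \<subseteq> carrier A \<and> \<zero>\<^bsub>A\<^esub> \<in> U \<and>
     (\<forall>x\<in>U. \<forall>y\<in>U. x \<oplus>\<^bsub>A\<^esub> y \<in> U) \<and> (\<forall>c. \<forall>x\<in>U. c \<odot>\<^bsub>A\<^esub> x \<in> U)"

definition alg_linear :: "('k::field, 'a) module \<Rightarrow> ('k, 'b) module \<Rightarrow> ('a \<Rightarrow> 'b) \<Rightarrow> bool" where
  "alg_linear A B f \<longleftrightarrow> f \<in> carrier A \<rightarrow> carrier B \<and>
     (\<forall>x\<in>carrier A. \<forall>y\<in>carrier A. f (x \<oplus>\<^bsub>A\<^esub> y) = f x \<oplus>\<^bsub>B\<^esub> f y) \<and>
     (\<forall>c. \<forall>x\<in>carrier A. f (c \<odot>\<^bsub>A\<^esub> x) = c \<odot>\<^bsub>B\<^esub> f x)"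

definition alg_hom :: "('k::field, 'a) module \<Rightarrow> ('k, 'b) module \<Rightarrow> ('a \<Rightarrow> 'b) \<Rightarrow> bool" where
  "alg_hom A B f \<longleftrightarrow> f \<in> ring_hom A B \<and> alg_linear A B f"

text \<open>\<open>A\<close> is, as a vector space, the internal direct sum of the \<open>D n\<close>, \<open>n \<ge> 0\<close>.\<close>

definition graded_with :: "('k::field, 'a) module \<Rightarrow> (nat \<Rightarrow> 'a set) \<Rightarrow> bool" where
  "graded_with A D \<longleftrightarrow> (\<forall>n. alg_subspace A (D n)) \<and>
     (\<forall>a\<in>carrier A. \<exists>!d. (\<forall>n. d n \<in> D n) \<and> finite {n. d n \<noteq> \<zero>\<^bsub>A\<^esub>} \<and>
        a = (\<Oplus>\<^bsub>A\<^esub>n\<in>{n. d n \<noteq> \<zero>\<^bsub>A\<^esub>}. d n))"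

text \<open>
  The quotient of a \<open>\<Bbbk>\<close>-algebra by the two-sided ideal generated by \<open>G\<close>. The library's \<open>Idl\<close> is
  two-sided; as \<open>A\<close> is unital, the ideal is automatically closed under scalars.
\<close>

definition quot_map :: "('k::field, 'a) module \<Rightarrow> 'a set \<Rightarrow> 'a \<Rightarrow> 'a set" where
  "quot_map A G x = (Idl\<^bsub>A\<^esub> G) +>\<^bsub>A\<^esub> x"

definition quot_algebra :: "('k::field, 'a) module \<Rightarrow> 'a set \<Rightarrow> ('k, 'a set) module" where
  "quot_algebra A G =
     ring.extend (A Quot (Idl\<^bsub>A\<^esub> G)) (module.fields (\<lambda>c X. \<Union>x\<in>X. quot_map A G (c \<odot>\<^bsub>A\<^esub> x)))"


section \<open>Free algebras and tensor algebras\<close>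

text \<open>
  With concatenation as the addition on lists, the convolution product makes \<open>'a list \<Rightarrow>\<^sub>0 'k\<close> the
  free unital associative \<open>'k\<close>-algebra on \<open>'a\<close>.
\<close>

instantiation list :: (type) monoid_add
begin

definition zero_list :: "'a list" where "zero_list = []"
definition plus_list :: "'a list \<Rightarrow> 'a list \<Rightarrow> 'a list" where "plus_list = (@)"

instance
  by standard (simp_all add: zero_list_def plus_list_def)

end

definition free_scale :: "'k::field \<Rightarrow> ('a \<Rightarrow>\<^sub>0 'k) \<Rightarrow> ('a \<Rightarrow>\<^sub>0 'k)" where
  "free_scale c p = Poly_Mapping.map ((*) c) p"

definition free_algebra :: "('k::field, 'a list \<Rightarrow>\<^sub>0 'k) module" where
  "free_algebra = type_algebra free_scale"

abbreviation word :: "'a list \<Rightarrow> ('a list \<Rightarrow>\<^sub>0 'k::field)" where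
  "word w \<equiv> Poly_Mapping.single w 1"

text \<open>
  Multilinearity in every position. The linear span \<open>N\<close> of these relations is homogeneous for the
  length of words, and the part of length \<open>n\<close> of (free vector space on lists)\<open>/N\<close> is the \<open>n\<close>-fold tensor
  power of the vector space \<open>'v\<close> with scalar multiplication \<open>s\<close>. Moreover \<open>N\<close> is a two-sided ideal.
\<close>

definition tensor_relations :: "('k::field \<Rightarrow> 'v::ab_group_add \<Rightarrow> 'v) \<Rightarrow> ('v list \<Rightarrow>\<^sub>0 'k) set" where
  "tensor_relations s =
     {word (u @ (x + y) # v) - word (u @ x # v) - word (u @ y # v) | u v x y. True} \<union>
     {word (u @ s c x # v) - free_scale c (word (u @ x # v)) | u v c x. True}"

definition tensor_algebra ::
    "('k::field \<Rightarrow> 'v::ab_group_add \<Rightarrow> 'v) \<Rightarrow> ('k, ('v list \<Rightarrow>\<^sub>0 'k) set) module" where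
  "tensor_algebra s = quot_algebra free_algebra (tensor_relations s)"

definition tensor_class ::
    "('k::field \<Rightarrow> 'v::ab_group_add \<Rightarrow> 'v) \<Rightarrow> ('v list \<Rightarrow>\<^sub>0 'k) \<Rightarrow> ('v list \<Rightarrow>\<^sub>0 'k) set" where
  "tensor_class s = quot_map free_algebra (tensor_relations s)"

text \<open>
  A list of lists \<open>[[a\<^sub>1,b\<^sub>1],[a\<^sub>2,b\<^sub>2],\<dots>]\<close> stands for the tensor \<open>a\<^sub>1 \<otimes> b\<^sub>1 + a\<^sub>2 \<otimes> b\<^sub>2 + \<dots>\<close> (likewise for
  longer inner lists); \<open>tensor_eq\<close> is equality of the tensors so represented.
\<close>

definition tensor_eq ::
    "('k::field \<Rightarrow> 'v::ab_group_add \<Rightarrow> 'v) \<Rightarrow> 'v list list \<Rightarrow> 'v list list \<Rightarrow> bool" where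
  "tensor_eq s ts us \<longleftrightarrow>
     (\<Sum>t\<leftarrow>ts. word t) - (\<Sum>u\<leftarrow>us. word u) \<in> Modules.module.span free_scale (tensor_relations s)"


section \<open>Hopf algebras and their modules\<close>

text \<open>
  \<open>comult h\<close> is a chosen expression \<open>[(a\<^sub>1,b\<^sub>1),(a\<^sub>2,b\<^sub>2),\<dots>]\<close> of \<open>\<Delta>(h) = a\<^sub>1 \<otimes> b\<^sub>1 + a\<^sub>2 \<otimes> b\<^sub>2 + \<dots>\<close> as a sum of
  pure tensors. All axioms on \<open>\<Delta>\<close> are identities of tensors, i.e. modulo \<open>tensor_eq\<close>, so every
  comultiplication \<open>H \<rightarrow> H \<otimes> H\<close> is covered, and Sweedler sums \<open>f(h\<^sub>(\<^sub>1\<^sub>), h\<^sub>(\<^sub>2\<^sub>))\<close> with \<open>f\<close> bilinear are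
  \<open>\<Sum>(a, b)\<leftarrow>comult h. f a b\<close>.
\<close>

locale hopf_algebra = vector_space scale
  for scale :: "'k::field \<Rightarrow> 'h::ring_1 \<Rightarrow> 'h" +
  fixes comult :: "'h \<Rightarrow> ('h \<times> 'h) list"
    and counit :: "'h \<Rightarrow> 'k"
    and antipode :: "'h \<Rightarrow> 'h"
  assumes scale_mult_left: "scale c x * y = scale c (x * y)"
    and scale_mult_right: "x * scale c y = scale c (x * y)"
    and comult_add: "tensor_eq scale [[a, b]. (a, b) \<leftarrow> comult (x + y)]
          ([[a, b]. (a, b) \<leftarrow> comult x] @ [[a, b]. (a, b) \<leftarrow> comult y])"
    and comult_scale: "tensor_eq scale [[a, b]. (a, b) \<leftarrow> comult (scale c x)]
          [[scale c a, b]. (a, b) \<leftarrow> comult x]"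
    and counit_linear: "Vector_Spaces.linear scale (*) counit"
    and coassoc: "tensor_eq scale
          [[a1, a2, b]. (a, b) \<leftarrow> comult x, (a1, a2) \<leftarrow> comult a]
          [[a, b1, b2]. (a, b) \<leftarrow> comult x, (b1, b2) \<leftarrow> comult b]"
    and counit_left: "(\<Sum>(a, b)\<leftarrow>comult x. scale (counit a) b) = x"
    and counit_right: "(\<Sum>(a, b)\<leftarrow>comult x. scale (counit b) a) = x"
    and comult_mult: "tensor_eq scale [[a, b]. (a, b) \<leftarrow> comult (x * y)]
          [[a * c, b * d]. (a, b) \<leftarrow> comult x, (c, d) \<leftarrow> comult y]"
    and comult_one: "tensor_eq scale [[a, b]. (a, b) \<leftarrow> comult 1] [[1, 1]]"
    and counit_mult: "counit (x * y) = counit x * counit y"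
    and counit_one: "counit 1 = 1"
    and antipode_linear: "Vector_Spaces.linear scale scale antipode"
    and antipode_left: "(\<Sum>(a, b)\<leftarrow>comult x. antipode a * b) = scale (counit x) 1"
    and antipode_right: "(\<Sum>(a, b)\<leftarrow>comult x. a * antipode b) = scale (counit x) 1"

definition adjoint_action ::
    "('h \<Rightarrow> ('h \<times> 'h) list) \<Rightarrow> ('h \<Rightarrow> 'h) \<Rightarrow> 'h \<Rightarrow> 'h \<Rightarrow> 'h::ring_1" where
  "adjoint_action comult antipode h k = (\<Sum>(a, b)\<leftarrow>comult h. a * k * antipode b)"

locale algebra_module = vector_space scaleM
  for scaleH :: "'k::field \<Rightarrow> 'h::ring_1 \<Rightarrow> 'h"
    and scaleM :: "'k \<Rightarrow> 'm::ab_group_add \<Rightarrow> 'm" +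
  fixes act :: "'h \<Rightarrow> 'm \<Rightarrow> 'm"
  assumes act_add_left: "act (h + k) m = act h m + act k m"
    and act_add_right: "act h (m + n) = act h m + act h n"
    and act_scale_left: "act (scaleH c h) m = scaleM c (act h m)"
    and act_scale_right: "act h (scaleM c m) = scaleM c (act h m)"
    and act_one: "act 1 m = m"
    and act_mult: "act (h * k) m = act h (act k m)"

definition module_map ::
    "('k::field \<Rightarrow> 'm::ab_group_add \<Rightarrow> 'm) \<Rightarrow> ('h \<Rightarrow> 'm \<Rightarrow> 'm) \<Rightarrow>
     ('k \<Rightarrow> 'n::ab_group_add \<Rightarrow> 'n) \<Rightarrow> ('h \<Rightarrow> 'n \<Rightarrow> 'n) \<Rightarrow> ('m \<Rightarrow> 'n) \<Rightarrow> bool" where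
  "module_map scaleM actM scaleN actN f \<longleftrightarrow>
     Vector_Spaces.linear scaleM scaleN f \<and> (\<forall>h m. f (actM h m) = actN h (f m))"

definition short_exact :: "('a \<Rightarrow> 'b) \<Rightarrow> ('b \<Rightarrow> 'c::zero) \<Rightarrow> bool" where
  "short_exact inc pr \<longleftrightarrow> inj inc \<and> surj pr \<and> range inc = {m. pr m = 0}"

definition vs_basis :: "('k::field \<Rightarrow> 'v::ab_group_add \<Rightarrow> 'v) \<Rightarrow> 'v set \<Rightarrow> bool" where
  "vs_basis s B \<longleftrightarrow> \<not> Modules.module.dependent s B \<and> Modules.module.span s B = UNIV"

definition direct_complement ::
    "('k::field \<Rightarrow> 'v::ab_group_add \<Rightarrow> 'v) \<Rightarrow> 'v set \<Rightarrow> 'v set \<Rightarrow> bool" where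
  "direct_complement s U W \<longleftrightarrow> U \<inter> W = {0} \<and> {u + w | u w. u \<in> U \<and> w \<in> W} = UNIV \<and>
     Modules.module.subspace s U \<and> Modules.module.subspace s W"


section \<open>The algebras \<open>T\<^sub>H(M)\<close> and \<open>T(V)#\<^sub>MH\<close>\<close>

text \<open>
  \<open>inc : H \<rightarrow> M\<close> is the inclusion of the extension and \<open>HB\<close> the chosen basis of \<open>H\<close>. Relations are
  written in the free algebra on \<open>M\<close> and then mapped to \<open>T(M)\<close> and \<open>T\<^sub>H(M)\<close>, respectively.
\<close>

definition H_relations :: "('h::ring_1 \<Rightarrow> 'm) \<Rightarrow> 'h set \<Rightarrow> ('m list \<Rightarrow>\<^sub>0 'k::field) set" where
  "H_relations inc HB =
     {word [inc h, inc k] - word [inc (h * k)] | h k. h \<in> HB \<and> k \<in> HB} \<union> {word [inc 1] - 1}"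

definition TH_algebra ::
    "('k::field \<Rightarrow> 'm::ab_group_add \<Rightarrow> 'm) \<Rightarrow> ('h::ring_1 \<Rightarrow> 'm) \<Rightarrow> 'h set \<Rightarrow>
     ('k, ('m list \<Rightarrow>\<^sub>0 'k) set set) module" where
  "TH_algebra scaleM inc HB =
     quot_algebra (tensor_algebra scaleM) (tensor_class scaleM ` H_relations inc HB)"

definition TH_class ::
    "('k::field \<Rightarrow> 'm::ab_group_add \<Rightarrow> 'm) \<Rightarrow> ('h::ring_1 \<Rightarrow> 'm) \<Rightarrow> 'h set \<Rightarrow>
     ('m list \<Rightarrow>\<^sub>0 'k) \<Rightarrow> ('m list \<Rightarrow>\<^sub>0 'k) set set" where
  "TH_class scaleM inc HB p =
     quot_map (tensor_algebra scaleM) (tensor_class scaleM ` H_relations inc HB)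
       (tensor_class scaleM p)"

definition JM_relations ::
    "('h \<Rightarrow> ('h \<times> 'h) list) \<Rightarrow> ('h \<Rightarrow> 'm \<Rightarrow> 'm) \<Rightarrow> ('h \<Rightarrow> 'm) \<Rightarrow> ('m list \<Rightarrow>\<^sub>0 'k::field) set" where
  "JM_relations comult act inc =
     {word [inc h, m] - (\<Sum>(a, b)\<leftarrow>comult h. word [act a m, inc b]) | h m. True}"

definition smash_algebra ::
    "('h::ring_1 \<Rightarrow> ('h \<times> 'h) list) \<Rightarrow> ('k::field \<Rightarrow> 'm::ab_group_add \<Rightarrow> 'm) \<Rightarrow> ('h \<Rightarrow> 'm \<Rightarrow> 'm) \<Rightarrow>
     ('h \<Rightarrow> 'm) \<Rightarrow> 'h set \<Rightarrow> ('k, ('m list \<Rightarrow>\<^sub>0 'k) set set set) module" where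
  "smash_algebra comult scaleM act inc HB =
     quot_algebra (TH_algebra scaleM inc HB) (TH_class scaleM inc HB ` JM_relations comult act inc)"

definition smash_class ::
    "('h::ring_1 \<Rightarrow> ('h \<times> 'h) list) \<Rightarrow> ('k::field \<Rightarrow> 'm::ab_group_add \<Rightarrow> 'm) \<Rightarrow> ('h \<Rightarrow> 'm \<Rightarrow> 'm) \<Rightarrow>
     ('h \<Rightarrow> 'm) \<Rightarrow> 'h set \<Rightarrow> ('m list \<Rightarrow>\<^sub>0 'k) \<Rightarrow> ('m list \<Rightarrow>\<^sub>0 'k) set set set" where
  "smash_class comult scaleM act inc HB p =
     quot_map (TH_algebra scaleM inc HB) (TH_class scaleM inc HB ` JM_relations comult act inc)
       (TH_class scaleM inc HB p)"

end

theory Submission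
  imports Defs
begin

text \<open>Words are straightened by moving \<open>H\<close> to the right: the relations turn \<open>k x A h\<close> into
  \<open>(k\<^sub>(\<^sub>1\<^sub>) \<cdot> x) k\<^sub>(\<^sub>2\<^sub>) A h\<close>, and the component of \<open>k\<^sub>(\<^sub>1\<^sub>) \<cdot> x\<close> in \<open>H\<close> only meets the shorter word \<open>A\<close>. Hence
  the \<open>A h\<close> span. They are independent because the same recursion defines an action of
  \<open>T(V)#\<^sub>MH\<close> on \<open>\<Bbbk>\<langle>\<XX>\<rangle> \<otimes> H\<close> in which \<open>A h\<close> sends \<open>1 \<otimes> 1\<close> to \<open>A \<otimes> h\<close>; the adjoint action on \<open>H\<close> is
  exactly what makes this compatible with the multiplication of \<open>H\<close>. Since the antipode is
  bijective, the relations also read \<open>m h = h\<^sub>(\<^sub>2\<^sub>) (S\<^sup>-\<^sup>1(h\<^sub>(\<^sub>1\<^sub>)) \<cdot> m)\<close>, and the same argument for the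
  opposite algebra of \<open>H\<close> shows that the \<open>h A\<close> form a basis as well. Thus \<open>\<phi>\<close> maps one basis
  bijectively to another, and the grading and the embeddings are read off the basis.\<close>

subsection \<open>Linear extension from finitely supported functions\<close>

text \<open>The obstacle is that the algebra is a threefold quotient of the free algebra on all of
  M, with classes that are sets of sets of sets. Computations are therefore pulled back to the free
  algebra, where the quotient is visible only through its kernel, the least two-sided ideal
  containing the three families of relations. Distinct elements of M are unrelated letters there, so
  a letter depends linearly on its element only modulo the kernel; hence multilinearity and spanning
  are treated modulo a subspace. Likewise \<open>comult h\<close> is a chosen list of pairs, and
  identities of tensors can be used only after a bilinear or trilinear map has been applied. The
  space k<X> \<otimes> H is modelled by finitely supported functions from words to H, without
  expanding H in a basis. No inverse of \<phi> is constructed: A h and h A carry the same index (A,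
  h), so it suffices that both families are bases. For the second family the representation is by
  right multiplications, which compose like left multiplications over the opposite algebra.\<close>

definition pm_sum :: "('a \<Rightarrow> 'b::zero \<Rightarrow> 'c::comm_monoid_add) \<Rightarrow> ('a \<Rightarrow>\<^sub>0 'b) \<Rightarrow> 'c" where
  "pm_sum f p = (\<Sum>a\<in>Poly_Mapping.keys p. f a (Poly_Mapping.lookup p a))"

text \<open>The coefficients may lie in any vector space. With the scaling of H this acts on
  functions from words to H; with the multiplication of the field it is
  \<open>free_scale\<close>.\<close>

definition pm_scale :: "('k \<Rightarrow> 'b::zero \<Rightarrow> 'b) \<Rightarrow> 'k \<Rightarrow> ('a \<Rightarrow>\<^sub>0 'b) \<Rightarrow> ('a \<Rightarrow>\<^sub>0 'b)" where
  "pm_scale s c p = Poly_Mapping.map (s c) p"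

definition lin_ext :: "('k::zero \<Rightarrow> 'c \<Rightarrow> 'c::comm_monoid_add) \<Rightarrow> ('a \<Rightarrow> 'c) \<Rightarrow> ('a \<Rightarrow>\<^sub>0 'k) \<Rightarrow> 'c" where
  "lin_ext s f = pm_sum (\<lambda>a c. s c (f a))"

lemma pm_sum_superset:
  assumes "finite S" "Poly_Mapping.keys p \<subseteq> S" "\<And>a. f a 0 = 0"
  shows "pm_sum f p = (\<Sum>a\<in>S. f a (Poly_Mapping.lookup p a))"
  unfolding pm_sum_def
  by (rule sum.mono_neutral_left) (use assms in \<open>auto simp: in_keys_iff\<close>)

lemma pm_sum_zero [simp]: "pm_sum f 0 = 0"
  by (simp add: pm_sum_def)

lemma pm_sum_single: "f a 0 = 0 \<Longrightarrow> pm_sum f (Poly_Mapping.single a b) = f a b"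
  by (cases "b = 0") (simp_all add: pm_sum_def)

lemma pm_sum_add:
  fixes f :: "'a \<Rightarrow> 'b::comm_monoid_add \<Rightarrow> 'c::ab_group_add"
  assumes add: "\<And>a x y. f a (x + y) = f a x + f a y"
  shows "pm_sum f (p + q) = pm_sum f p + pm_sum f q"
proof -
  have z: "f a 0 = 0" for a
    using add[of a 0 0] by simp
  let ?S = "Poly_Mapping.keys p \<union> Poly_Mapping.keys q"
  have "pm_sum f r = (\<Sum>a\<in>?S. f a (Poly_Mapping.lookup r a))" if "Poly_Mapping.keys r \<subseteq> ?S" for r
    by (rule pm_sum_superset) (use that z in auto)
  then show ?thesis
    using keys_add[of p q] by (simp add: lookup_add add sum.distrib)
qed

lemma lookup_pm_scale: "s c 0 = 0 \<Longrightarrow> Poly_Mapping.lookup (pm_scale s c p) a = s c (Poly_Mapping.lookup p a)"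
  by (simp add: pm_scale_def map.rep_eq when_def)

lemma keys_pm_scale: "s c 0 = 0 \<Longrightarrow> Poly_Mapping.keys (pm_scale s c p) \<subseteq> Poly_Mapping.keys p"
  by (auto simp: in_keys_iff lookup_pm_scale)

lemma pm_scale_single [simp]:
  "s c 0 = 0 \<Longrightarrow> pm_scale s c (Poly_Mapping.single a b) = Poly_Mapping.single a (s c b)"
  by (rule poly_mapping_eqI) (simp add: lookup_pm_scale lookup_single when_def)

lemma pm_sum_scale:
  fixes f :: "'a \<Rightarrow> 'b::comm_monoid_add \<Rightarrow> 'c::ab_group_add"
  assumes add: "\<And>a x y. f a (x + y) = f a x + f a y"
    and scale: "\<And>a x. f a (s c x) = t (f a x)"
    and s0: "s c 0 = 0"
    and t: "\<And>x y. t (x + y) = t x + t y"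
  shows "pm_sum f (pm_scale s c p) = t (pm_sum f p)"
proof -
  have z: "f a 0 = 0" for a
    using add[of a 0 0] by simp
  have t0: "t 0 = 0" using t[of 0 0] by simp
  have tsum: "t (sum g S) = (\<Sum>a\<in>S. t (g a))" for g :: "'a \<Rightarrow> 'c" and S
    by (induction S rule: infinite_finite_induct) (simp_all add: t0 t)
  have "pm_sum f (pm_scale s c p) = (\<Sum>a\<in>Poly_Mapping.keys p. f a (Poly_Mapping.lookup (pm_scale s c p) a))"
    by (rule pm_sum_superset) (use keys_pm_scale[of s c p] s0 z in auto)
  then show ?thesis
    by (simp add: pm_sum_def tsum lookup_pm_scale s0 scale)
qed

lemma pm_sum_id: "pm_sum Poly_Mapping.single p = p"
proof (rule poly_mapping_eqI)
  fix k
  have "(\<Sum>a\<in>Poly_Mapping.keys p. Poly_Mapping.lookup p a when a = k) = (\<Sum>a\<in>Poly_Mapping.keys p. if a = k then Poly_Mapping.lookup p k else 0)"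
    by (rule sum.cong) (auto simp: when_def)
  then show "Poly_Mapping.lookup (pm_sum Poly_Mapping.single p) k = Poly_Mapping.lookup p k"
    by (simp add: pm_sum_def lookup_sum lookup_single in_keys_iff)
qed

text \<open>The case of singles is restricted to keys of \<open>p\<close>, so that a hypothesis on
  the support of \<open>p\<close> can be used there without being carried through sums.\<close>

lemma pm_induct [case_names zero single add]:
  fixes p :: "'a \<Rightarrow>\<^sub>0 'b::comm_monoid_add"
  assumes "P 0" "\<And>a b. a \<in> Poly_Mapping.keys p \<Longrightarrow> P (Poly_Mapping.single a b)" "\<And>p q. P p \<Longrightarrow> P q \<Longrightarrow> P (p + q)"
  shows "P p"
proof -
  have "P (\<Sum>a\<in>S. Poly_Mapping.single a (Poly_Mapping.lookup p a))" if "S \<subseteq> Poly_Mapping.keys p" for S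
    using that by (induction S rule: infinite_finite_induct) (auto intro: assms)
  then show ?thesis
    using pm_sum_id[of p] by (metis pm_sum_def order_refl)
qed

lemma vector_space_pm_scale:
  fixes s :: "'k::field \<Rightarrow> 'b::ab_group_add \<Rightarrow> 'b"
  assumes "vector_space s"
  shows "vector_space (pm_scale s :: 'k \<Rightarrow> ('a \<Rightarrow>\<^sub>0 'b) \<Rightarrow> _)"
proof -
  interpret vector_space s by fact
  show ?thesis
    by unfold_locales
      (auto intro!: poly_mapping_eqI simp: lookup_pm_scale lookup_add scale_right_distrib scale_left_distrib)
qed

lemma vector_space_times: "vector_space ((*) :: 'k::field \<Rightarrow> 'k \<Rightarrow> 'k)"
  by unfold_locales (simp_all add: algebra_simps)

lemma free_scale_eq: "free_scale = pm_scale (*)"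
  by (simp add: fun_eq_iff free_scale_def pm_scale_def)

lemma vector_space_free_scale: "vector_space free_scale"
  unfolding free_scale_eq by (rule vector_space_pm_scale[OF vector_space_times])

interpretation free: vector_space free_scale
  by (rule vector_space_free_scale)

lemma free_scale_single [simp]:
  "free_scale c (Poly_Mapping.single a b) = Poly_Mapping.single a (c * b)"
  by (simp add: free_scale_eq)

lemma lookup_free_scale [simp]: "Poly_Mapping.lookup (free_scale c p) a = c * Poly_Mapping.lookup p a"
  by (simp add: free_scale_eq lookup_pm_scale)

context vector_space
begin

lemma linear_lin_ext: "Vector_Spaces.linear free_scale scale (lin_ext scale f)"
  unfolding Vector_Spaces.linear_iff lin_ext_def free_scale_eq
proof (intro conjI allI)
  show "pm_sum (\<lambda>a c. scale c (f a)) (pm_scale (*) c p) = scale c (pm_sum (\<lambda>a c. scale c (f a)) p)" for c p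
    by (rule pm_sum_scale) (simp_all add: algebra_simps)
qed (simp_all add: vector_space_axioms vector_space_pm_scale vector_space_times pm_sum_add algebra_simps)

lemma lin_ext_single [simp]: "lin_ext scale f (Poly_Mapping.single a c) = scale c (f a)"
  by (simp add: lin_ext_def pm_sum_single)

lemmas lin_ext_add = Vector_Spaces.linear.axioms(3)[OF linear_lin_ext, THEN module_hom.add]
  and lin_ext_scale = Vector_Spaces.linear.axioms(3)[OF linear_lin_ext, THEN module_hom.scale]
  and lin_ext_diff = Vector_Spaces.linear.axioms(3)[OF linear_lin_ext, THEN module_hom.diff]
  and lin_ext_zero = Vector_Spaces.linear.axioms(3)[OF linear_lin_ext, THEN module_hom.zero]

end

lemma additive_sum_list:
  fixes f :: "'a::ab_group_add \<Rightarrow> 'b::ab_group_add"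
  assumes "\<And>x y. f (x + y) = f x + f y"
  shows "f (sum_list xs) = sum_list (map f xs)"
  using assms[of 0 0] by (induction xs) (simp_all add: assms)

lemma sum_list_concat: "sum_list (concat xss) = sum_list (map sum_list xss)"
  for xss :: "'a::monoid_add list list"
  by (induction xss) simp_all

subsection \<open>Sweedler sums\<close>

text \<open>Multilinearity is only required modulo a subspace \<open>J\<close>, so that sums in a presented algebra,
  which is not a type, can be treated as well.\<close>

lemma (in vector_space) tensor_eq_sum:
  fixes s :: "'a \<Rightarrow> 'v::ab_group_add \<Rightarrow> 'v"
  assumes eq: "tensor_eq s ts us" and J: "subspace J"
    and add: "\<And>u x y v. F (u @ (x + y) # v) - F (u @ x # v) - F (u @ y # v) \<in> J"
    and sc: "\<And>u c x v. F (u @ s c x # v) - scale c (F (u @ x # v)) \<in> J"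
  shows "(\<Sum>t\<leftarrow>ts. F t) - (\<Sum>u\<leftarrow>us. F u) \<in> J"
proof -
  let ?\<Phi> = "lin_ext scale F"
  interpret \<Phi>: Vector_Spaces.linear free_scale scale ?\<Phi> by (rule linear_lin_ext)
  \<comment> \<open>The preimage of \<open>J\<close> under the linear extension of \<open>F\<close>
    is a subspace containing the tensor relations, hence also their span.\<close>
  have "free.subspace {p. ?\<Phi> p \<in> J}"
    by (rule \<Phi>.subspace_vimage[OF J, unfolded vimage_def])
  moreover have "tensor_relations s \<subseteq> {p. ?\<Phi> p \<in> J}"
    using add sc by (auto simp: tensor_relations_def \<Phi>.diff \<Phi>.scale)
  ultimately have "free.span (tensor_relations s) \<subseteq> {p. ?\<Phi> p \<in> J}"
    by (rule free.span_minimal[rotated])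
  with eq have "?\<Phi> ((\<Sum>t\<leftarrow>ts. word t) - (\<Sum>u\<leftarrow>us. word u)) \<in> J"
    by (auto simp: tensor_eq_def)
  moreover have "?\<Phi> (\<Sum>t\<leftarrow>xs. word t) = (\<Sum>t\<leftarrow>xs. F t)" for xs
    by (simp add: additive_sum_list[of ?\<Phi>] \<Phi>.add o_def)
  ultimately show ?thesis by (simp add: \<Phi>.diff)
qed

lemma case_list_snoc_const: "case_list p (\<lambda>_ _. q) (xs @ y # ys) = q"
  by (cases xs) simp_all

lemma (in vector_space) tensor_eq_bilinear:
  fixes s :: "'a \<Rightarrow> 'v::ab_group_add \<Rightarrow> 'v"
  assumes eq: "tensor_eq s [[a, b]. (a, b) \<leftarrow> ps] [[a, b]. (a, b) \<leftarrow> qs]"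
    and "\<And>x y b. f (x + y) b = f x b + f y b" "\<And>a x y. f a (x + y) = f a x + f a y"
    and "\<And>c x b. f (s c x) b = scale c (f x b)" "\<And>c a x. f a (s c x) = scale c (f a x)"
  shows "(\<Sum>(a, b)\<leftarrow>ps. f a b) = (\<Sum>(a, b)\<leftarrow>qs. f a b)"
proof -
  \<comment> \<open>\<open>tensor_relations\<close> contains relations between words of every
    length. The default 0 makes them hold trivially away from length two.\<close>
  define F where "F l = (case l of [a, b] \<Rightarrow> f a b | _ \<Rightarrow> 0)" for l
  have "(\<Sum>t\<leftarrow>[[a, b]. (a, b) \<leftarrow> ps]. F t) - (\<Sum>t\<leftarrow>[[a, b]. (a, b) \<leftarrow> qs]. F t) \<in> {0}"
  proof (rule tensor_eq_sum[OF eq])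
    show "F (u @ (x + y) # v) - F (u @ x # v) - F (u @ y # v) \<in> {0}" for u x y v
      by (cases u; cases "tl u"; cases v; cases "tl v") (simp_all add: F_def case_list_snoc_const assms(2-3))
    show "F (u @ s c x # v) - scale c (F (u @ x # v)) \<in> {0}" for u c x v
      by (cases u; cases "tl u"; cases v; cases "tl v") (simp_all add: F_def case_list_snoc_const assms(4-5))
  qed simp
  moreover have "(\<Sum>t\<leftarrow>[[a, b]. (a, b) \<leftarrow> ps]. F t) = (\<Sum>(a, b)\<leftarrow>ps. f a b)" for ps
    by (simp add: F_def o_def split_def)
  ultimately show ?thesis by simp
qed

lemma (in vector_space) tensor_eq_trilinear_mod:
  fixes s :: "'a \<Rightarrow> 'v::ab_group_add \<Rightarrow> 'v" and ps qs :: "('v \<times> 'v \<times> 'v) list"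
  assumes eq: "tensor_eq s (map (\<lambda>(a, b, c). [a, b, c]) ps) (map (\<lambda>(a, b, c). [a, b, c]) qs)"
    and J: "subspace J"
    and "\<And>x y b e. f (x + y) b e - f x b e - f y b e \<in> J" "\<And>c x b e. f (s c x) b e - scale c (f x b e) \<in> J"
    and "\<And>a x y e. f a (x + y) e - f a x e - f a y e \<in> J" "\<And>c a x e. f a (s c x) e - scale c (f a x e) \<in> J"
    and "\<And>a b x y. f a b (x + y) - f a b x - f a b y \<in> J" "\<And>c a b x. f a b (s c x) - scale c (f a b x) \<in> J"
  shows "(\<Sum>(a, b, c)\<leftarrow>ps. f a b c) - (\<Sum>(a, b, c)\<leftarrow>qs. f a b c) \<in> J"
proof -
  define F where "F l = (case l of [a, b, c] \<Rightarrow> f a b c | _ \<Rightarrow> 0)" for l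
  have "(\<Sum>t\<leftarrow>map (\<lambda>(a, b, c). [a, b, c]) ps. F t) - (\<Sum>t\<leftarrow>map (\<lambda>(a, b, c). [a, b, c]) qs. F t) \<in> J"
  proof (rule tensor_eq_sum[OF eq J])
    show "F (u @ (x + y) # v) - F (u @ x # v) - F (u @ y # v) \<in> J" for u x y v
      by (cases u; cases "tl u"; cases "tl (tl u)"; cases v; cases "tl v"; cases "tl (tl v)")
        (simp_all add: F_def case_list_snoc_const assms subspace_0[OF J])
    show "F (u @ s c x # v) - scale c (F (u @ x # v)) \<in> J" for u c x v
      by (cases u; cases "tl u"; cases "tl (tl u)"; cases v; cases "tl v"; cases "tl (tl v)")
        (simp_all add: F_def case_list_snoc_const assms subspace_0[OF J])
  qed
  moreover have "(\<Sum>t\<leftarrow>map (\<lambda>(a, b, c). [a, b, c]) ps. F t) = (\<Sum>(a, b, c)\<leftarrow>ps. f a b c)" for ps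
    by (simp add: F_def o_def split_def)
  ultimately show ?thesis by simp
qed

subsection \<open>Presented algebras\<close>

lemma word_mult: "(word u :: 'a list \<Rightarrow>\<^sub>0 'k::field) * word v = word (u @ v)"
  by (simp add: mult_single plus_list_def)

lemma word_Nil: "word [] = 1"
  by (simp add: zero_list_def flip: single_one)

lemma free_scale_mult_left: "free_scale c p * q = free_scale c (p * q)"
  for p q :: "'a list \<Rightarrow>\<^sub>0 'k::field"
  by (simp add: free_scale_def mult_map_scale_conv_mult mult.assoc)

lemma free_scale_mult_right: "p * free_scale c q = free_scale c (p * q)"
  for p q :: "'a list \<Rightarrow>\<^sub>0 'k::field"
proof -
  \<comment> \<open>Scaling is left multiplication by a constant, so the claim is that constants are
    central.\<close>
  have comm: "r * Poly_Mapping.single 0 c = Poly_Mapping.single 0 c * r" for r :: "'a list \<Rightarrow>\<^sub>0 'k"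
  proof (induction r rule: pm_induct)
    case (add r t) then show ?case by (simp add: distrib_left distrib_right)
  qed (simp_all add: mult_single mult.commute)
  show ?thesis
    unfolding free_scale_def mult_map_scale_conv_mult using comm[of p] by (simp flip: mult.assoc)
qed

definition two_sided :: "('a list \<Rightarrow>\<^sub>0 'k::field) set \<Rightarrow> bool" where
  "two_sided J \<longleftrightarrow> free.subspace J \<and> (\<forall>p\<in>J. \<forall>q. q * p \<in> J \<and> p * q \<in> J)"

lemma two_sidedI:
  assumes J: "free.subspace J"
    and l: "\<And>u p. p \<in> J \<Longrightarrow> word u * p \<in> J" and r: "\<And>u p. p \<in> J \<Longrightarrow> p * word u \<in> J"
  shows "two_sided J"
proof -
  have "q * p \<in> J \<and> p * q \<in> J" if p: "p \<in> J" for p q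
  proof (induction q rule: pm_induct)
    case zero then show ?case by (simp add: free.subspace_0[OF J])
  next
    case (single u c)
    have "Poly_Mapping.single u c = free_scale c (word u)" by simp
    then show ?case
      using free.subspace_scale[OF J l[OF p], of c u] free.subspace_scale[OF J r[OF p], of c u]
      by (simp only: free_scale_mult_left free_scale_mult_right)
  next
    case (add q q')
    then show ?case by (simp add: distrib_left distrib_right free.subspace_add[OF J])
  qed
  with J show ?thesis by (simp add: two_sided_def)
qed

text \<open>Multiplying a relation between single letters by words on both sides moves it to an
  arbitrary position.\<close>

lemma two_sided_tensor_relations:
  assumes J: "two_sided J"
    and add: "\<And>x y. word [x + y] - word [x] - word [y] \<in> J"
    and sc: "\<And>c x. word [s c x] - free_scale c (word [x]) \<in> J"
  shows "tensor_relations s \<subseteq> J"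
proof -
  have "word u * p * word v \<in> J" if "p \<in> J" for u v p
    using J that by (simp add: two_sided_def)
  from this[OF add] this[OF sc] show ?thesis
    unfolding tensor_relations_def
    by (auto simp: left_diff_distrib right_diff_distrib word_mult free_scale_mult_left free_scale_mult_right
        simp del: free_scale_single)
qed

text \<open>A surjection from the free algebra compatible with all operations. The ring laws of
  \<open>A\<close> are inherited along it, and each stage of the nested quotient has this form, so
  that one can calculate with noncommutative polynomials instead of cosets.\<close>

locale presentation =
  fixes \<pi> :: "('x list \<Rightarrow>\<^sub>0 'k::field) \<Rightarrow> 'a" and A :: "('k, 'a) module" (structure)
  assumes carrier_eq: "carrier A = range \<pi>"
    and add_eq: "\<pi> p \<oplus> \<pi> q = \<pi> (p + q)"
    and mult_eq: "\<pi> p \<otimes> \<pi> q = \<pi> (p * q)"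
    and smult_eq: "c \<odot>\<^bsub>A\<^esub> \<pi> p = \<pi> (free_scale c p)"
    and one_eq: "\<one> = \<pi> 1"
    and zero_eq: "\<zero> = \<pi> 0"
begin

lemma ring: "ring A"
proof (rule ringI)
  show "abelian_group A"
  proof (rule abelian_groupI)
    fix x assume "x \<in> carrier A"
    then obtain p where "x = \<pi> p" by (auto simp: carrier_eq)
    then show "\<exists>y\<in>carrier A. y \<oplus> x = \<zero>"
      by (intro bexI[of _ "\<pi> (- p)"]) (auto simp: carrier_eq add_eq zero_eq)
  qed (auto simp: carrier_eq add_eq zero_eq add_ac)
  show "Group.monoid A"
    by (rule monoidI) (auto simp: carrier_eq mult_eq one_eq mult.assoc)
qed (auto simp: carrier_eq mult_eq add_eq algebra_simps)

sublocale ring A by (rule ring)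

lemma in_carrier [simp, intro]: "\<pi> p \<in> carrier A"
  by (simp add: carrier_eq)

lemma smult_closed [simp, intro]: "x \<in> carrier A \<Longrightarrow> c \<odot>\<^bsub>A\<^esub> x \<in> carrier A"
  by (auto simp: carrier_eq smult_eq)

lemma minus_eq_class: "\<ominus> \<pi> p = \<pi> (- p)"
  by (rule minus_equality) (simp_all add: add_eq zero_eq)

lemma eq_iff: "\<pi> p = \<pi> q \<longleftrightarrow> \<pi> (p - q) = \<zero>"
proof
  assume "\<pi> p = \<pi> q"
  then have "\<pi> p \<oplus> \<pi> (- q) = \<pi> q \<oplus> \<pi> (- q)" by simp
  then show "\<pi> (p - q) = \<zero>" by (simp add: add_eq zero_eq)
next
  assume "\<pi> (p - q) = \<zero>"
  then have "\<pi> (p - q) \<oplus> \<pi> q = \<zero> \<oplus> \<pi> q" by simp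
  then show "\<pi> p = \<pi> q" by (simp add: add_eq zero_eq)
qed

lemma finsum_eq: "finite S \<Longrightarrow> (\<Oplus>i\<in>S. \<pi> (f i)) = \<pi> (\<Sum>i\<in>S. f i)"
  by (induction S rule: finite_induct) (simp_all add: zero_eq add_eq Pi_def)

definition kernel :: "('x list \<Rightarrow>\<^sub>0 'k) set" where
  "kernel = {p. \<pi> p = \<zero>}"

lemma eq_iff_kernel: "\<pi> p = \<pi> q \<longleftrightarrow> p - q \<in> kernel"
  by (simp add: kernel_def eq_iff)

lemma two_sided_kernel: "two_sided kernel"
  unfolding two_sided_def
proof (intro conjI ballI allI)
  show "free.subspace kernel"
  proof (rule free.subspaceI)
    fix p q c assume *: "p \<in> kernel"
    \<comment> \<open>Scaling becomes multiplication by a constant, so that a scalar multiple of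
      zero vanishes by the ring laws.\<close>
    have "\<pi> (free_scale c p) = \<pi> (free_scale c 1) \<otimes> \<pi> p"
      by (simp add: mult_eq free_scale_mult_left)
    with * show "free_scale c p \<in> kernel" by (simp add: kernel_def)
    assume "q \<in> kernel"
    with * show "p + q \<in> kernel" by (simp add: kernel_def flip: add_eq)
  qed (simp add: kernel_def zero_eq)
qed (simp_all add: kernel_def flip: mult_eq)

lemma ideal_image:
  assumes J: "two_sided J"
  shows "ideal (\<pi> ` J) A"
proof (rule idealI[OF ring])
  note sub = J[unfolded two_sided_def, THEN conjunct1]
  show "subgroup (\<pi> ` J) (add_monoid A)"
  proof (rule add.subgroupI)
    show "\<pi> ` J \<noteq> {}" using free.subspace_0[OF sub] by auto
    show "\<ominus> a \<in> \<pi> ` J" if "a \<in> \<pi> ` J" for a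
      using that free.subspace_neg[OF sub] by (auto simp: minus_eq_class)
    show "a \<oplus> b \<in> \<pi> ` J" if "a \<in> \<pi> ` J" "b \<in> \<pi> ` J" for a b
      using that free.subspace_add[OF sub] by (auto simp: add_eq)
  qed auto
  fix a x assume "a \<in> \<pi> ` J" "x \<in> carrier A"
  then obtain p q where "a = \<pi> p" "p \<in> J" "x = \<pi> q" by (auto simp: carrier_eq)
  with J show "x \<otimes> a \<in> \<pi> ` J" "a \<otimes> x \<in> \<pi> ` J"
    by (auto simp: mult_eq two_sided_def)
qed

context
  fixes G assumes G: "G \<subseteq> carrier A"
begin

interpretation I: ideal "Idl G" A
  by (rule genideal_ideal[OF G])

lemma quot_map_eq_zero_iff: "quot_map A G (\<pi> p) = Idl G \<longleftrightarrow> \<pi> p \<in> Idl G"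
  unfolding quot_map_def
  by (metis I.a_rcos_const I.rcos_const_imp_mem in_carrier)

text \<open>Scalar multiplication in the quotient is a union over all representatives. They
  contribute the same coset, since the ideal is closed under multiplication by the constant
  \<open>c\<close>.\<close>

lemma quot_map_smult:
  assumes "X = quot_map A G (\<pi> p)"
  shows "(\<Union>x\<in>X. quot_map A G (c \<odot>\<^bsub>A\<^esub> x)) = quot_map A G (\<pi> (free_scale c p))"
proof -
  have ne: "\<pi> p \<in> X"
    unfolding assms quot_map_def by (rule I.a_rcos_self) simp
  have "quot_map A G (c \<odot>\<^bsub>A\<^esub> x) = quot_map A G (\<pi> (free_scale c p))" if "x \<in> X" for x
  proof -
    from that obtain i where i: "i \<in> Idl G" "x = i \<oplus> \<pi> p"
      by (auto simp: assms quot_map_def a_r_coset_def r_coset_def)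
    then obtain q where q: "i = \<pi> q" using I.a_Hcarr carrier_eq by blast
    have "\<pi> (free_scale c 1) \<otimes> \<pi> q \<in> Idl G" using i q by (auto intro: I.I_l_closed)
    then have "\<pi> (free_scale c q) \<in> Idl G" by (simp add: mult_eq free_scale_mult_left)
    moreover have "c \<odot>\<^bsub>A\<^esub> x = \<pi> (free_scale c q) \<oplus> \<pi> (free_scale c p)"
      by (simp add: i q add_eq smult_eq free.scale_right_distrib)
    moreover have "\<pi> (free_scale c q) \<oplus> \<pi> r \<ominus> \<pi> r = \<pi> (free_scale c q)" for r
      by (simp add: a_minus_def minus_eq_class add_eq)
    ultimately show ?thesis
      unfolding quot_map_def
      using quotient_eq_iff_same_a_r_cos[OF I.is_ideal, of "c \<odot>\<^bsub>A\<^esub> x" "\<pi> (free_scale c p)"]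
      by simp
  qed
  with ne show ?thesis by blast
qed

lemma presentation_quot: "presentation (\<lambda>p. quot_map A G (\<pi> p)) (quot_algebra A G)"
proof -
  interpret h: ring_hom_ring A "A Quot Idl G" "(+>) (Idl G)"
    by (rule I.rcos_ring_hom_ring)
  let ?B = "quot_algebra A G"
  have s: "carrier ?B = carrier (A Quot Idl G)" "mult ?B = mult (A Quot Idl G)"
    "add ?B = add (A Quot Idl G)" "one ?B = one (A Quot Idl G)" "zero ?B = zero (A Quot Idl G)"
    "smult ?B = (\<lambda>c X. \<Union>x\<in>X. quot_map A G (c \<odot>\<^bsub>A\<^esub> x))"
    by (simp_all add: quot_algebra_def ring.defs module.defs)
  show ?thesis
  proof
    show "carrier ?B = range (\<lambda>p. quot_map A G (\<pi> p))"
      by (auto simp: s FactRing_def A_RCOSETS_def RCOSETS_def a_r_coset_def quot_map_def carrier_eq)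
    show "smult ?B c (quot_map A G (\<pi> p)) = quot_map A G (\<pi> (free_scale c p))" for c p
      by (simp add: s quot_map_smult[OF refl])
    show "zero ?B = quot_map A G (\<pi> 0)"
      using h.hom_zero by (simp add: s quot_map_def flip: zero_eq)
    show "one ?B = quot_map A G (\<pi> 1)"
      using h.hom_one by (simp add: s quot_map_def flip: one_eq)
  qed (simp_all add: s quot_map_def flip: h.hom_add h.hom_mult add_eq mult_eq)
qed

lemma kernel_quot_le: "kernel \<subseteq> presentation.kernel (\<lambda>p. quot_map A G (\<pi> p)) (quot_algebra A G)"
proof -
  interpret B: presentation "\<lambda>p. quot_map A G (\<pi> p)" "quot_algebra A G" by (rule presentation_quot)
  show ?thesis
    by (auto simp: kernel_def B.kernel_def zero_eq B.zero_eq)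
qed

lemma relations_quot_le: "\<pi> p \<in> G \<Longrightarrow> p \<in> presentation.kernel (\<lambda>p. quot_map A G (\<pi> p)) (quot_algebra A G)"
proof -
  interpret B: presentation "\<lambda>p. quot_map A G (\<pi> p)" "quot_algebra A G" by (rule presentation_quot)
  assume "\<pi> p \<in> G"
  then have "\<pi> p \<in> Idl G" using genideal_self[OF G] by auto
  moreover have "\<pi> 0 \<in> Idl G" by (metis I.zero_closed zero_eq)
  ultimately show ?thesis
    unfolding B.kernel_def B.zero_eq mem_Collect_eq
    using quot_map_eq_zero_iff by metis
qed

text \<open>Together with \<open>kernel_quot_le\<close> and \<open>relations_quot_le\<close>, the
  universal property of the quotient in terms of kernels: the new kernel is the least two-sided
  ideal of the free algebra that contains the old one and representatives of the relations.\<close>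

lemma kernel_quot_minimal:
  assumes J: "two_sided J" and "kernel \<subseteq> J" and GJ: "G \<subseteq> \<pi> ` J"
  shows "presentation.kernel (\<lambda>p. quot_map A G (\<pi> p)) (quot_algebra A G) \<subseteq> J"
proof -
  interpret B: presentation "\<lambda>p. quot_map A G (\<pi> p)" "quot_algebra A G" by (rule presentation_quot)
  show ?thesis
  proof
    fix p assume "p \<in> B.kernel"
    moreover have "\<pi> 0 \<in> Idl G" by (metis I.zero_closed zero_eq)
    ultimately have "\<pi> p \<in> Idl G"
      unfolding B.kernel_def B.zero_eq mem_Collect_eq using quot_map_eq_zero_iff by metis
    then have "\<pi> p \<in> \<pi> ` J"
      using genideal_minimal[OF ideal_image[OF J] GJ] by auto
    \<comment> \<open>\<open>p\<close> and \<open>q\<close> differ by an element of the old kernel,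
      which is contained in \<open>J\<close>.\<close>
    then obtain q where q: "q \<in> J" "\<pi> p = \<pi> q" by auto
    then have "p - q \<in> J" using assms(2) eq_iff_kernel by auto
    then show "p \<in> J"
      using free.subspace_add[of J "p - q" q] q J by (simp add: two_sided_def)
  qed
qed

end

end

section \<open>The tower of quotients from the free algebra to T(V)#_M H\<close>

lemma presentation_free: "presentation (\<lambda>p. p) (free_algebra :: ('k::field, 'x list \<Rightarrow>\<^sub>0 'k) module)"
  by unfold_locales (simp_all add: free_algebra_def type_algebra_def)

interpretation free_pres: presentation "\<lambda>p. p" "free_algebra :: ('k::field, 'x list \<Rightarrow>\<^sub>0 'k) module"
  by (rule presentation_free)

lemma presentation_tensor: "presentation (tensor_class s) (tensor_algebra s)"
  using free_pres.presentation_quot[of "tensor_relations s"]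
  by (simp add: free_pres.carrier_eq tensor_class_def[abs_def] tensor_algebra_def)

interpretation tens: presentation "tensor_class s" "tensor_algebra s" for s
  by (rule presentation_tensor)

abbreviation tensor_kernel where
  "tensor_kernel s \<equiv> presentation.kernel (tensor_class s) (tensor_algebra s)"

abbreviation TH_kernel where
  "TH_kernel s inc HB \<equiv> presentation.kernel (TH_class s inc HB) (TH_algebra s inc HB)"

abbreviation smash_kernel where
  "smash_kernel comult s act inc HB \<equiv>
    presentation.kernel (smash_class comult s act inc HB) (smash_algebra comult s act inc HB)"

lemma tensor_relations_kernel: "tensor_relations s \<subseteq> tensor_kernel s"
  using free_pres.relations_quot_le[of "tensor_relations s"]
  by (auto simp: free_pres.carrier_eq tensor_class_def[abs_def] tensor_algebra_def)

lemma tensor_kernel_minimal: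
  assumes "two_sided J" "tensor_relations s \<subseteq> J"
  shows "tensor_kernel s \<subseteq> J"
proof -
  have "free_pres.kernel \<subseteq> J"
    using assms(1) by (auto simp: free_pres.kernel_def free_pres.zero_eq two_sided_def free.subspace_0)
  with assms show ?thesis
  using free_pres.kernel_quot_minimal[of "tensor_relations s" J]
  by (simp add: free_pres.carrier_eq tensor_class_def[abs_def] tensor_algebra_def)
qed

lemma presentation_TH: "presentation (TH_class s inc HB) (TH_algebra s inc HB)"
  using tens.presentation_quot[of "tensor_class s ` H_relations inc HB" s]
  by (auto simp: tens.carrier_eq TH_class_def[abs_def] TH_algebra_def)

interpretation TH: presentation "TH_class s inc HB" "TH_algebra s inc HB" for s inc HB
  by (rule presentation_TH)

lemma presentation_smash: "presentation (smash_class comult s act inc HB) (smash_algebra comult s act inc HB)"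
  using TH.presentation_quot[of "TH_class s inc HB ` JM_relations comult act inc" s inc HB]
  by (auto simp: TH.carrier_eq smash_class_def[abs_def] smash_algebra_def)

lemma smash_kernel_relations:
  "tensor_relations s \<union> H_relations inc HB \<union> JM_relations comult act inc \<subseteq> smash_kernel comult s act inc HB"
proof -
  have 1: "tensor_kernel s \<subseteq> TH_kernel s inc HB"
    using tens.kernel_quot_le[of "tensor_class s ` H_relations inc HB" s]
    by (auto simp: tens.carrier_eq TH_class_def[abs_def] TH_algebra_def)
  have 2: "H_relations inc HB \<subseteq> TH_kernel s inc HB"
    using tens.relations_quot_le[of "tensor_class s ` H_relations inc HB" s]
    by (auto simp: tens.carrier_eq TH_class_def[abs_def] TH_algebra_def)
  have 3: "TH_kernel s inc HB \<subseteq> smash_kernel comult s act inc HB"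
    using TH.kernel_quot_le[of "TH_class s inc HB ` JM_relations comult act inc" s inc HB]
    by (auto simp: TH.carrier_eq smash_class_def[abs_def] smash_algebra_def)
  have 4: "JM_relations comult act inc \<subseteq> smash_kernel comult s act inc HB"
    using TH.relations_quot_le[of "TH_class s inc HB ` JM_relations comult act inc" s inc HB]
    by (auto simp: TH.carrier_eq smash_class_def[abs_def] smash_algebra_def)
  show ?thesis using tensor_relations_kernel 1 2 3 4 by blast
qed

text \<open>With \<open>smash_kernel_relations\<close> this determines the kernel in one step: it is
  the least two-sided ideal of the free algebra on M containing all three families of relations. The
  nesting of the quotients can be forgotten from here on.\<close>

lemma smash_kernel_minimal:
  assumes J: "two_sided J"
    and "tensor_relations s \<union> H_relations inc HB \<union> JM_relations comult act inc \<subseteq> J"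
  shows "smash_kernel comult s act inc HB \<subseteq> J"
proof -
  have "tensor_kernel s \<subseteq> J" using assms tensor_kernel_minimal by blast
  then have "TH_kernel s inc HB \<subseteq> J"
    using tens.kernel_quot_minimal[of "tensor_class s ` H_relations inc HB" s J] assms
    by (auto simp: tens.carrier_eq TH_class_def[abs_def] TH_algebra_def)
  then show ?thesis
    using TH.kernel_quot_minimal[of "TH_class s inc HB ` JM_relations comult act inc" s inc HB J] assms
    by (simp add: TH.carrier_eq smash_class_def[abs_def] smash_algebra_def image_mono)
qed

subsection \<open>Bases of presented algebras\<close>

text \<open>Coefficients are attached to indices and not to vectors, so repetitions in \<beta> are
  harmless.\<close>

lemma (in vector_space) span_image_eq_lin_ext:
  "span (\<beta> ` T) = {lin_ext scale \<beta> c | c. Poly_Mapping.keys c \<subseteq> T}"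
proof
  have "subspace {lin_ext scale \<beta> c | c. Poly_Mapping.keys c \<subseteq> T}"
  proof (rule subspaceI)
    show "0 \<in> {lin_ext scale \<beta> c | c. Poly_Mapping.keys c \<subseteq> T}"
      by (auto intro!: exI[of _ 0] simp: lin_ext_zero)
    show "x + y \<in> {lin_ext scale \<beta> c | c. Poly_Mapping.keys c \<subseteq> T}"
      if "x \<in> {lin_ext scale \<beta> c | c. Poly_Mapping.keys c \<subseteq> T}" "y \<in> {lin_ext scale \<beta> c | c. Poly_Mapping.keys c \<subseteq> T}" for x y
    proof -
      from that obtain c d where "x = lin_ext scale \<beta> c" "y = lin_ext scale \<beta> d"
        "Poly_Mapping.keys c \<subseteq> T" "Poly_Mapping.keys d \<subseteq> T" by auto
      then show ?thesis using keys_add[of c d]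
        by (auto intro!: exI[of _ "c + d"] simp: lin_ext_add)
    qed
    show "scale a x \<in> {lin_ext scale \<beta> c | c. Poly_Mapping.keys c \<subseteq> T}"
      if "x \<in> {lin_ext scale \<beta> c | c. Poly_Mapping.keys c \<subseteq> T}" for a x
    proof -
      from that obtain c where "x = lin_ext scale \<beta> c" "Poly_Mapping.keys c \<subseteq> T" by auto
      then show ?thesis
        by (auto intro!: exI[of _ "free_scale a c"] simp: lin_ext_scale in_keys_iff)
    qed
  qed
  moreover have "\<beta> ` T \<subseteq> {lin_ext scale \<beta> c | c. Poly_Mapping.keys c \<subseteq> T}"
  proof
    fix x assume "x \<in> \<beta> ` T"
    then obtain j where "j \<in> T" "x = \<beta> j" by auto
    then show "x \<in> {lin_ext scale \<beta> c | c. Poly_Mapping.keys c \<subseteq> T}"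
      by (auto intro!: exI[of _ "Poly_Mapping.single j 1"])
  qed
  ultimately show "span (\<beta> ` T) \<subseteq> {lin_ext scale \<beta> c | c. Poly_Mapping.keys c \<subseteq> T}"
    by (rule span_minimal[rotated])
  show "{lin_ext scale \<beta> c | c. Poly_Mapping.keys c \<subseteq> T} \<subseteq> span (\<beta> ` T)"
  proof safe
    fix c :: "'c \<Rightarrow>\<^sub>0 'a" assume "Poly_Mapping.keys c \<subseteq> T"
    then show "lin_ext scale \<beta> c \<in> span (\<beta> ` T)"
      unfolding lin_ext_def pm_sum_def by (intro span_sum span_scale span_base) auto
  qed
qed

text \<open>A basis of \<open>A\<close> given by polynomials \<beta> and tested in the free algebra
  modulo the kernel. Independence is that of an indexed family, so it includes injectivity of the
  indexing (\<open>inj_on_basis\<close>).\<close>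

locale presentation_basis = presentation \<pi> A
  for \<pi> :: "('x list \<Rightarrow>\<^sub>0 'k::field) \<Rightarrow> 'a" and A :: "('k, 'a) module" (structure) +
  fixes \<beta> :: "'j \<Rightarrow> ('x list \<Rightarrow>\<^sub>0 'k)" and J :: "'j set"
  assumes spanning: "\<exists>q\<in>free.span (\<beta> ` J). p - q \<in> kernel"
    and independent: "Poly_Mapping.keys c \<subseteq> J \<Longrightarrow> lin_ext free_scale \<beta> c \<in> kernel \<Longrightarrow> c = 0"
begin

definition comb :: "('j \<Rightarrow>\<^sub>0 'k) \<Rightarrow> 'a" where
  "comb c = \<pi> (lin_ext free_scale \<beta> c)"

lemma comb_add: "comb (c + d) = comb c \<oplus> comb d"
  by (simp add: comb_def add_eq free.lin_ext_add)

lemma comb_scale: "comb (free_scale a c) = a \<odot>\<^bsub>A\<^esub> comb c"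
  by (simp add: comb_def smult_eq free.lin_ext_scale)

lemma comb_zero: "comb 0 = \<zero>"
  by (simp add: comb_def zero_eq free.lin_ext_zero)

lemma comb_single [simp]: "comb (Poly_Mapping.single j 1) = \<pi> (\<beta> j)"
  by (simp add: comb_def)

lemma comb_in_carrier [simp, intro]: "comb c \<in> carrier A"
  by (simp add: comb_def)

lemma comb_sum: "finite N \<Longrightarrow> comb (sum e N) = (\<Oplus>n\<in>N. comb (e n))"
  by (induction N rule: finite_induct) (auto simp: comb_zero comb_add)

lemma comb_inj:
  assumes "Poly_Mapping.keys c \<subseteq> J" "Poly_Mapping.keys d \<subseteq> J" "comb c = comb d"
  shows "c = d"
proof -
  have "Poly_Mapping.keys (c - d) \<subseteq> Poly_Mapping.keys c \<union> Poly_Mapping.keys d" by (auto simp: in_keys_iff lookup_minus)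
  moreover have "lin_ext free_scale \<beta> (c - d) \<in> kernel"
    using assms(3) by (simp add: comb_def eq_iff_kernel free.lin_ext_diff)
  ultimately show ?thesis using independent[of "c - d"] assms by auto
qed

lemma comb_surj: "a \<in> carrier A \<Longrightarrow> \<exists>c. Poly_Mapping.keys c \<subseteq> J \<and> a = comb c"
proof -
  assume "a \<in> carrier A"
  then obtain p where p: "a = \<pi> p" by (auto simp: carrier_eq)
  obtain q where "q \<in> free.span (\<beta> ` J)" "p - q \<in> kernel" using spanning by blast
  then show ?thesis
    by (auto simp: p comb_def eq_iff_kernel free.span_image_eq_lin_ext)
qed

lemma inj_on_basis: "inj_on (\<lambda>j. \<pi> (\<beta> j)) J"
proof (rule inj_onI)
  fix i j assume *: "i \<in> J" "j \<in> J" "\<pi> (\<beta> i) = \<pi> (\<beta> j)"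
  then have "Poly_Mapping.single i (1::'k) = Poly_Mapping.single j 1"
    by (intro comb_inj) auto
  then show "i = j" by (metis keys_single singletonD singletonI zero_neq_one)
qed

lemma alg_span_eq:
  assumes T: "T \<subseteq> J"
  shows "alg_span A ((\<lambda>j. \<pi> (\<beta> j)) ` T) = {comb c | c. Poly_Mapping.keys c \<subseteq> T}"
proof (intro equalityI subsetI)
  fix x assume "x \<in> alg_span A ((\<lambda>j. \<pi> (\<beta> j)) ` T)"
  then obtain c S where S: "finite S" "S \<subseteq> (\<lambda>j. \<pi> (\<beta> j)) ` T"
    and x: "x = (\<Oplus>b\<in>S. c b \<odot>\<^bsub>A\<^esub> b)"
    by (auto simp: alg_span_def)
  define g where "g = inv_into T (\<lambda>j. \<pi> (\<beta> j))"
  have g: "g b \<in> T" "b = \<pi> (\<beta> (g b))" if "b \<in> S" for b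
    using that S(2) inv_into_into[of b "\<lambda>j. \<pi> (\<beta> j)" T] f_inv_into_f[of b "\<lambda>j. \<pi> (\<beta> j)" T]
    by (auto simp: g_def)
  have SA: "S \<subseteq> carrier A" using S(2) by auto
  have "x = (\<Oplus>b\<in>S. \<pi> (free_scale (c b) (\<beta> (g b))))"
    unfolding x by (rule finsum_cong') (use SA in \<open>auto simp flip: smult_eq g(2)\<close>)
  also have "\<dots> = \<pi> (\<Sum>b\<in>S. free_scale (c b) (\<beta> (g b)))"
    by (rule finsum_eq) fact
  finally have "x = \<pi> (\<Sum>b\<in>S. free_scale (c b) (\<beta> (g b)))" .
  moreover have "(\<Sum>b\<in>S. free_scale (c b) (\<beta> (g b))) \<in> free.span (\<beta> ` T)"
    by (intro free.span_sum free.span_scale free.span_base imageI g)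
  ultimately show "x \<in> {comb c | c. Poly_Mapping.keys c \<subseteq> T}"
    by (auto simp: free.span_image_eq_lin_ext comb_def)
next
  fix x assume "x \<in> {comb c | c. Poly_Mapping.keys c \<subseteq> T}"
  then obtain c where c: "Poly_Mapping.keys c \<subseteq> T" "x = comb c" by auto
  let ?b = "\<lambda>j. \<pi> (\<beta> j)"
  have inj: "inj_on ?b (Poly_Mapping.keys c)" using inj_on_basis c T by (meson inj_on_subset)
  define g where "g = inv_into (Poly_Mapping.keys c) ?b"
  have g: "g (?b j) = j" if "j \<in> Poly_Mapping.keys c" for j unfolding g_def by (rule inv_into_f_f[OF inj that])
  have "x = (\<Oplus>j\<in>Poly_Mapping.keys c. Poly_Mapping.lookup c j \<odot>\<^bsub>A\<^esub> ?b j)"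
    by (simp add: c comb_def lin_ext_def pm_sum_def smult_eq finsum_eq)
  also have "\<dots> = (\<Oplus>j\<in>Poly_Mapping.keys c. Poly_Mapping.lookup c (g (?b j)) \<odot>\<^bsub>A\<^esub> ?b j)"
    by (rule finsum_cong') (auto simp: g smult_eq)
  also have "\<dots> = (\<Oplus>b\<in>?b ` Poly_Mapping.keys c. Poly_Mapping.lookup c (g b) \<odot>\<^bsub>A\<^esub> b)"
    by (rule finsum_reindex[symmetric]) (auto simp: smult_eq inj)
  finally have "x = (\<Oplus>b\<in>?b ` Poly_Mapping.keys c. Poly_Mapping.lookup c (g b) \<odot>\<^bsub>A\<^esub> b)" .
  moreover have "finite (?b ` Poly_Mapping.keys c)" "?b ` Poly_Mapping.keys c \<subseteq> ?b ` T" using c by auto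
  ultimately show "x \<in> alg_span A (?b ` T)" unfolding alg_span_def mem_Collect_eq
    by (intro exI[of _ "\<lambda>b. Poly_Mapping.lookup c (g b)"] exI[of _ "?b ` Poly_Mapping.keys c"] conjI)
qed

lemma alg_basis: "alg_basis A ((\<lambda>j. \<pi> (\<beta> j)) ` J)"
  unfolding alg_basis_def
proof (intro conjI)
  show "alg_span A ((\<lambda>j. \<pi> (\<beta> j)) ` J) = carrier A"
    using comb_surj by (auto simp: alg_span_eq)
  show "alg_independent A ((\<lambda>j. \<pi> (\<beta> j)) ` J)"
    unfolding alg_independent_def
  proof (intro allI impI ballI)
    fix S c b assume "finite S \<and> S \<subseteq> (\<lambda>j. \<pi> (\<beta> j)) ` J \<and> (\<Oplus>b\<in>S. c b \<odot>\<^bsub>A\<^esub> b) = \<zero>" and b: "b \<in> S"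
    then have S: "finite S" "S \<subseteq> (\<lambda>j. \<pi> (\<beta> j)) ` J" "(\<Oplus>b\<in>S. c b \<odot>\<^bsub>A\<^esub> b) = \<zero>" by auto
    define g where "g = inv_into J (\<lambda>j. \<pi> (\<beta> j))"
    have g: "g b \<in> J" "b = \<pi> (\<beta> (g b))" if "b \<in> S" for b
      using that S(2) inv_into_into[of b "\<lambda>j. \<pi> (\<beta> j)" J] f_inv_into_f[of b "\<lambda>j. \<pi> (\<beta> j)" J]
      by (auto simp: g_def)
    have g_eq: "g b = g b' \<longleftrightarrow> b = b'" if "b \<in> S" "b' \<in> S" for b b'
      using that g by metis
    have SA: "S \<subseteq> carrier A" using S(2) by auto
    \<comment> \<open>The combination over vectors is rewritten over indices. As \<open>g\<close> is
      injective on \<open>S\<close>, the coefficient of \<open>?d\<close> at \<open>g b\<close> is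
      just \<open>c b\<close>.\<close>
    let ?d = "\<Sum>b\<in>S. Poly_Mapping.single (g b) (c b)"
    have "comb (Poly_Mapping.single (g b) (c b)) = c b \<odot>\<^bsub>A\<^esub> b" if "b \<in> S" for b
      using g[OF that] by (simp add: comb_def flip: smult_eq)
    then have "comb ?d = (\<Oplus>b\<in>S. c b \<odot>\<^bsub>A\<^esub> b)"
      unfolding comb_sum[OF S(1)]
      by (intro finsum_cong') (use SA in auto)
    moreover have "Poly_Mapping.keys ?d \<subseteq> J"
    proof
      fix j assume "j \<in> Poly_Mapping.keys ?d"
      then have "(\<Sum>b\<in>S. c b when g b = j) \<noteq> 0"
        by (simp add: in_keys_iff lookup_sum lookup_single)
      then obtain b where "b \<in> S" "(c b when g b = j) \<noteq> 0" using sum.not_neutral_contains_not_neutral by blast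
      moreover from this have "g b = j" by (cases "g b = j") simp_all
      ultimately have "b \<in> S" "g b = j" by simp_all
      then show "j \<in> J" using g by auto
    qed
    ultimately have "?d = 0" using S(3) by (intro comb_inj) (auto simp: comb_zero)
    then have "(\<Sum>b'\<in>S. c b' when g b' = g b) = 0"
      by (metis (mono_tags, lifting) lookup_single lookup_sum lookup_zero sum.cong)
    also have "(\<Sum>b'\<in>S. c b' when g b' = g b) = (\<Sum>b'\<in>S. if b' = b then c b else 0)"
      by (rule sum.cong) (auto simp: g_eq b when_def)
    finally show "c b = 0" using S(1) b by simp
  qed
qed auto

text \<open>Every function \<open>deg\<close> on the index set of a basis grades the space: the
  components of an element are obtained by sorting its coordinates according to
  \<open>deg\<close>.\<close>

lemma graded:
  fixes deg :: "'j \<Rightarrow> nat"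
  shows "graded_with A (\<lambda>n. alg_span A ((\<lambda>j. \<pi> (\<beta> j)) ` {j \<in> J. deg j = n}))"
proof -
  let ?J = "\<lambda>n. {j \<in> J. deg j = n}"
  define D where "D n = {comb c | c. Poly_Mapping.keys c \<subseteq> ?J n}" for n
  have D: "alg_span A ((\<lambda>j. \<pi> (\<beta> j)) ` ?J n) = D n" for n
    unfolding D_def by (rule alg_span_eq) auto
  define part where "part c n = (\<Sum>j\<in>{j \<in> Poly_Mapping.keys c. deg j = n}. Poly_Mapping.single j (Poly_Mapping.lookup c j))"
    for c :: "'j \<Rightarrow>\<^sub>0 'k" and n
  have lookup_part: "Poly_Mapping.lookup (part c n) i = (Poly_Mapping.lookup c i when deg i = n)" for c n i
  proof -
    have "Poly_Mapping.lookup (part c n) i = (\<Sum>j\<in>{j \<in> Poly_Mapping.keys c. deg j = n}. if j = i then Poly_Mapping.lookup c i else 0)"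
      by (auto simp: part_def lookup_sum lookup_single when_def intro!: sum.cong)
    then show ?thesis by (auto simp: when_def in_keys_iff)
  qed
  have keys_part: "Poly_Mapping.keys (part c n) \<subseteq> ?J n" if "Poly_Mapping.keys c \<subseteq> J" for c n
    using that by (auto simp: in_keys_iff lookup_part when_def split: if_splits)
  have sub: "alg_subspace A (D n)" for n
    unfolding alg_subspace_def
  proof (intro conjI ballI allI)
    show "\<zero> \<in> D n" by (auto simp: D_def comb_zero intro!: exI[of _ 0])
    show "x \<oplus> y \<in> D n" if xy: "x \<in> D n" "y \<in> D n" for x y
    proof -
      from xy obtain c d where "x = comb c" "y = comb d" "Poly_Mapping.keys c \<subseteq> ?J n" "Poly_Mapping.keys d \<subseteq> ?J n"
        unfolding D_def by blast
      then show ?thesis using keys_add[of c d] unfolding D_def by (auto simp: comb_add intro!: exI[of _ "c + d"])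
    qed
    show "a \<odot>\<^bsub>A\<^esub> x \<in> D n" if "x \<in> D n" for a x
    proof -
      from that obtain c where "x = comb c" "Poly_Mapping.keys c \<subseteq> ?J n" unfolding D_def by blast
      then show ?thesis unfolding D_def
        by (auto simp: comb_scale in_keys_iff intro!: exI[of _ "free_scale a c"])
    qed
  qed (auto simp: D_def)
  have "\<exists>!d. (\<forall>n. d n \<in> D n) \<and> finite {n. d n \<noteq> \<zero>} \<and> a = (\<Oplus>n\<in>{n. d n \<noteq> \<zero>}. d n)"
    if a: "a \<in> carrier A" for a
  proof -
    obtain c where c: "Poly_Mapping.keys c \<subseteq> J" "a = comb c" using comb_surj[OF a] by blast
    let ?d = "\<lambda>n. comb (part c n)" and ?N = "{n. comb (part c n) \<noteq> \<zero>}"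
    have N0: "part c n = 0" if "n \<notin> ?N" for n
      using that keys_part[OF c(1), of n] comb_inj[of "part c n" 0] by (auto simp: comb_zero)
    have "part c n = 0" if "n \<notin> deg ` Poly_Mapping.keys c" for n
      by (rule poly_mapping_eqI) (use that in \<open>auto simp: lookup_part when_def in_keys_iff\<close>)
    then have "?N \<subseteq> deg ` Poly_Mapping.keys c"
      using comb_zero by fastforce
    then have fin: "finite ?N" by (rule finite_subset) simp
    have "c = (\<Sum>n\<in>?N. part c n)"
    proof (rule poly_mapping_eqI)
      fix i
      have "Poly_Mapping.lookup (\<Sum>n\<in>?N. part c n) i = (\<Sum>n\<in>?N. if n = deg i then Poly_Mapping.lookup c i else 0)"
        by (auto simp: lookup_sum lookup_part when_def intro!: sum.cong)
      also have "\<dots> = Poly_Mapping.lookup c i"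
      proof (cases "deg i \<in> ?N")
        case False
        have "Poly_Mapping.lookup c i = 0"
          using lookup_part[of c "deg i" i] N0[OF False] by simp
        then show ?thesis using fin by simp
      qed (use fin in simp)
      finally show "Poly_Mapping.lookup c i = Poly_Mapping.lookup (\<Sum>n\<in>?N. part c n) i" by simp
    qed
    then have ex_sum: "a = (\<Oplus>n\<in>?N. ?d n)" using comb_sum[OF fin, of "part c"] c(2) by simp
    have ex_in: "?d n \<in> D n" for n using keys_part[OF c(1)] unfolding D_def by blast
    have unique: "d n = ?d n"
      if d: "\<forall>n. d n \<in> D n" "finite {n. d n \<noteq> \<zero>}" "a = (\<Oplus>n\<in>{n. d n \<noteq> \<zero>}. d n)" for d n
    proof -
      \<comment> \<open>A competing decomposition is lifted to coordinates. Their sum must be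
        \<open>c\<close> because \<open>comb\<close> is injective on coordinates supported in
        \<open>J\<close>, and disjointness of the degrees then recovers each component.\<close>
      from d(1) have "\<forall>n. \<exists>e. Poly_Mapping.keys e \<subseteq> ?J n \<and> d n = comb e" unfolding D_def by blast
      then obtain e where "\<forall>n. Poly_Mapping.keys (e n) \<subseteq> ?J n \<and> d n = comb (e n)" by metis
      then have e: "Poly_Mapping.keys (e n) \<subseteq> ?J n" "d n = comb (e n)" for n by auto
      let ?M = "{n. d n \<noteq> \<zero>}"
      have M0: "e n = 0" if "n \<notin> ?M" for n
        using that e[of n] comb_inj[of "e n" 0] by (auto simp: comb_zero)
      have look: "Poly_Mapping.lookup (e m) i = (Poly_Mapping.lookup (e (deg i)) i when m = deg i)" for m i
        using e(1)[of m] by (auto simp: when_def in_keys_iff)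
      have "Poly_Mapping.keys (sum e ?M) \<subseteq> J"
      proof
        fix i assume "i \<in> Poly_Mapping.keys (sum e ?M)"
        then have "(\<Sum>m\<in>?M. Poly_Mapping.lookup (e m) i) \<noteq> 0" by (simp add: in_keys_iff lookup_sum)
        then obtain m where "Poly_Mapping.lookup (e m) i \<noteq> 0" by (metis (mono_tags, lifting) sum.neutral)
        then show "i \<in> J" using e(1)[of m] by (auto simp: in_keys_iff)
      qed
      moreover have "comb (sum e ?M) = comb c"
        using d(3) c(2) comb_sum[OF d(2), of e] by (simp flip: e(2))
      ultimately have ce: "sum e ?M = c" using comb_inj c(1) by blast
      have "e n = part c n"
      proof (rule poly_mapping_eqI)
        fix i
        have "Poly_Mapping.lookup c i = (\<Sum>m\<in>?M. Poly_Mapping.lookup (e m) i)" by (simp flip: ce add: lookup_sum)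
        also have "\<dots> = (\<Sum>m\<in>?M. if m = deg i then Poly_Mapping.lookup (e (deg i)) i else 0)"
          by (subst look) (auto simp: when_def intro!: sum.cong)
        also have "\<dots> = Poly_Mapping.lookup (e (deg i)) i"
          using d(2) M0[of "deg i"] by auto
        finally show "Poly_Mapping.lookup (e n) i = Poly_Mapping.lookup (part c n) i"
          by (subst look) (auto simp: lookup_part when_def)
      qed
      then show ?thesis using e(2) by simp
    qed
    show ?thesis
      by (rule ex1I[of _ ?d]) (use ex_sum ex_in fin in blast, use unique in \<open>intro ext, blast\<close>)
  qed
  then show ?thesis
    unfolding graded_with_def D using sub by blast
qed

end

text \<open>Both bases have the same index set, so coordinates with respect to one can be recombined
  with the other. The second claim covers every linear map with the prescribed values, as such a map
  necessarily sends \<open>b.comb c\<close> to \<open>b'.comb c\<close>.\<close>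

lemma basis_change:
  fixes A :: "('k::field, 'a) module" (structure)
  assumes "presentation_basis \<pi> A \<beta> J" "presentation_basis \<pi> A \<beta>' J"
  shows "\<exists>\<phi>. alg_linear A A \<phi> \<and> (\<forall>j\<in>J. \<phi> (\<pi> (\<beta> j)) = \<pi> (\<beta>' j))"
    and "alg_linear A A \<phi> \<Longrightarrow> \<forall>j\<in>J. \<phi> (\<pi> (\<beta> j)) = \<pi> (\<beta>' j) \<Longrightarrow> bij_betw \<phi> (carrier A) (carrier A)"
proof -
  interpret b: presentation_basis \<pi> A \<beta> J by fact
  interpret b': presentation_basis \<pi> A \<beta>' J by fact
  define coord where "coord a = (THE c. Poly_Mapping.keys c \<subseteq> J \<and> a = b.comb c)" for a
  have coord: "coord (b.comb c) = c" if "Poly_Mapping.keys c \<subseteq> J" for c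
    unfolding coord_def by (rule the_equality) (use that b.comb_inj in auto)
  have *: "alg_linear A A (b'.comb \<circ> coord)"
    unfolding alg_linear_def
  proof (intro conjI ballI allI)
    fix x y assume "x \<in> carrier A" "y \<in> carrier A"
    then obtain c d where "x = b.comb c" "y = b.comb d" "Poly_Mapping.keys c \<subseteq> J" "Poly_Mapping.keys d \<subseteq> J"
      using b.comb_surj by metis
    moreover have "Poly_Mapping.keys (c + d) \<subseteq> J" using calculation keys_add[of c d] by blast
    ultimately show "(b'.comb \<circ> coord) (x \<oplus> y) = (b'.comb \<circ> coord) x \<oplus> (b'.comb \<circ> coord) y"
      by (simp add: coord b'.comb_add flip: b.comb_add)
  next
    fix a x assume "x \<in> carrier A"
    then obtain c where "x = b.comb c" "Poly_Mapping.keys c \<subseteq> J"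
      using b.comb_surj by metis
    moreover have "Poly_Mapping.keys (free_scale a c) \<subseteq> J" using calculation by (auto simp: in_keys_iff)
    ultimately show "(b'.comb \<circ> coord) (a \<odot>\<^bsub>A\<^esub> x) = a \<odot>\<^bsub>A\<^esub> (b'.comb \<circ> coord) x"
      by (simp add: coord b'.comb_scale flip: b.comb_scale)
  qed auto
  have "(b'.comb \<circ> coord) (\<pi> (\<beta> j)) = \<pi> (\<beta>' j)" if "j \<in> J" for j
    using that coord[of "Poly_Mapping.single j 1"] by simp
  with * show "\<exists>\<phi>. alg_linear A A \<phi> \<and> (\<forall>j\<in>J. \<phi> (\<pi> (\<beta> j)) = \<pi> (\<beta>' j))" by blast
next
  interpret b: presentation_basis \<pi> A \<beta> J by fact
  interpret b': presentation_basis \<pi> A \<beta>' J by fact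
  assume lin: "alg_linear A A \<phi>" and \<phi>: "\<forall>j\<in>J. \<phi> (\<pi> (\<beta> j)) = \<pi> (\<beta>' j)"
  have eq: "\<phi> (b.comb c) = b'.comb c" if "Poly_Mapping.keys c \<subseteq> J" for c
  proof -
    have "\<phi> (b.comb (\<Sum>j\<in>S. Poly_Mapping.single j (Poly_Mapping.lookup c j))) = b'.comb (\<Sum>j\<in>S. Poly_Mapping.single j (Poly_Mapping.lookup c j))"
      if "finite S" "S \<subseteq> J" for S
      using that
    proof (induction S rule: finite_induct)
      case empty
      \<comment> \<open>\<open>alg_linear\<close> does not state that zero goes to zero; this
        follows from homogeneity at the scalar 0.\<close>
      have "\<phi> (0 \<odot>\<^bsub>A\<^esub> b.comb 0) = 0 \<odot>\<^bsub>A\<^esub> \<phi> (b.comb 0)" using lin by (auto simp: alg_linear_def)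
      moreover have "0 \<odot>\<^bsub>A\<^esub> x = \<zero>" if "x \<in> carrier A" for x
        using that by (auto simp: b.carrier_eq b.smult_eq b.zero_eq)
      moreover have "\<phi> (b.comb 0) \<in> carrier A" using lin by (auto simp: alg_linear_def)
      ultimately show ?case by (simp add: b.comb_zero b'.comb_zero)
    next
      case (insert j S)
      let ?s = "free_scale (Poly_Mapping.lookup c j) (Poly_Mapping.single j 1) :: _ \<Rightarrow>\<^sub>0 'k"
      have "\<phi> (b.comb ?s) = b'.comb ?s"
        unfolding b.comb_scale b'.comb_scale using lin \<phi> insert by (simp add: alg_linear_def)
      with insert lin show ?case
        by (simp add: b.comb_add b'.comb_add alg_linear_def)
    qed
    from this[of "Poly_Mapping.keys c"] that show ?thesis using pm_sum_id[of c] by (simp add: pm_sum_def)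
  qed
  show "bij_betw \<phi> (carrier A) (carrier A)"
    unfolding bij_betw_def
  proof (intro conjI equalityI subsetI inj_onI)
    fix x y assume "x \<in> carrier A" "y \<in> carrier A" "\<phi> x = \<phi> y"
    then show "x = y" using b.comb_surj b'.comb_inj eq by metis
  next
    fix x assume "x \<in> carrier A"
    then obtain c where "Poly_Mapping.keys c \<subseteq> J" "x = b'.comb c" using b'.comb_surj by metis
    then show "x \<in> \<phi> ` carrier A" using eq by (metis b.comb_in_carrier image_eqI)
  qed (use lin in \<open>auto simp: alg_linear_def\<close>)
qed

subsection \<open>Straightening\<close>

definition bilin :: "('k \<Rightarrow> 'a::ab_group_add \<Rightarrow> 'a) \<Rightarrow> ('k \<Rightarrow> 'b::ab_group_add \<Rightarrow> 'b) \<Rightarrow> ('a \<Rightarrow> 'a \<Rightarrow> 'b) \<Rightarrow> bool" where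
  "bilin s t f \<longleftrightarrow> (\<forall>x y b. f (x + y) b = f x b + f y b) \<and> (\<forall>a x y. f a (x + y) = f a x + f a y) \<and>
     (\<forall>c x b. f (s c x) b = t c (f x b)) \<and> (\<forall>c a x. f a (s c x) = t c (f a x))"

lemma sum_list_swap:
  fixes f :: "'a \<Rightarrow> 'b \<Rightarrow> 'c::comm_monoid_add"
  shows "(\<Sum>x\<leftarrow>xs. \<Sum>y\<leftarrow>ys. f x y) = (\<Sum>y\<leftarrow>ys. \<Sum>x\<leftarrow>xs. f x y)"
  by (induction xs) (simp_all add: sum_list_addf)

text \<open>Both the left and the right multiplication by \<open>H\<close> on \<open>T(V)#\<^sub>MH\<close> can be straightened. The
  second case is the first one for the opposite algebra of \<open>H\<close>, so the multiplication is a parameter.\<close>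

locale straightening = H: vector_space scaleH + M: vector_space scaleM
  for scaleH :: "'k::field \<Rightarrow> 'h::ring_1 \<Rightarrow> 'h"
    and scaleM :: "'k \<Rightarrow> 'm::ab_group_add \<Rightarrow> 'm" +
  fixes mul :: "'h \<Rightarrow> 'h \<Rightarrow> 'h"
    and comult :: "'h \<Rightarrow> ('h \<times> 'h) list"
    and act :: "'h \<Rightarrow> 'm \<Rightarrow> 'm"
    and ad :: "'h \<Rightarrow> 'h \<Rightarrow> 'h"
    and inc :: "'h \<Rightarrow> 'm"
    and X :: "'m set"
  assumes mul_bilin: "bilin scaleH scaleH mul"
    and mul_assoc: "mul (mul x y) z = mul x (mul y z)"
    and mul_one_left: "mul 1 x = x"
    and mul_one_right: "mul x 1 = x"
    and comult_add: "tensor_eq scaleH [[a, b]. (a, b) \<leftarrow> comult (x + y)]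
          ([[a, b]. (a, b) \<leftarrow> comult x] @ [[a, b]. (a, b) \<leftarrow> comult y])"
    and comult_scale: "tensor_eq scaleH [[a, b]. (a, b) \<leftarrow> comult (scaleH c x)]
          [[scaleH c a, b]. (a, b) \<leftarrow> comult x]"
    and comult_mult: "tensor_eq scaleH [[a, b]. (a, b) \<leftarrow> comult (mul x y)]
          [[mul a c, mul b d]. (a, b) \<leftarrow> comult x, (c, d) \<leftarrow> comult y]"
    and comult_one: "tensor_eq scaleH [[a, b]. (a, b) \<leftarrow> comult 1] [[1, 1]]"
    and act_add_left: "act (h + k) m = act h m + act k m"
    and act_add_right: "act h (m + n) = act h m + act h n"
    and act_scale_left: "act (scaleH c h) m = scaleM c (act h m)"
    and act_scale_right: "act h (scaleM c m) = scaleM c (act h m)"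
    and act_one: "act 1 m = m"
    and act_mul: "act (mul h k) m = act h (act k m)"
    and inc_add: "inc (h + k) = inc h + inc k"
    and inc_scale: "inc (scaleH c h) = scaleM c (inc h)"
    and inc_inj: "inj inc"
    and act_inc: "act h (inc k) = inc (ad h k)"
    and ad_mul: "(\<Sum>(a, b)\<leftarrow>comult h. mul (ad a k) b) = mul h k"
    and X_independent: "M.independent X"
    and X_complement: "direct_complement scaleM (M.span X) (range inc)"
begin

lemma mul_simps:
  "mul (x + y) z = mul x z + mul y z" "mul z (x + y) = mul z x + mul z y"
  "mul (scaleH c x) z = scaleH c (mul x z)" "mul z (scaleH c x) = scaleH c (mul z x)"
  using mul_bilin by (simp_all add: bilin_def)

text \<open>The lists \<open>comult (x + y)\<close>, \<open>comult (mul x y)\<close> and so on are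
  unrelated choices. The Hopf algebra axioms become equations once a bilinear \<open>f\<close> is
  applied.\<close>

lemma
  assumes t: "vector_space t" and f: "bilin scaleH t f"
  shows sweedler_add: "(\<Sum>(a, b)\<leftarrow>comult (x + y). f a b) = (\<Sum>(a, b)\<leftarrow>comult x. f a b) + (\<Sum>(a, b)\<leftarrow>comult y. f a b)"
    and sweedler_scale: "(\<Sum>(a, b)\<leftarrow>comult (scaleH c x). f a b) = t c (\<Sum>(a, b)\<leftarrow>comult x. f a b)"
    and sweedler_mult: "(\<Sum>(a, b)\<leftarrow>comult (mul x y). f a b) =
        (\<Sum>(a, b)\<leftarrow>comult x. \<Sum>(c, d)\<leftarrow>comult y. f (mul a c) (mul b d))"
    and sweedler_one: "(\<Sum>(a, b)\<leftarrow>comult 1. f a b) = f 1 1"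
proof -
  interpret t: vector_space t by fact
  have *: "(\<Sum>(a, b)\<leftarrow>ps. f a b) = (\<Sum>(a, b)\<leftarrow>qs. f a b)"
    if "tensor_eq scaleH [[a, b]. (a, b) \<leftarrow> ps] [[a, b]. (a, b) \<leftarrow> qs]" for ps qs
    by (rule t.tensor_eq_bilinear[OF that]) (use f in \<open>simp_all add: bilin_def\<close>)
  show "(\<Sum>(a, b)\<leftarrow>comult (x + y). f a b) = (\<Sum>(a, b)\<leftarrow>comult x. f a b) + (\<Sum>(a, b)\<leftarrow>comult y. f a b)"
    using *[of "comult (x + y)" "comult x @ comult y"] comult_add[of x y] by simp
  have "(\<Sum>(a, b)\<leftarrow>comult (scaleH c x). f a b) = (\<Sum>(a, b)\<leftarrow>[(scaleH c a, b). (a, b) \<leftarrow> comult x]. f a b)"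
    by (rule *) (use comult_scale[of c x] in \<open>simp add: o_def split_def\<close>)
  also have "\<dots> = t c (\<Sum>(a, b)\<leftarrow>comult x. f a b)"
    using f by (subst additive_sum_list[of "t c"]) (simp_all add: o_def split_def bilin_def t.scale_right_distrib)
  finally show "(\<Sum>(a, b)\<leftarrow>comult (scaleH c x). f a b) = t c (\<Sum>(a, b)\<leftarrow>comult x. f a b)" .
  have "(\<Sum>(a, b)\<leftarrow>comult (mul x y). f a b) =
      (\<Sum>(a, b)\<leftarrow>[(mul a c, mul b d). (a, b) \<leftarrow> comult x, (c, d) \<leftarrow> comult y]. f a b)"
    by (rule *) (use comult_mult[of x y] in \<open>simp add: o_def split_def map_concat\<close>)
  then show "(\<Sum>(a, b)\<leftarrow>comult (mul x y). f a b) =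
        (\<Sum>(a, b)\<leftarrow>comult x. \<Sum>(c, d)\<leftarrow>comult y. f (mul a c) (mul b d))"
    by (simp add: o_def split_def map_concat sum_list_concat)
  show "(\<Sum>(a, b)\<leftarrow>comult 1. f a b) = f 1 1"
    using *[of "comult 1" "[(1, 1)]"] comult_one by simp
qed

section \<open>The splitting of M into k X and H\<close>

lemma inc_zero: "inc 0 = 0"
  using inc_add[of 0 0] by simp

lemma inc_diff: "inc (h - k) = inc h - inc k"
  using inc_add[of "h - k" k] by (simp add: algebra_simps)

lemma mul_zero [simp]: "mul 0 x = 0"
  using mul_simps(1)[of 0 0 x] by simp

text \<open>The linear projection of M onto H along k X. It need not commute with the action of H:
  for x in X the values \<open>hpart (act a x)\<close> measure the deviation and produce the terms
  with shorter words.\<close>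

definition hpart :: "'m \<Rightarrow> 'h" where
  "hpart m = (THE h. m - inc h \<in> M.span X)"

definition xpart :: "'m \<Rightarrow> 'm" where
  "xpart m = m - inc (hpart m)"

lemma hpart_unique: "m - inc h \<in> M.span X \<Longrightarrow> hpart m = h"
  unfolding hpart_def
proof (rule the_equality)
  fix k assume "m - inc h \<in> M.span X" "m - inc k \<in> M.span X"
  then have "(m - inc h) - (m - inc k) \<in> M.span X" by (rule M.span_diff)
  then have "inc (k - h) \<in> M.span X \<inter> range inc" by (simp flip: inc_diff)
  then have "inc (k - h) = inc 0" using X_complement by (auto simp: direct_complement_def inc_zero)
  then show "k = h" using inc_inj by (metis eq_iff_diff_eq_0 injD)
qed

lemma xpart_in_span: "xpart m \<in> M.span X"
proof -
  have "m \<in> {u + w | u w. u \<in> M.span X \<and> w \<in> range inc}"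
    using X_complement by (auto simp: direct_complement_def)
  then obtain u h where "u \<in> M.span X" "m = u + inc h" by auto
  moreover from this have "hpart m = h" by (intro hpart_unique) simp
  ultimately show ?thesis by (simp add: xpart_def)
qed

lemma decomp: "m = xpart m + inc (hpart m)"
  by (simp add: xpart_def)

lemma hpart_add: "hpart (m + n) = hpart m + hpart n"
  using M.span_add[OF xpart_in_span[of m] xpart_in_span[of n]]
  by (intro hpart_unique) (simp add: xpart_def inc_add algebra_simps)

lemma hpart_scale: "hpart (scaleM c m) = scaleH c (hpart m)"
  using M.span_scale[OF xpart_in_span[of m], of c]
  by (intro hpart_unique) (simp add: xpart_def inc_scale M.scale_right_diff_distrib)

lemma hpart_inc [simp]: "hpart (inc h) = h"
  by (rule hpart_unique) (simp add: M.span_zero)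

lemma hpart_span: "m \<in> M.span X \<Longrightarrow> hpart m = 0"
  by (rule hpart_unique) (simp add: inc_zero)

lemma xpart_span: "m \<in> M.span X \<Longrightarrow> xpart m = m"
  by (simp add: xpart_def hpart_span inc_zero)

lemma xpart_add: "xpart (m + n) = xpart m + xpart n"
  by (simp add: xpart_def hpart_add inc_add)

lemma xpart_scale: "xpart (scaleM c m) = scaleM c (xpart m)"
  by (simp add: xpart_def hpart_scale inc_scale M.scale_right_diff_distrib)

section \<open>The space k<X> \<otimes> H: words with coefficients in H\<close>

abbreviation sE :: "'k \<Rightarrow> ('m list \<Rightarrow>\<^sub>0 'h) \<Rightarrow> ('m list \<Rightarrow>\<^sub>0 'h)" where
  "sE \<equiv> pm_scale scaleH"

sublocale E: vector_space sE
  by (rule vector_space_pm_scale[OF H.vector_space_axioms])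

sublocale ME: vector_space_pair scaleM sE ..

definition prepend :: "'m \<Rightarrow> ('m list \<Rightarrow>\<^sub>0 'h) \<Rightarrow> ('m list \<Rightarrow>\<^sub>0 'h)" where
  "prepend x = pm_sum (\<lambda>A h. Poly_Mapping.single (x # A) h)"

text \<open>\<open>prepend\<close> is not linear in the letter, since words with different first
  letters are independent. This map agrees with it on X, is linear in \<open>m\<close>, and vanishes
  on the image of H.\<close>

definition pre :: "'m \<Rightarrow> ('m list \<Rightarrow>\<^sub>0 'h) \<Rightarrow> ('m list \<Rightarrow>\<^sub>0 'h)" where
  "pre m P = ME.construct X (\<lambda>x. prepend x P) (xpart m)"

lemma prepend_single [simp]: "prepend x (Poly_Mapping.single A h) = Poly_Mapping.single (x # A) h"
  by (simp add: prepend_def pm_sum_single)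

lemma prepend_add: "prepend x (P + Q) = prepend x P + prepend x Q"
  by (simp add: prepend_def pm_sum_add single_add)

lemma prepend_scale: "prepend x (sE c P) = sE c (prepend x P)"
  unfolding prepend_def
  by (rule pm_sum_scale) (simp_all add: single_add E.scale_right_distrib)

lemma pre_basis: "x \<in> X \<Longrightarrow> pre x P = prepend x P"
  by (simp add: pre_def xpart_span M.span_base ME.construct_basis[OF X_independent])

lemma pre_linear_left: "Vector_Spaces.linear scaleM sE (ME.construct X (\<lambda>x. prepend x P))"
  by (rule ME.linear_construct[OF X_independent])

lemma pre_add_left: "pre (m + n) P = pre m P + pre n P"
  using pre_linear_left[of P] by (simp add: pre_def xpart_add Vector_Spaces.linear_iff)

lemma pre_scale_left: "pre (scaleM c m) P = sE c (pre m P)"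
  using pre_linear_left[of P] by (simp add: pre_def xpart_scale Vector_Spaces.linear_iff)

lemma pre_span_induct:
  assumes "R 0" "\<And>x. x \<in> X \<Longrightarrow> R x" "\<And>x y. R x \<Longrightarrow> R y \<Longrightarrow> R (x + y)" "\<And>c x. R x \<Longrightarrow> R (scaleM c x)"
    and "m \<in> M.span X"
  shows "R m"
  using assms(5) by (rule M.span_induct) (use assms(1-4) in \<open>auto simp: M.subspace_def\<close>)

lemma pre_zero_left: "pre 0 P = 0"
  using pre_add_left[of 0 0 P] by simp

lemma pre_xpart: "pre (xpart m) P = pre m P"
  by (simp add: pre_def xpart_span[OF xpart_in_span])

lemma pre_inc [simp]: "pre (inc h) P = 0"
  using pre_xpart[of "inc h" P] by (simp add: xpart_def pre_zero_left)

lemma pre_add_right: "pre m (P + Q) = pre m P + pre m Q"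
proof -
  have "pre y (P + Q) = pre y P + pre y Q" if "y \<in> M.span X" for y
    using that
    by (rule pre_span_induct[rotated 4])
      (simp_all add: pre_zero_left pre_basis prepend_add pre_add_left pre_scale_left E.scale_right_distrib)
  from this[OF xpart_in_span[of m]] show ?thesis by (simp add: pre_xpart)
qed

lemma pre_scale_right: "pre m (sE c P) = sE c (pre m P)"
proof -
  have "pre y (sE c P) = sE c (pre y P)" if "y \<in> M.span X" for y
    using that
    by (rule pre_span_induct[rotated 4])
      (simp_all add: pre_zero_left pre_basis prepend_scale pre_add_left pre_scale_left E.scale_right_distrib
        mult.commute)
  from this[OF xpart_in_span[of m]] show ?thesis by (simp add: pre_xpart)
qed

text \<open>\<open>straight A k h\<close> is the normal form of \<open>k A h\<close>. The component in \<open>H\<close> of \<open>k\<^sub>(\<^sub>1\<^sub>) \<cdot> x\<close> is multiplied to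
  \<open>k\<^sub>(\<^sub>2\<^sub>)\<close> before passing it through the shorter word \<open>A\<close>; this makes the recursion structural.\<close>

primrec straight :: "'m list \<Rightarrow> 'h \<Rightarrow> 'h \<Rightarrow> ('m list \<Rightarrow>\<^sub>0 'h)" where
  "straight [] k h = Poly_Mapping.single [] (mul k h)"
| "straight (x # A) k h = (\<Sum>(a, b)\<leftarrow>comult k.
     pre (act a x) (straight A b h) + straight A (mul (hpart (act a x)) b) h)"

definition lmul :: "'h \<Rightarrow> ('m list \<Rightarrow>\<^sub>0 'h) \<Rightarrow> ('m list \<Rightarrow>\<^sub>0 'h)" where
  "lmul k = pm_sum (\<lambda>A h. straight A k h)"

text \<open>Additivity and homogeneity are proved jointly because the induction step applies the
  Sweedler rules to a map whose bilinearity uses both for the tail \<open>A\<close>.\<close>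

lemma straight_linear_left:
  "straight A (k + l) h = straight A k h + straight A l h \<and> straight A (scaleH c k) h = sE c (straight A k h)"
proof (induction A arbitrary: k l c)
  case Nil
  then show ?case by (simp add: mul_simps single_add)
next
  case (Cons x A)
  have "bilin scaleH sE (\<lambda>a b. pre (act a x) (straight A b h) + straight A (mul (hpart (act a x)) b) h)"
    using Cons by (simp add: bilin_def act_add_left act_scale_left hpart_add hpart_scale mul_simps
        pre_add_left pre_add_right pre_scale_left pre_scale_right E.scale_right_distrib add_ac)
  then show ?case
    by (simp add: sweedler_add[OF E.vector_space_axioms] sweedler_scale[OF E.vector_space_axioms])
qed

lemmas straight_add_left = straight_linear_left[THEN conjunct1]
  and straight_scale_left = straight_linear_left[THEN conjunct2]

lemma straight_bilin:
  "bilin scaleH sE (\<lambda>a b. pre (act a x) (straight A b h) + straight A (mul (hpart (act a x)) b) h)"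
  by (simp add: bilin_def act_add_left act_scale_left hpart_add hpart_scale mul_simps straight_add_left
        straight_scale_left pre_add_left pre_add_right pre_scale_left pre_scale_right E.scale_right_distrib add_ac)

lemma straight_linear_right:
  "straight A k (g + h) = straight A k g + straight A k h \<and> straight A k (scaleH c h) = sE c (straight A k h)"
proof (induction A arbitrary: k c)
  case Nil
  then show ?case by (simp add: mul_simps single_add)
next
  case (Cons x A)
  then show ?case
    by (simp add: pre_add_right pre_scale_right additive_sum_list[of "sE c"] E.scale_right_distrib o_def
        split_def add_ac flip: sum_list_addf)
qed

lemmas straight_add_right = straight_linear_right[THEN conjunct1]
  and straight_scale_right = straight_linear_right[THEN conjunct2]

lemma straight_zero [simp]: "straight A 0 h = 0" "straight A k 0 = 0"
  using straight_add_left[of A 0 0 h] straight_add_right[of A k 0 0] by simp_all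

lemma lmul_single [simp]: "lmul k (Poly_Mapping.single A h) = straight A k h"
  by (simp add: lmul_def pm_sum_single)

lemma lmul_add_right: "lmul k (P + Q) = lmul k P + lmul k Q"
  by (simp add: lmul_def pm_sum_add straight_add_right)

lemma lmul_zero_right [simp]: "lmul k 0 = 0"
  by (simp add: lmul_def)

lemma lmul_scale_right: "lmul k (sE c P) = sE c (lmul k P)"
  unfolding lmul_def
  by (rule pm_sum_scale) (simp_all add: straight_add_right straight_scale_right E.scale_right_distrib)

lemma lmul_add_left: "lmul (k + l) P = lmul k P + lmul l P"
  by (simp add: lmul_def pm_sum_def straight_add_left sum.distrib)

lemma lmul_scale_left: "lmul (scaleH c k) P = sE c (lmul k P)"
  by (simp add: lmul_def pm_sum_def straight_scale_left E.scale_sum_right)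

lemma lmul_zero_left [simp]: "lmul 0 P = 0"
  using lmul_add_left[of 0 0 P] by simp

text \<open>The recursion of \<open>straight\<close>, extended linearly from letters in X and single
  words to span X and arbitrary \<open>P\<close>. In general it fails for \<open>y\<close> with a
  component in H: \<open>pre\<close> drops that component on the left, while
  \<open>hpart (act a y)\<close> keeps it on the right.\<close>

lemma lmul_pre_span:
  assumes "y \<in> M.span X"
  shows "lmul h (pre y P) =
    (\<Sum>(a, b)\<leftarrow>comult h. pre (act a y) (lmul b P) + lmul (mul (hpart (act a y)) b) P)"
  using assms
proof (rule pre_span_induct[rotated 4])
  fix x assume x: "x \<in> X"
  show "lmul h (pre x P) =
    (\<Sum>(a, b)\<leftarrow>comult h. pre (act a x) (lmul b P) + lmul (mul (hpart (act a x)) b) P)"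
  proof (induction P rule: pm_induct)
    case zero
    have "pre m 0 = 0" for m using pre_add_right[of m 0 0] by simp
    then show ?case by simp
  next
    case (single A g)
    show ?case by (simp add: pre_basis x)
  next
    case (add P Q)
    then show ?case
      by (simp add: pre_add_right lmul_add_right add_ac split_def flip: sum_list_addf)
  qed
next
  fix x y
  assume "lmul h (pre x P) =
      (\<Sum>(a, b)\<leftarrow>comult h. pre (act a x) (lmul b P) + lmul (mul (hpart (act a x)) b) P)"
    and "lmul h (pre y P) =
      (\<Sum>(a, b)\<leftarrow>comult h. pre (act a y) (lmul b P) + lmul (mul (hpart (act a y)) b) P)"
  then show "lmul h (pre (x + y) P) =
      (\<Sum>(a, b)\<leftarrow>comult h. pre (act a (x + y)) (lmul b P) + lmul (mul (hpart (act a (x + y))) b) P)"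
    by (simp add: pre_add_left lmul_add_right lmul_add_left act_add_right hpart_add mul_simps add_ac split_def
        flip: sum_list_addf)
next
  fix c x
  assume "lmul h (pre x P) =
      (\<Sum>(a, b)\<leftarrow>comult h. pre (act a x) (lmul b P) + lmul (mul (hpart (act a x)) b) P)"
  then show "lmul h (pre (scaleM c x) P) =
      (\<Sum>(a, b)\<leftarrow>comult h. pre (act a (scaleM c x)) (lmul b P) + lmul (mul (hpart (act a (scaleM c x))) b) P)"
    by (simp add: pre_scale_left lmul_scale_right lmul_scale_left act_scale_right hpart_scale mul_simps split_def
        additive_sum_list[of "sE c"] E.scale_right_distrib o_def)
next
  have "act a 0 = 0" for a using act_add_right[of a 0 0] by simp
  then show "lmul h (pre 0 P) =
      (\<Sum>(a, b)\<leftarrow>comult h. pre (act a 0) (lmul b P) + lmul (mul (hpart (act a 0)) b) P)"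
    by (simp add: pre_zero_left hpart_span M.span_zero split_def)
qed

text \<open>By \<open>ad_mul\<close> a product h k equals \<open>(ad h_(1) k) h_(2)\<close>. Thus
  the H-component of an element of M moves past h by the same formula as its component in k
  X.\<close>

lemma lmul_mul_via_ad: "lmul (mul (mul h k) b) P = (\<Sum>(c, d)\<leftarrow>comult h. lmul (mul (mul (ad c k) d) b) P)"
proof -
  have "lmul (mul (sum_list xs) b) P = (\<Sum>x\<leftarrow>xs. lmul (mul x b) P)" for xs
    by (rule additive_sum_list[of "\<lambda>x. lmul (mul x b) P"]) (simp add: mul_simps lmul_add_left)
  note * = this
  show ?thesis
    by (subst ad_mul[symmetric]) (simp add: * o_def split_def)
qed

lemma pre_act_xpart: "pre (act a (xpart m)) P = pre (act a m) P"
proof -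
  have "pre (act a m) P = pre (act a (xpart m)) P + pre (act a (inc (hpart m))) P"
    by (subst (1) decomp) (simp add: act_add_right pre_add_left)
  then show ?thesis by (simp add: act_inc)
qed

text \<open>Both components of \<open>m\<close> contribute: the one in k X through the deviation of
  the splitting from H-linearity, the one in H through the adjoint action, since \<open>inc\<close>
  is H-linear.\<close>

lemma hpart_act: "hpart (act a m) = hpart (act a (xpart m)) + ad a (hpart m)"
  by (subst (1) decomp) (simp add: act_add_right hpart_add act_inc)

text \<open>This is the associativity that makes \<open>lmul\<close> an action of H. Moving h past
  \<open>xpart (act a x)\<close> and past \<open>hpart (act a x)\<close> gives two kinds of terms in
  H, which \<open>hpart_act\<close> combines into \<open>hpart (act (mul c a) x)\<close>;
  multiplicativity of the comultiplication then turns the double Sweedler sum into that of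
  \<open>mul h k\<close>.\<close>

lemma lmul_straight: "lmul h (straight A k g) = straight A (mul h k) g"
proof (induction A arbitrary: h k g)
  case Nil
  then show ?case by (simp add: mul_assoc)
next
  case (Cons x A)
  let ?f = "\<lambda>a b. pre (act a x) (straight A b g) + straight A (mul (hpart (act a x)) b) g"
  have step: "lmul h (?f a b) = (\<Sum>(c, d)\<leftarrow>comult h. ?f (mul c a) (mul d b))" for a b
  proof -
    have "lmul h (pre (act a x) (straight A b g)) = lmul h (pre (xpart (act a x)) (straight A b g))"
      by (simp add: pre_xpart)
    also have "\<dots> = (\<Sum>(c, d)\<leftarrow>comult h. pre (act c (act a x)) (straight A (mul d b) g) +
        straight A (mul (hpart (act c (xpart (act a x)))) (mul d b)) g)"
      by (simp add: lmul_pre_span[OF xpart_in_span] Cons pre_act_xpart mul_assoc)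
    finally have 1: "lmul h (pre (act a x) (straight A b g)) = \<dots>" .
    have 2: "lmul h (straight A (mul (hpart (act a x)) b) g) =
        (\<Sum>(c, d)\<leftarrow>comult h. straight A (mul (ad c (hpart (act a x))) (mul d b)) g)"
      using lmul_mul_via_ad[of h "hpart (act a x)" b "Poly_Mapping.single A g"]
      by (simp add: Cons mul_assoc)
    show ?thesis
      unfolding lmul_add_right 1 2
      by (simp add: split_def act_mul hpart_act[of _ "act a x"] mul_simps straight_add_left add_ac
          flip: sum_list_addf)
  qed
  have "lmul h (straight (x # A) k g) = (\<Sum>(a, b)\<leftarrow>comult k. lmul h (?f a b))"
    by (simp add: additive_sum_list[of "lmul h"] lmul_add_right o_def split_def)
  also have "\<dots> = (\<Sum>(c, d)\<leftarrow>comult h. \<Sum>(a, b)\<leftarrow>comult k. ?f (mul c a) (mul d b))"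
    unfolding step split_def by (rule sum_list_swap)
  also have "\<dots> = straight (x # A) (mul h k) g"
    using sweedler_mult[OF E.vector_space_axioms straight_bilin] by simp
  finally show ?case .
qed

lemma lmul_lmul: "lmul h (lmul k P) = lmul (mul h k) P"
  by (induction P rule: pm_induct) (simp_all add: lmul_straight lmul_add_right)

section \<open>Normal forms and the action of M on them\<close>

definition normal_forms :: "('m list \<Rightarrow>\<^sub>0 'h) set" where
  "normal_forms = {P. Poly_Mapping.keys P \<subseteq> lists X}"

lemma subspace_normal_forms: "E.subspace normal_forms"
proof (rule E.subspaceI)
  fix P Q c assume P: "P \<in> normal_forms"
  show "sE c P \<in> normal_forms"
    using P keys_pm_scale[of scaleH c P] by (auto simp: normal_forms_def)
  assume "Q \<in> normal_forms"
  then show "P + Q \<in> normal_forms"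
    using P keys_add[of P Q] by (auto simp: normal_forms_def)
qed (simp add: normal_forms_def)

lemmas nf_add = E.subspace_add[OF subspace_normal_forms]
  and nf_scale = E.subspace_scale[OF subspace_normal_forms]
  and nf_zero = E.subspace_0[OF subspace_normal_forms]
  and nf_sum = E.subspace_sum[OF subspace_normal_forms]

lemma single_in_normal_forms: "A \<in> lists X \<Longrightarrow> Poly_Mapping.single A h \<in> normal_forms"
  by (cases "h = 0") (auto simp: normal_forms_def)

lemma nf_sum_list: "(\<And>x. x \<in> set xs \<Longrightarrow> f x \<in> normal_forms) \<Longrightarrow> (\<Sum>x\<leftarrow>xs. f x) \<in> normal_forms"
  by (induction xs) (simp_all add: nf_zero nf_add)

lemma prepend_in_normal_forms: "x \<in> X \<Longrightarrow> P \<in> normal_forms \<Longrightarrow> prepend x P \<in> normal_forms"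
  unfolding prepend_def pm_sum_def
  by (rule nf_sum) (auto simp: normal_forms_def)

lemma pre_in_normal_forms: "P \<in> normal_forms \<Longrightarrow> pre m P \<in> normal_forms"
proof -
  assume P: "P \<in> normal_forms"
  have "pre y P \<in> normal_forms" if "y \<in> M.span X" for y
    using that
    by (rule pre_span_induct[rotated 4])
      (simp_all add: pre_zero_left nf_zero pre_basis prepend_in_normal_forms P pre_add_left nf_add
        pre_scale_left nf_scale)
  from this[OF xpart_in_span[of m]] show ?thesis by (simp add: pre_xpart)
qed

lemma straight_in_normal_forms: "straight A k h \<in> normal_forms"
  by (induction A arbitrary: k)
    (auto simp: single_in_normal_forms intro!: nf_sum_list nf_add pre_in_normal_forms)

lemma lmul_in_normal_forms: "lmul k P \<in> normal_forms"
  unfolding lmul_def pm_sum_def by (intro nf_sum straight_in_normal_forms)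

text \<open>The words must be over X: straightening replaces any other letter by the expansion of
  its X-component and an H-term. This is why the unit acts as the identity on
  \<open>normal_forms\<close> and not on the whole function space.\<close>

lemma straight_one: "A \<in> lists X \<Longrightarrow> straight A 1 h = Poly_Mapping.single A h"
proof (induction A)
  case Nil
  then show ?case by (simp add: mul_one_left)
next
  case (Cons x A)
  then show ?case
    by (simp add: sweedler_one[OF E.vector_space_axioms straight_bilin] act_one pre_basis hpart_span M.span_base)
qed

lemma lmul_one: "P \<in> normal_forms \<Longrightarrow> lmul 1 P = P"
  using pm_sum_id[of P]
  by (auto simp: lmul_def pm_sum_def normal_forms_def straight_one subset_iff cong: sum.cong)

text \<open>Left multiplication by an element of M on normal forms: the component in k X is
  prepended, and the component in H is straightened through the word.\<close>

definition mmul :: "'m \<Rightarrow> ('m list \<Rightarrow>\<^sub>0 'h) \<Rightarrow> ('m list \<Rightarrow>\<^sub>0 'h)" where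
  "mmul m P = pre m P + lmul (hpart m) P"

lemma mmul_add_left: "mmul (m + n) P = mmul m P + mmul n P"
  by (simp add: mmul_def pre_add_left hpart_add lmul_add_left add_ac)

lemma mmul_scale_left: "mmul (scaleM c m) P = sE c (mmul m P)"
  by (simp add: mmul_def pre_scale_left hpart_scale lmul_scale_left E.scale_right_distrib)

lemma mmul_add_right: "mmul m (P + Q) = mmul m P + mmul m Q"
  by (simp add: mmul_def pre_add_right lmul_add_right add_ac)

lemma mmul_scale_right: "mmul m (sE c P) = sE c (mmul m P)"
  by (simp add: mmul_def pre_scale_right lmul_scale_right E.scale_right_distrib)

lemma mmul_inc: "mmul (inc h) P = lmul h P"
  by (simp add: mmul_def)

lemma mmul_basis: "x \<in> X \<Longrightarrow> mmul x P = prepend x P"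
  by (simp add: mmul_def pre_basis hpart_span M.span_base)

lemma mmul_in_normal_forms: "P \<in> normal_forms \<Longrightarrow> mmul m P \<in> normal_forms"
  by (simp add: mmul_def nf_add pre_in_normal_forms lmul_in_normal_forms)

lemma mmul_inc_inc: "mmul (inc h) (mmul (inc k) P) = mmul (inc (mul h k)) P"
  by (simp add: mmul_inc lmul_lmul)

lemma mmul_inc_mmul: "mmul (inc h) (mmul m P) = (\<Sum>(a, b)\<leftarrow>comult h. mmul (act a m) (mmul (inc b) P))"
proof -
  \<comment> \<open>The factor 1 is inserted to match the shape of
    \<open>lmul_mul_via_ad\<close>.\<close>
  have "mmul (inc h) (mmul m P) = lmul h (pre (xpart m) P) + lmul (mul (mul h (hpart m)) 1) P"
    by (simp add: mmul_inc mmul_def[of m] lmul_add_right lmul_lmul pre_xpart mul_one_right)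
  also have "\<dots> = (\<Sum>(a, b)\<leftarrow>comult h. mmul (act a m) (mmul (inc b) P))"
    by (subst lmul_pre_span[OF xpart_in_span], subst lmul_mul_via_ad)
      (simp add: split_def mmul_inc mmul_def lmul_lmul mul_one_right hpart_act[of _ m] pre_act_xpart mul_simps
        lmul_add_left add_ac flip: sum_list_addf)
  finally show ?thesis .
qed

text \<open>The word A h can be recovered from its effect on 1 \<otimes> 1, which is the source of
  linear independence.\<close>

lemma foldr_mmul_normal: "A \<in> lists X \<Longrightarrow> foldr mmul (A @ [inc h]) (Poly_Mapping.single [] 1) = Poly_Mapping.single A h"
  by (induction A) (simp_all add: mmul_inc mul_one_right mmul_basis)


text \<open>The spanning argument for abstract operators \<open>T m\<close>, so that it serves for
  multiplication by a letter from the left and from the right; \<open>J\<close> will be the kernel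
  and \<open>e\<close> the unit. \<open>S\<close> consists of the elements congruent to combinations
  of normal words, and the point is its stability under every \<open>T m\<close>.\<close>

lemma straighten_span:
  fixes T :: "'m \<Rightarrow> 'e::ab_group_add \<Rightarrow> 'e" and HB :: "'h set" and e :: 'e
  assumes t: "vector_space t" and J: "Modules.module.subspace t J"
    and HB: "H.span HB = UNIV"
    and T_add_right: "\<And>m p q. T m (p + q) = T m p + T m q"
    and T_scale_right: "\<And>m c p. T m (t c p) = t c (T m p)"
    and T_J: "\<forall>m. \<forall>p\<in>J. T m p \<in> J"
    and T_add_left: "\<And>m n p. T (m + n) p - (T m p + T n p) \<in> J"
    and T_scale_left: "\<And>m c p. T (scaleM c m) p - t c (T m p) \<in> J"
    and T_mul: "\<And>h k p. T (inc h) (T (inc k) p) - T (inc (mul h k)) p \<in> J"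
    and T_straight: "\<And>h m p. T (inc h) (T m p) - (\<Sum>(a, b)\<leftarrow>comult h. T (act a m) (T (inc b) p)) \<in> J"
  defines "S \<equiv> {q. \<exists>r\<in>Modules.module.span t ((\<lambda>(A, h). foldr T (A @ [inc h]) e) ` (lists X \<times> HB)). q - r \<in> J}"
  shows "T (inc h) e \<in> S" and "p \<in> S \<Longrightarrow> T m p \<in> S" and "Modules.module.subspace t S" and "J \<subseteq> S"
proof -
  interpret t: vector_space t by fact
  let ?g = "\<lambda>A h. foldr T (A @ [inc h]) e"
  let ?G = "(\<lambda>(A, h). ?g A h) ` (lists X \<times> HB)"
  have JI: "x \<in> J \<Longrightarrow> y \<in> J \<Longrightarrow> x + y \<in> J" "x \<in> J \<Longrightarrow> t c x \<in> J" "x \<in> J \<Longrightarrow> y \<in> J \<Longrightarrow> x - y \<in> J" "0 \<in> J" for x y c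
    using J t.subspace_diff[OF J] by (auto simp: t.subspace_def)
  show S: "t.subspace S"
  proof (rule t.subspaceI)
    show "0 \<in> S" using JI t.span_zero by (auto simp: S_def intro!: bexI[of _ 0])
    fix x y c assume "x \<in> S"
    then obtain r where r: "r \<in> t.span ?G" "x - r \<in> J" by (auto simp: S_def)
    then have "t c x - t c r \<in> J" using JI by (simp flip: t.scale_right_diff_distrib)
    then show "t c x \<in> S" using r t.span_scale unfolding S_def by blast
    assume "y \<in> S"
    then obtain r' where r': "r' \<in> t.span ?G" "y - r' \<in> J" by (auto simp: S_def)
    have "(x + y) - (r + r') \<in> J" using JI(1)[OF r(2) r'(2)] by (simp add: algebra_simps)
    then show "x + y \<in> S" using t.span_add[OF r(1) r'(1)] unfolding S_def by blast
  qed
  note SI = t.subspace_add[OF S] t.subspace_scale[OF S] t.subspace_diff[OF S] t.subspace_0[OF S]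
  show JS: "J \<subseteq> S" using t.span_zero by (auto simp: S_def intro!: bexI[of _ 0])
  have cong: "x \<in> S" if "x - y \<in> J" "y \<in> S" for x y
    using SI(1)[of "x - y" y] that JS by auto
  have span_S: "t.span ?G \<subseteq> S"
  proof
    fix r assume "r \<in> t.span ?G"
    moreover have "r - r \<in> J" using JI(4) by simp
    ultimately show "r \<in> S" unfolding S_def by blast
  qed
  have S_sum: "(\<Sum>x\<leftarrow>xs. f x) \<in> S" if "\<And>x. x \<in> set xs \<Longrightarrow> f x \<in> S" for xs :: "('h \<times> 'h) list" and f
    using that by (induction xs) (simp_all add: SI)
  have foldr_lin: "foldr T A (p + q) = foldr T A p + foldr T A q" "foldr T A (t c p) = t c (foldr T A p)"
    "p \<in> J \<Longrightarrow> foldr T A p \<in> J" for A p q c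
    by (induction A) (simp_all add: T_add_right T_scale_right T_J)
  have foldr_diff: "foldr T A (p - q) = foldr T A p - foldr T A q" for A p q
    using foldr_lin(1)[of A "p - q" q] by (simp add: algebra_simps)
  \<comment> \<open>From \<open>HB\<close> to all of H: the last letter is linear modulo
    \<open>J\<close>, and \<open>foldr T A\<close> preserves \<open>J\<close>.\<close>
  have g_S: "?g A h \<in> S" if A: "A \<in> lists X" for A h
  proof -
    have "h \<in> H.span HB" by (simp add: HB)
    then show ?thesis
    proof (rule H.span_induct)
      show "?g A h \<in> S" if "h \<in> HB" for h
        using A that span_S t.span_base[of "?g A h" ?G] by force
      have 0: "?g A 0 \<in> J"
        using foldr_lin(3)[OF T_scale_left[of 0 "0" e], of A] by (simp add: inc_zero)
      show "H.subspace {h. ?g A h \<in> S}"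
      proof (rule H.subspaceI)
        show "0 \<in> {h. ?g A h \<in> S}" using 0 JS by auto
        fix h k c assume h: "h \<in> {h. ?g A h \<in> S}"
        have "?g A (scaleH c h) - t c (?g A h) \<in> J"
          using foldr_lin(3)[OF T_scale_left[of c "inc h" e], of A] by (simp add: inc_scale foldr_diff foldr_lin)
        from cong[OF this SI(2)] h show "scaleH c h \<in> {h. ?g A h \<in> S}" by simp
        assume k: "k \<in> {h. ?g A h \<in> S}"
        have "?g A (h + k) - (?g A h + ?g A k) \<in> J"
          using foldr_lin(3)[OF T_add_left[of "inc h" "inc k" e], of A] by (simp add: inc_add foldr_diff foldr_lin)
        from cong[OF this SI(1)] h k show "h + k \<in> {h. ?g A h \<in> S}" by simp
      qed
    qed
  qed
  show "T (inc h) e \<in> S" using g_S[of "[]"] by simp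
  \<comment> \<open>\<open>T m\<close> is linear and preserves \<open>J\<close>, so its effect has
    to be checked only on normal words.\<close>
  have T_span: "T m p \<in> S" if "p \<in> S" and gen: "\<And>A h. A \<in> lists X \<Longrightarrow> T m (?g A h) \<in> S" for m p
  proof -
    have "T m r \<in> S" if "r \<in> t.span ?G" for r
      using that
    proof (rule t.span_induct)
      show "t.subspace {r. T m r \<in> S}"
        using SI T_scale_right[of m 0 0] by (auto simp: t.subspace_def T_add_right T_scale_right)
    qed (use gen in auto)
    moreover from \<open>p \<in> S\<close> obtain r where r: "r \<in> t.span ?G" "p - r \<in> J" by (auto simp: S_def)
    moreover have "T m p - T m r \<in> J"
      using T_J r(2) T_add_right[of m "p - r" r] by (simp add: algebra_simps)
    ultimately show ?thesis using cong by simp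
  qed
  have T_X: "T y p \<in> S" if "p \<in> S" "y \<in> M.span X" for y p
    using that(2)
  proof (rule pre_span_induct[rotated 4])
    show "T x p \<in> S" if "x \<in> X" for x
    proof (rule T_span[OF \<open>p \<in> S\<close>])
      show "T x (?g A h) \<in> S" if "A \<in> lists X" for A h
        using g_S[of "x # A" h] that \<open>x \<in> X\<close> by simp
    qed
    show "T 0 p \<in> S" using T_scale_left[of 0 0 p] JS by auto
    show "T (scaleM c x) p \<in> S" if "T x p \<in> S" for c x by (rule cong[OF T_scale_left SI(2)[OF that]])
    show "T (x + y) p \<in> S" if "T x p \<in> S" "T y p \<in> S" for x y by (rule cong[OF T_add_left SI(1)[OF that]])
  qed
  \<comment> \<open>The recursion of \<open>straight\<close> again: the H-component of
    \<open>act a x\<close> is merged with \<open>b\<close> by \<open>T_mul\<close>, so the induction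
    hypothesis for the shorter word \<open>A\<close> applies to the product.\<close>
  have T_inc: "T (inc k) (?g A h) \<in> S" if "A \<in> lists X" for A k h
    using that
  proof (induction A arbitrary: k h)
    case Nil
    show ?case using cong[OF T_mul g_S[of "[]" "mul k h", simplified]] by simp
  next
    case (Cons x A)
    have "T (act a x) (T (inc b) (?g A h)) \<in> S" for a b
    proof -
      let ?w = "T (inc b) (?g A h)" and ?z = "hpart (act a x)"
      have "T (inc ?z) ?w \<in> S"
        by (rule cong[OF T_mul Cons.IH])
      moreover have "T (xpart (act a x)) ?w \<in> S"
        by (rule T_X[OF Cons.IH xpart_in_span])
      ultimately show ?thesis
        using cong[OF T_add_left SI(1), of "xpart (act a x)" ?w "inc ?z"] by (simp flip: decomp)
    qed
    then have "(\<Sum>(a, b)\<leftarrow>comult k. T (act a x) (T (inc b) (?g A h))) \<in> S"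
      by (intro S_sum) auto
    from cong[OF T_straight this] show ?case by simp
  qed
  show "T m p \<in> S" if p: "p \<in> S"
    using cong[OF T_add_left SI(1)[OF T_X[OF p xpart_in_span[of m]] T_span[OF p T_inc, of "hpart m"]]]
    by (simp flip: decomp)
qed

text \<open>The coefficient at the word \<open>r A\<close> is a combination of elements of
  \<open>HB\<close>, so independence in H finishes the argument. The relabelling \<open>r\<close> is
  the identity for left multiplication and \<open>rev\<close> for right multiplication.\<close>

lemma normal_form_independent:
  assumes HB: "H.independent HB" and r: "inj r" and c: "Poly_Mapping.keys c \<subseteq> lists X \<times> HB"
    and z: "lin_ext sE (\<lambda>(A, h). Poly_Mapping.single (r A) h) c = 0"
  shows "c = 0"
proof (rule poly_mapping_eqI)
  fix j :: "'m list \<times> 'h"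
  obtain A h where j: "j = (A, h)" by force
  show "Poly_Mapping.lookup c j = Poly_Mapping.lookup 0 j"
  proof (cases "h \<in> HB")
    case True
    let ?S = "{h. (A, h) \<in> Poly_Mapping.keys c}"
    have fin: "finite ?S"
      by (rule finite_subset[of _ "snd ` Poly_Mapping.keys c"]) force+
    have "0 = (\<Sum>i\<in>Poly_Mapping.keys c. if fst i = A then scaleH (Poly_Mapping.lookup c i) (snd i) else 0)"
    proof -
      have "0 = Poly_Mapping.lookup (lin_ext sE (\<lambda>(A, h). Poly_Mapping.single (r A) h) c) (r A)" by (simp add: z)
      also have "\<dots> = (\<Sum>i\<in>Poly_Mapping.keys c.
          Poly_Mapping.lookup (Poly_Mapping.single (r (fst i)) (scaleH (Poly_Mapping.lookup c i) (snd i))) (r A))"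
        by (simp add: lin_ext_def pm_sum_def lookup_sum split_def)
      finally show ?thesis by (simp add: lookup_single when_def inj_eq[OF r])
    qed
    also have "\<dots> = (\<Sum>i\<in>Pair A ` ?S. scaleH (Poly_Mapping.lookup c i) (snd i))"
      by (rule sum.mono_neutral_cong_right) auto
    also have "\<dots> = (\<Sum>h\<in>?S. scaleH (Poly_Mapping.lookup c (A, h)) h)"
      by (subst sum.reindex) (auto simp: inj_on_def)
    finally have "(\<Sum>h\<in>?S. scaleH (Poly_Mapping.lookup c (A, h)) h) = 0" by simp
    then have "\<forall>h\<in>?S. Poly_Mapping.lookup c (A, h) = 0"
      using H.independentD[OF HB fin, of "\<lambda>h. Poly_Mapping.lookup c (A, h)"] c by auto
    then show ?thesis by (auto simp: j in_keys_iff)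
  qed (use c in \<open>auto simp: j in_keys_iff\<close>)
qed

end

text \<open>One of the two multiplications applies a further operator to a result that is already
  zero; the other first moves the vector, and \<open>S\<close> is stable. The second alternative in
  the hypothesis is for right multiplications, which reverse the order of products.\<close>

lemma (in vector_space) two_sided_ann:
  assumes add: "\<And>w x y. g w (x + y) = g w x + g w y" and scale: "\<And>w c x. g w (scale c x) = scale c (g w x)"
    and S: "\<And>w x. x \<in> S \<Longrightarrow> g w x \<in> S"
    and hom: "(\<forall>u v. g (u @ v) = g u \<circ> g v) \<or> (\<forall>u v. g (u @ v) = g v \<circ> g u)"
  shows "two_sided {p. \<forall>x\<in>S. lin_ext scale (\<lambda>w. g w x) p = 0}"
proof -
  have g0: "g w 0 = 0" for w using add[of w 0 0] by simp
  have ext: "lin_ext scale (\<lambda>w. g (u @ w) x) p = lin_ext scale (\<lambda>w. g w x) (word u * p)"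
    "lin_ext scale (\<lambda>w. g (w @ u) x) p = lin_ext scale (\<lambda>w. g w x) (p * word u)" for u x p
  proof (induction p rule: pm_induct)
    case (add p q)
    { case 1 from add show ?case by (simp add: lin_ext_add distrib_left) }
    { case 2 from add show ?case by (simp add: lin_ext_add distrib_right) }
  qed (simp_all add: lin_ext_zero mult_single plus_list_def)
  have out: "lin_ext scale (\<lambda>w. g u (g w x)) p = g u (lin_ext scale (\<lambda>w. g w x) p)" for u x p
    by (induction p rule: pm_induct) (simp_all add: lin_ext_zero g0 scale lin_ext_add add)
  have "free.subspace {p. \<forall>x\<in>S. lin_ext scale (\<lambda>w. g w x) p = 0}"
    by (rule free.subspaceI) (simp_all add: lin_ext_zero lin_ext_add lin_ext_scale)
  then show ?thesis
  proof (rule two_sidedI)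
    fix u p assume p: "p \<in> {p. \<forall>x\<in>S. lin_ext scale (\<lambda>w. g w x) p = 0}"
    show "word u * p \<in> {p. \<forall>x\<in>S. lin_ext scale (\<lambda>w. g w x) p = 0}"
      "p * word u \<in> {p. \<forall>x\<in>S. lin_ext scale (\<lambda>w. g w x) p = 0}"
      using hom p S by (auto simp: out g0 simp flip: ext)
  qed
qed

lemma alg_hom_lift:
  fixes \<theta> :: "('x list \<Rightarrow>\<^sub>0 'k::field) \<Rightarrow> ('y list \<Rightarrow>\<^sub>0 'k)"
  assumes "presentation \<pi> A" "presentation \<rho> B"
    and \<theta>_add: "\<And>p q. \<theta> (p + q) = \<theta> p + \<theta> q" and \<theta>_scale: "\<And>c p. \<theta> (free_scale c p) = free_scale c (\<theta> p)"
    and \<theta>_mult: "\<And>p q. \<theta> (p * q) = \<theta> p * \<theta> q" and \<theta>_one: "\<theta> 1 = 1"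
    and ker: "presentation.kernel \<pi> A \<subseteq> {p. \<theta> p \<in> presentation.kernel \<rho> B}"
  shows "\<exists>f. alg_hom A B f \<and> (\<forall>p. f (\<pi> p) = \<rho> (\<theta> p))"
proof -
  interpret A: presentation \<pi> A by fact
  interpret B: presentation \<rho> B by fact
  define f where "f a = \<rho> (\<theta> (SOME p. \<pi> p = a))" for a
  have diff: "\<theta> (p - q) = \<theta> p - \<theta> q" for p q
    using \<theta>_add[of "p - q" q] by (simp add: algebra_simps)
  have f: "f (\<pi> p) = \<rho> (\<theta> p)" for p
  proof -
    have "\<pi> (SOME q. \<pi> q = \<pi> p) = \<pi> p" by (rule someI[of _ p]) simp
    then show ?thesis using ker by (auto simp: f_def A.eq_iff_kernel B.eq_iff_kernel diff)
  qed
  have "f \<in> ring_hom A B"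
    by (rule ring_hom_memI)
      (auto simp: A.carrier_eq f A.mult_eq B.mult_eq A.add_eq B.add_eq A.one_eq B.one_eq \<theta>_add \<theta>_mult \<theta>_one)
  moreover have "alg_linear A B f"
    by (auto simp: alg_linear_def A.carrier_eq f A.smult_eq B.smult_eq A.add_eq B.add_eq \<theta>_add \<theta>_scale)
  ultimately show ?thesis using f by (auto simp: alg_hom_def)
qed

text \<open>Spanning is the half needed to embed the tensor algebra: independence of the images of
  these words will be taken from the basis of the target.\<close>

lemma (in vector_space) words_span_tensor:
  assumes B: "span B = UNIV"
  shows "\<exists>q\<in>free.span (word ` lists B). p - q \<in> tensor_kernel scale"
proof -
  let ?K = "tensor_kernel scale"
  define S where "S = {q. \<exists>r\<in>free.span (word ` lists B). q - r \<in> ?K}"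
  have K2: "two_sided ?K" by (rule tens.two_sided_kernel)
  then have K: "free.subspace ?K" by (simp add: two_sided_def)
  have KI: "x \<in> ?K \<Longrightarrow> y \<in> ?K \<Longrightarrow> x + y \<in> ?K" "x \<in> ?K \<Longrightarrow> free_scale c x \<in> ?K" "0 \<in> ?K" for x y c
    using K by (auto simp: free.subspace_def)
  have S: "free.subspace S"
  proof (rule free.subspaceI)
    show "0 \<in> S" using KI free.span_zero by (auto simp: S_def intro!: bexI[of _ 0])
    fix x y c assume "x \<in> S"
    then obtain r where r: "r \<in> free.span (word ` lists B)" "x - r \<in> ?K" by (auto simp: S_def)
    then have "free_scale c x - free_scale c r \<in> ?K" using KI by (simp flip: free.scale_right_diff_distrib)
    then show "free_scale c x \<in> S" using free.span_scale[OF r(1)] unfolding S_def by blast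
    assume "y \<in> S"
    then obtain r' where r': "r' \<in> free.span (word ` lists B)" "y - r' \<in> ?K" by (auto simp: S_def)
    have "(x + y) - (r + r') \<in> ?K" using KI(1)[OF r(2) r'(2)] by (simp add: algebra_simps)
    then show "x + y \<in> S" using free.span_add[OF r(1) r'(1)] unfolding S_def by blast
  qed
  have KS: "?K \<subseteq> S" using free.span_zero by (auto simp: S_def intro!: bexI[of _ 0])
  have cong: "x \<in> S" if "x - y \<in> ?K" "y \<in> S" for x y
    using free.subspace_add[OF S, of "x - y" y] that KS by auto
  have base: "word [b] * q \<in> S" if b: "b \<in> B" and q: "q \<in> S" for b q
  proof -
    have "word [b] * r \<in> free.span (word ` lists B)" if "r \<in> free.span (word ` lists B)" for r
      using that
    proof (rule free.span_induct)
      show "free.subspace {r. word [b] * r \<in> free.span (word ` lists B)}"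
        by (rule free.subspaceI)
          (simp_all add: distrib_left free_scale_mult_right free.span_zero free.span_add free.span_scale)
      show "word [b] * r \<in> free.span (word ` lists B)" if "r \<in> word ` lists B" for r
        using that b by (auto simp: word_mult intro!: free.span_base imageI)
    qed
    moreover obtain r where r: "r \<in> free.span (word ` lists B)" "q - r \<in> ?K" using q by (auto simp: S_def)
    moreover have "word [b] * q - word [b] * r \<in> ?K"
      using K2 r(2) by (simp add: two_sided_def flip: right_diff_distrib)
    ultimately show ?thesis unfolding S_def by blast
  qed
  have mult: "word [v] * q \<in> S" if q: "q \<in> S" for v q
  proof -
    have rel: "r * q \<in> ?K" if "r \<in> tensor_relations scale" for r
      using K2 tensor_relations_kernel that by (auto simp: two_sided_def)
    have rel_add: "word [x + y] * q - (word [x] * q + word [y] * q) \<in> ?K" for x y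
    proof -
      have "word ([] @ (x + y) # []) - word ([] @ x # []) - word ([] @ y # []) \<in> tensor_relations scale"
        unfolding tensor_relations_def by blast
      from rel[OF this] show ?thesis by (simp add: algebra_simps)
    qed
    have rel_scale: "word [scale c x] * q - free_scale c (word [x] * q) \<in> ?K" for c x
    proof -
      have "word ([] @ scale c x # []) - free_scale c (word ([] @ x # [])) \<in> tensor_relations scale"
        unfolding tensor_relations_def by blast
      from rel[OF this] show ?thesis
        by (simp add: left_diff_distrib free_scale_mult_left del: free_scale_single)
    qed
    have "v \<in> span B" by (simp add: B)
    then show ?thesis
    proof (rule span_induct)
      show "subspace {v. word [v] * q \<in> S}"
      proof (rule subspaceI)
        show "0 \<in> {v. word [v] * q \<in> S}" using rel_scale[of 0 0] KS by auto
        show "x + y \<in> {v. word [v] * q \<in> S}" if "x \<in> {v. word [v] * q \<in> S}" "y \<in> {v. word [v] * q \<in> S}" for x y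
          using cong[OF rel_add free.subspace_add[OF S]] that by simp
        show "scale c x \<in> {v. word [v] * q \<in> S}" if "x \<in> {v. word [v] * q \<in> S}" for c x
          using cong[OF rel_scale free.subspace_scale[OF S]] that by simp
      qed
    qed (use base q in auto)
  qed
  have "word w \<in> S" for w
  proof (induction w)
    case Nil
    have "word [] \<in> free.span (word ` lists B)" by (rule free.span_base) auto
    then show ?case unfolding S_def using KI(3) by (auto intro!: bexI[of _ "word []"])
  next
    case (Cons v w)
    then show ?case using mult[of "word w" v] by (simp add: word_mult)
  qed
  then have "p \<in> S" for p
  proof (induction p rule: pm_induct)
    case (single w c)
    then show ?case using free.subspace_scale[OF S, of "word w" c] by simp
  qed (simp_all add: free.subspace_0[OF S] free.subspace_add[OF S])
  then show ?thesis unfolding S_def by blast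
qed

subsection \<open>The antipode\<close>

context hopf_algebra
begin

text \<open>Coassociativity as regrouping of iterated Sweedler sums. The version modulo
  \<open>J\<close> is needed for products of letters in the free algebra, which are trilinear only
  modulo the kernel.\<close>

lemma coassoc_mod:
  assumes t: "vector_space t" and J: "Modules.module.subspace t J"
    and f: "\<And>x y b e. f (x + y) b e - f x b e - f y b e \<in> J" "\<And>c x b e. f (scale c x) b e - t c (f x b e) \<in> J"
      "\<And>a x y e. f a (x + y) e - f a x e - f a y e \<in> J" "\<And>c a x e. f a (scale c x) e - t c (f a x e) \<in> J"
      "\<And>a b x y. f a b (x + y) - f a b x - f a b y \<in> J" "\<And>c a b x. f a b (scale c x) - t c (f a b x) \<in> J"
  shows "(\<Sum>(a, b)\<leftarrow>comult x. \<Sum>(a1, a2)\<leftarrow>comult a. f a1 a2 b) -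
    (\<Sum>(a, b)\<leftarrow>comult x. \<Sum>(b1, b2)\<leftarrow>comult b. f a b1 b2) \<in> J"
proof -
  let ?ps = "[(a1, a2, b). (a, b) \<leftarrow> comult x, (a1, a2) \<leftarrow> comult a]"
  let ?qs = "[(a, b1, b2). (a, b) \<leftarrow> comult x, (b1, b2) \<leftarrow> comult b]"
  have "tensor_eq scale (map (\<lambda>(a, b, c). [a, b, c]) ?ps) (map (\<lambda>(a, b, c). [a, b, c]) ?qs)"
    using coassoc[of x] by (simp add: map_concat o_def split_def)
  then have "(\<Sum>(a, b, c)\<leftarrow>?ps. f a b c) - (\<Sum>(a, b, c)\<leftarrow>?qs. f a b c) \<in> J"
    by (rule vector_space.tensor_eq_trilinear_mod[OF t _ J]) (rule f)+
  then show ?thesis by (simp add: map_concat sum_list_concat o_def split_def)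
qed

lemma coassoc_sum:
  assumes t: "vector_space t"
    and f: "\<And>x y b e. f (x + y) b e = f x b e + f y b e" "\<And>c x b e. f (scale c x) b e = t c (f x b e)"
      "\<And>a x y e. f a (x + y) e = f a x e + f a y e" "\<And>c a x e. f a (scale c x) e = t c (f a x e)"
      "\<And>a b x y. f a b (x + y) = f a b x + f a b y" "\<And>c a b x. f a b (scale c x) = t c (f a b x)"
  shows "(\<Sum>(a, b)\<leftarrow>comult x. \<Sum>(a1, a2)\<leftarrow>comult a. f a1 a2 b) =
    (\<Sum>(a, b)\<leftarrow>comult x. \<Sum>(b1, b2)\<leftarrow>comult b. f a b1 b2)"
proof -
  have "Modules.module.subspace t {0}"
    by (rule module.subspace_single_0) (use t in \<open>simp add: module_iff_vector_space\<close>)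
  from coassoc_mod[OF t this, of f x] show ?thesis by (simp add: f)
qed

lemma antipode_add: "antipode (x + y) = antipode x + antipode y"
  and antipode_scale: "antipode (scale c x) = scale c (antipode x)"
  using antipode_linear by (simp_all add: Vector_Spaces.linear_iff)

lemmas mult_scale = scale_mult_left scale_mult_right

lemma scale_sum_list: "scale c (sum_list xs) = (\<Sum>x\<leftarrow>xs. scale c x)"
  by (rule additive_sum_list) (rule scale_right_distrib)

lemma antipode_sum_list: "antipode (sum_list xs) = (\<Sum>x\<leftarrow>xs. antipode x)"
  by (rule additive_sum_list) (rule antipode_add)

lemma antipode_one: "antipode 1 = 1"
proof -
  have "tensor_eq scale [[a, b]. (a, b) \<leftarrow> comult 1] [[a, b]. (a, b) \<leftarrow> [(1, 1)]]"
    using comult_one by simp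
  then have "(\<Sum>(a, b)\<leftarrow>comult 1. antipode a * b) = (\<Sum>(a, b)\<leftarrow>[(1, 1)]. antipode a * b)"
    by (rule tensor_eq_bilinear) (simp_all add: antipode_add antipode_scale mult_scale distrib_left distrib_right)
  then show ?thesis by (simp add: antipode_left counit_one)
qed

text \<open>Both sides are convolution inverses of the multiplication; they are compared in
  \<open>S(x\<^sub>(\<^sub>1\<^sub>)y\<^sub>(\<^sub>1\<^sub>)) x\<^sub>(\<^sub>2\<^sub>)y\<^sub>(\<^sub>2\<^sub>) S(y\<^sub>(\<^sub>3\<^sub>)) S(x\<^sub>(\<^sub>3\<^sub>))\<close>.\<close>

lemma antipode_mult: "antipode (x * y) = antipode y * antipode x"
proof -
  let ?S = antipode
  let ?f = "\<lambda>a b c. \<Sum>(u, v)\<leftarrow>comult y. \<Sum>(v1, v2)\<leftarrow>comult v. ?S (a * u) * (b * v1) * ?S v2 * ?S c"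
  \<comment> \<open>To contract the first two legs of x later, the legs of y have to be regrouped in
    the same way.\<close>
  have f_eq: "?f a b c = (\<Sum>(u, v)\<leftarrow>comult y. \<Sum>(u1, u2)\<leftarrow>comult u. ?S (a * u1) * (b * u2) * ?S v * ?S c)" for a b c
    by (rule coassoc_sum[OF vector_space_axioms, symmetric])
      (simp_all add: algebra_simps antipode_add antipode_scale mult_scale)
  have "(\<Sum>(a, b)\<leftarrow>comult x. \<Sum>(a1, a2)\<leftarrow>comult a. ?f a1 a2 b) = (\<Sum>(a, b)\<leftarrow>comult x. \<Sum>(b1, b2)\<leftarrow>comult b. ?f a b1 b2)"
    by (rule coassoc_sum[OF vector_space_axioms])
      (simp_all add: algebra_simps antipode_add antipode_scale mult_scale split_def scale_sum_list o_def flip: sum_list_addf)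
  \<comment> \<open>In \<open>S(a u) b1 v1 S(v2) S(b2)\<close> the legs v1, v2 of y cancel, then the
    legs b1, b2 of x, leaving S(a y) up to the counit.\<close>
  moreover have "(\<Sum>(b1, b2)\<leftarrow>comult b. ?f a b1 b2) = scale (counit b) (?S (a * y))" for a b
  proof -
    have 1: "(\<Sum>(v1, v2)\<leftarrow>comult v. p * (q * v1) * ?S v2 * r) = scale (counit v) (p * q * r)" for p q r v
    proof -
      have "(\<Sum>(v1, v2)\<leftarrow>comult v. p * (q * v1) * ?S v2 * r) = p * q * (\<Sum>(v1, v2)\<leftarrow>comult v. v1 * ?S v2) * r"
        by (simp add: split_def mult.assoc flip: sum_list_const_mult sum_list_mult_const)
      then show ?thesis by (simp add: antipode_right mult_scale)
    qed
    have 2: "(\<Sum>(u, v)\<leftarrow>comult y. scale (counit v) (?S (a * u) * q * r)) = ?S (a * y) * q * r" for q r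
    proof -
      have "(\<Sum>(u, v)\<leftarrow>comult y. scale (counit v) (?S (a * u) * q * r)) =
        ?S (a * (\<Sum>(u, v)\<leftarrow>comult y. scale (counit v) u)) * q * r"
        by (simp add: split_def mult.assoc antipode_sum_list antipode_scale mult_scale o_def
            flip: sum_list_const_mult sum_list_mult_const)
      then show ?thesis by (simp add: counit_right)
    qed
    have "(\<Sum>(b1, b2)\<leftarrow>comult b. ?f a b1 b2) = (\<Sum>(b1, b2)\<leftarrow>comult b. ?S (a * y) * b1 * ?S b2)"
      by (simp only: 1 2)
    also have "\<dots> = ?S (a * y) * (\<Sum>(b1, b2)\<leftarrow>comult b. b1 * ?S b2)"
      by (simp add: split_def mult.assoc sum_list_const_mult)
    finally show ?thesis by (simp add: antipode_right mult_scale)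
  qed
  moreover have "(\<Sum>(a, b)\<leftarrow>comult x. scale (counit b) (?S (a * y))) = ?S (x * y)"
  proof -
    have "(\<Sum>(a, b)\<leftarrow>comult x. scale (counit b) (?S (a * y))) = ?S ((\<Sum>(a, b)\<leftarrow>comult x. scale (counit b) a) * y)"
      by (simp add: split_def antipode_sum_list antipode_scale mult_scale o_def flip: sum_list_mult_const)
    then show ?thesis by (simp add: counit_right)
  qed
  \<comment> \<open>Here the first two legs of x and y cancel together, since the comultiplication
    of a product is the product of the comultiplications.\<close>
  moreover have "(\<Sum>(a1, a2)\<leftarrow>comult a. ?f a1 a2 b) = scale (counit a) (?S y * ?S b)" for a b
  proof -
    have 1: "(\<Sum>(a1, a2)\<leftarrow>comult a. \<Sum>(u1, u2)\<leftarrow>comult u. ?S (a1 * u1) * (a2 * u2)) = scale (counit a * counit u) 1" for u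
    proof -
      let ?ps = "[(a * c, b * d). (a, b) \<leftarrow> comult a, (c, d) \<leftarrow> comult u]"
      have "tensor_eq scale [[p, q]. (p, q) \<leftarrow> comult (a * u)] [[p, q]. (p, q) \<leftarrow> ?ps]"
        using comult_mult[of a u] by (simp add: map_concat o_def split_def)
      then have "(\<Sum>(p, q)\<leftarrow>comult (a * u). ?S p * q) = (\<Sum>(p, q)\<leftarrow>?ps. ?S p * q)"
        by (rule tensor_eq_bilinear) (simp_all add: antipode_add antipode_scale mult_scale distrib_left distrib_right)
      then show ?thesis using antipode_left[of "a * u"] by (simp add: counit_mult map_concat sum_list_concat o_def split_def)
    qed
    have "(\<Sum>(a1, a2)\<leftarrow>comult a. ?f a1 a2 b) = (\<Sum>(u, v)\<leftarrow>comult y.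
        (\<Sum>(a1, a2)\<leftarrow>comult a. \<Sum>(u1, u2)\<leftarrow>comult u. ?S (a1 * u1) * (a2 * u2)) * ?S v * ?S b)"
      unfolding f_eq unfolding split_def
      by (subst sum_list_swap) (simp flip: sum_list_mult_const)
    also have "\<dots> = scale (counit a) (?S (\<Sum>(u, v)\<leftarrow>comult y. scale (counit u) v) * ?S b)"
      unfolding 1 by (simp add: split_def antipode_sum_list antipode_scale mult_scale o_def scale_sum_list
          flip: sum_list_mult_const)
    finally show ?thesis by (simp add: counit_left)
  qed
  moreover have "(\<Sum>(a, b)\<leftarrow>comult x. scale (counit a) (?S y * ?S b)) = ?S y * ?S x"
  proof -
    have "(\<Sum>(a, b)\<leftarrow>comult x. scale (counit a) (?S y * ?S b)) = ?S y * ?S (\<Sum>(a, b)\<leftarrow>comult x. scale (counit a) b)"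
      by (simp add: split_def antipode_sum_list antipode_scale mult_scale o_def flip: sum_list_const_mult)
    then show ?thesis by (simp add: counit_left)
  qed
  ultimately show ?thesis by simp
qed

end

locale hopf_algebra_bij = hopf_algebra +
  assumes bij_antipode: "bij antipode"
begin

abbreviation antipode_inv :: "'b \<Rightarrow> 'b" where
  "antipode_inv \<equiv> inv_into UNIV antipode"

lemma antipode_inv [simp]: "antipode (antipode_inv x) = x" "antipode_inv (antipode x) = x"
  using bij_antipode by (simp_all add: bij_is_surj surj_f_inv_f bij_is_inj)

lemma antipode_inv_eqI: "antipode y = x \<Longrightarrow> antipode_inv x = y"
  by auto

lemma antipode_inv_add: "antipode_inv (x + y) = antipode_inv x + antipode_inv y"
  and antipode_inv_scale: "antipode_inv (scale c x) = scale c (antipode_inv x)"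
  and antipode_inv_mult: "antipode_inv (x * z) = antipode_inv z * antipode_inv x"
  and antipode_inv_one: "antipode_inv 1 = 1"
  by (rule antipode_inv_eqI, simp add: antipode_add antipode_scale antipode_mult antipode_one)+

text \<open>The inverse of S is the antipode of the opposite algebra with the same comultiplication.
  Applying the injective, product-reversing S reduces both identities to the antipode
  axioms.\<close>

lemma antipode_inv_left: "(\<Sum>(a, b)\<leftarrow>comult x. antipode_inv b * a) = scale (counit x) 1"
  and antipode_inv_right: "(\<Sum>(a, b)\<leftarrow>comult x. b * antipode_inv a) = scale (counit x) 1"
proof -
  have "antipode (\<Sum>(a, b)\<leftarrow>comult x. antipode_inv b * a) = antipode (scale (counit x) 1)"
    using antipode_left[of x] by (simp add: antipode_sum_list split_def o_def antipode_mult antipode_scale antipode_one)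
  then show "(\<Sum>(a, b)\<leftarrow>comult x. antipode_inv b * a) = scale (counit x) 1"
    by (metis antipode_inv(2))
  have "antipode (\<Sum>(a, b)\<leftarrow>comult x. b * antipode_inv a) = antipode (scale (counit x) 1)"
    using antipode_right[of x] by (simp add: antipode_sum_list split_def o_def antipode_mult antipode_scale antipode_one)
  then show "(\<Sum>(a, b)\<leftarrow>comult x. b * antipode_inv a) = scale (counit x) 1"
    by (metis antipode_inv(2))
qed

end

lemma diff_diff_swap: "(a - b) - (c - d) = (a - c) - (b - d)"
  for a :: "'a::ab_group_add"
  by (simp add: algebra_simps)

subsection \<open>The algebra \<open>T(V)#\<^sub>MH\<close>\<close>

locale hopf_extension = hopf_algebra_bij scaleH comult counit antipode +
  Mod: algebra_module scaleH scaleM actM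
  for scaleH :: "'k::field \<Rightarrow> 'h::ring_1 \<Rightarrow> 'h" and comult counit antipode
    and scaleM :: "'k \<Rightarrow> 'm::ab_group_add \<Rightarrow> 'm" and actM +
  fixes inc :: "'h \<Rightarrow> 'm" and X :: "'m set" and HB :: "'h set"
  assumes inc_map: "module_map scaleH (adjoint_action comult antipode) scaleM actM inc"
    and inj_inc: "inj inc"
    and X_independent: "Mod.independent X"
    and X_complement: "direct_complement scaleM (Mod.span X) (range inc)"
    and HB_basis: "vs_basis scaleH HB"
    and HB_one: "1 \<in> HB"
begin

section \<open>The adjoint action and its two straightening identities\<close>

abbreviation ad where "ad \<equiv> adjoint_action comult antipode"

lemma inc_add: "inc (h + k) = inc h + inc k"
  and inc_scale: "inc (scaleH c h) = scaleM c (inc h)"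
  and act_inc: "actM h (inc k) = inc (ad h k)"
  using inc_map by (simp_all add: module_map_def Vector_Spaces.linear_iff)

text \<open>H embeds into M as a submodule, so the module laws of the adjoint action can be
  inherited from M instead of being computed from the antipode.\<close>

lemma ad_eqI: "actM h (inc k) = inc l \<Longrightarrow> ad h k = l"
  using inj_inc by (simp add: act_inc inj_eq)

lemma ad_add_left: "ad (h + l) k = ad h k + ad l k"
  and ad_scale_left: "ad (scaleH c h) k = scaleH c (ad h k)"
  and ad_one: "ad 1 k = k"
  and ad_mult: "ad (h * l) k = ad h (ad l k)"
  by (rule ad_eqI, simp add: inc_add inc_scale Mod.act_add_left Mod.act_add_right Mod.act_scale_left
      Mod.act_scale_right Mod.act_one Mod.act_mult flip: act_inc)+

text \<open>In Sweedler notation, \<open>h_(1) k S(h_(2)) h_(3) = h k\<close>.\<close>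

lemma ad_straight: "(\<Sum>(a, b)\<leftarrow>comult h. ad a k * b) = h * k"
proof -
  have "(\<Sum>(a, b)\<leftarrow>comult h. ad a k * b) =
      (\<Sum>(a, b)\<leftarrow>comult h. \<Sum>(a1, a2)\<leftarrow>comult a. a1 * k * antipode a2 * b)"
    by (simp add: adjoint_action_def split_def flip: sum_list_mult_const)
  also have "\<dots> = (\<Sum>(a, b)\<leftarrow>comult h. \<Sum>(b1, b2)\<leftarrow>comult b. a * k * antipode b1 * b2)"
    by (rule coassoc_sum[OF vector_space_axioms])
      (simp_all add: antipode_add antipode_scale mult_scale distrib_left distrib_right)
  also have "\<dots> = (\<Sum>(a, b)\<leftarrow>comult h. a * k * (\<Sum>(b1, b2)\<leftarrow>comult b. antipode b1 * b2))"
    by (simp add: split_def mult.assoc flip: sum_list_const_mult)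
  also have "\<dots> = (\<Sum>(a, b)\<leftarrow>comult h. scaleH (counit b) a * k)"
    by (simp only: antipode_left mult_scale mult_1_right)
  also have "\<dots> = (\<Sum>(a, b)\<leftarrow>comult h. scaleH (counit b) a) * k"
    by (simp add: split_def sum_list_mult_const)
  finally show ?thesis by (simp add: counit_right)
qed

text \<open>By \<open>ad_straight\<close> the left side becomes
  \<open>ad (h_(2) S^{-1}(h_(1))) k\<close> times \<open>h_(3)\<close>, and the argument of
  \<open>ad\<close> contracts to the counit.\<close>

lemma ad_straight_op: "(\<Sum>(a, b)\<leftarrow>comult h. b * ad (antipode_inv a) k) = k * h"
proof -
  have "(\<Sum>(a, b)\<leftarrow>comult h. b * ad (antipode_inv a) k) =
      (\<Sum>(a, b)\<leftarrow>comult h. \<Sum>(b1, b2)\<leftarrow>comult b. ad (b1 * antipode_inv a) k * b2)"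
    by (simp only: ad_mult ad_straight)
  also have "\<dots> = (\<Sum>(a, b)\<leftarrow>comult h. \<Sum>(a1, a2)\<leftarrow>comult a. ad (a2 * antipode_inv a1) k * b)"
    by (rule coassoc_sum[OF vector_space_axioms, symmetric])
      (simp_all add: antipode_inv_add antipode_inv_scale mult_scale distrib_left distrib_right
        ad_add_left ad_scale_left)
  also have "\<dots> = (\<Sum>(a, b)\<leftarrow>comult h. ad (\<Sum>(a1, a2)\<leftarrow>comult a. a2 * antipode_inv a1) k * b)"
    by (simp add: split_def additive_sum_list[of "\<lambda>x. ad x k"] ad_add_left o_def sum_list_mult_const)
  also have "\<dots> = (\<Sum>(a, b)\<leftarrow>comult h. k * scaleH (counit a) b)"
    by (simp only: antipode_inv_right ad_scale_left ad_one mult_scale)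
  also have "\<dots> = k * (\<Sum>(a, b)\<leftarrow>comult h. scaleH (counit a) b)"
    by (simp add: split_def sum_list_const_mult)
  finally show ?thesis by (simp add: counit_left)
qed

sublocale L: straightening scaleH scaleM "(*)" comult actM ad inc X
proof
  show "bilin scaleH scaleH (*)"
    by (simp add: bilin_def distrib_left distrib_right mult_scale)
qed (simp_all add: mult.assoc comult_add comult_scale comult_mult comult_one Mod.act_add_left Mod.act_add_right
    Mod.act_scale_left Mod.act_scale_right Mod.act_one Mod.act_mult inc_add inc_scale inj_inc act_inc
    ad_straight X_independent X_complement del: map_eq_conv)

text \<open>The inverse antipode reverses products and so makes M a module over the opposite
  algebra; the compatibility required of the adjoint action is
  \<open>ad_straight_op\<close>.\<close>

sublocale R: straightening scaleH scaleM "\<lambda>h k. k * h" comult "\<lambda>h. actM (antipode_inv h)"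
  "\<lambda>h. ad (antipode_inv h)" inc X
proof
  show "bilin scaleH scaleH (\<lambda>h k. k * h)"
    by (simp add: bilin_def distrib_left distrib_right mult_scale)
  show "tensor_eq scaleH [[a, b]. (a, b) \<leftarrow> comult (y * x)]
      [[c * a, d * b]. (a, b) \<leftarrow> comult x, (c, d) \<leftarrow> comult y]" for x y
  proof -
    \<comment> \<open>The two iterated lists contain the same words in different order, which does
      not affect the sum.\<close>
    have "(\<Sum>t\<leftarrow>[[c * a, d * b]. (a, b) \<leftarrow> comult x, (c, d) \<leftarrow> comult y]. word t :: _ \<Rightarrow>\<^sub>0 'k) =
        (\<Sum>t\<leftarrow>[[c * a, d * b]. (c, d) \<leftarrow> comult y, (a, b) \<leftarrow> comult x]. word t)"
      by (simp add: map_concat sum_list_concat o_def split_def) (rule sum_list_swap)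
    then show ?thesis using comult_mult[of y x] by (simp only: tensor_eq_def)
  qed
qed (simp_all add: mult.assoc comult_add comult_scale comult_one Mod.act_add_left Mod.act_add_right
    Mod.act_scale_left Mod.act_scale_right Mod.act_one Mod.act_mult inc_add inc_scale inj_inc act_inc
    antipode_inv_add antipode_inv_scale antipode_inv_mult antipode_inv_one
    ad_straight_op X_independent X_complement del: map_eq_conv)

section \<open>Congruences modulo the kernel\<close>

abbreviation Q where "Q \<equiv> smash_algebra comult scaleM actM inc HB"
abbreviation cls where "cls \<equiv> smash_class comult scaleM actM inc HB"

sublocale Q: presentation cls Q
  by (rule presentation_smash)

abbreviation K where "K \<equiv> Q.kernel"

lemma K_two_sided: "two_sided K"
  by (rule Q.two_sided_kernel)

lemma K_subspace: "free.subspace K"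
  using K_two_sided by (simp add: two_sided_def)

lemma K_mult: "p \<in> K \<Longrightarrow> q * p \<in> K" "p \<in> K \<Longrightarrow> p * q \<in> K"
  using K_two_sided by (simp_all add: two_sided_def)

lemmas K_add = free.subspace_add[OF K_subspace]
  and K_diff = free.subspace_diff[OF K_subspace]
  and K_scale = free.subspace_scale[OF K_subspace]
  and K_zero = free.subspace_0[OF K_subspace]

lemma K_trans: "p - q \<in> K \<Longrightarrow> q - r \<in> K \<Longrightarrow> p - r \<in> K"
  using K_add[of "p - q" "q - r"] by simp

lemma K_sym: "p - q \<in> K \<Longrightarrow> q - p \<in> K"
  using free.subspace_neg[OF K_subspace, of "p - q"] by simp

lemma K_sum_list:
  "(\<And>x. f x - g x \<in> K) \<Longrightarrow> (\<Sum>x\<leftarrow>xs. f x) - (\<Sum>x\<leftarrow>xs. g x) \<in> K"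
proof (induction xs)
  case (Cons x xs)
  then show ?case using K_add[of "f x - g x" "sum_list (map f xs) - sum_list (map g xs)"]
    by (simp add: algebra_simps)
qed (simp add: K_zero)

lemma K_relations: "tensor_relations scaleM \<union> H_relations inc HB \<union> JM_relations comult actM inc \<subseteq> K"
  by (rule smash_kernel_relations)

lemma K_letter_add: "word [m + n] - (word [m] + word [n]) \<in> K"
proof -
  have "word ([] @ (m + n) # []) - word ([] @ m # []) - word ([] @ n # []) \<in> tensor_relations scaleM"
    unfolding tensor_relations_def by blast
  then show ?thesis using K_relations by (auto simp: algebra_simps)
qed

lemma K_letter_scale: "word [scaleM c m] - free_scale c (word [m]) \<in> K"
proof -
  have "word ([] @ scaleM c m # []) - free_scale c (word ([] @ m # [])) \<in> tensor_relations scaleM"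
    unfolding tensor_relations_def by blast
  then show ?thesis using K_relations by auto
qed

lemma K_one: "word [inc 1] - 1 \<in> K"
  using K_relations by (auto simp: H_relations_def)

lemma K_straight: "word [inc h] * word [m] - (\<Sum>(a, b)\<leftarrow>comult h. word [actM a m] * word [inc b]) \<in> K"
proof -
  have "word [inc h, m] - (\<Sum>(a, b)\<leftarrow>comult h. word [actM a m, inc b]) \<in> JM_relations comult actM inc"
    unfolding JM_relations_def by blast
  then show ?thesis using K_relations by (auto simp: word_mult)
qed

lemma K_linear_sum_list: "word [sum_list xs] - (\<Sum>x\<leftarrow>xs. word [x]) \<in> K"
proof (induction xs)
  case Nil
  show ?case using K_letter_scale[of 0 0] by simp
next
  case (Cons x xs)
  show ?case using K_add[OF K_letter_add[of x "sum_list xs"] Cons] by (simp add: algebra_simps)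
qed

lemma HB_span: "span HB = UNIV"
  and HB_independent: "independent HB"
  using HB_basis by (simp_all add: vs_basis_def)

text \<open>The relations impose the multiplication of H only on pairs of basis elements; linearity
  of letters modulo \<open>K\<close> extends it to all pairs, one argument at a time.\<close>

lemma K_inc_mult: "word [inc h] * word [inc k] - word [inc (h * k)] \<in> K"
proof -
  \<comment> \<open>A map that is linear only modulo \<open>K\<close> still has a subspace as
    preimage of \<open>K\<close>.\<close>
  have lin: "subspace {h. F h \<in> K}"
    if "\<And>x y. F (x + y) - (F x + F y) \<in> K" "\<And>c x. F (scaleH c x) - free_scale c (F x) \<in> K"
    for F :: "'h \<Rightarrow> ('m list \<Rightarrow>\<^sub>0 'k)"
  proof (rule subspaceI)
    show "0 \<in> {h. F h \<in> K}" using that(2)[of 0 0] by simp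
    show "x + y \<in> {h. F h \<in> K}" if "x \<in> {h. F h \<in> K}" "y \<in> {h. F h \<in> K}" for x y
      using K_add[OF \<open>\<And>x y. F (x + y) - (F x + F y) \<in> K\<close>[of x y], of "F x + F y"] K_add[of "F x" "F y"] that by simp
    show "scaleH c x \<in> {h. F h \<in> K}" if "x \<in> {h. F h \<in> K}" for c x
      using K_add[OF \<open>\<And>c x. F (scaleH c x) - free_scale c (F x) \<in> K\<close>[of c x], of "free_scale c (F x)"] K_scale[of "F x" c] that by simp
  qed
  let ?F = "\<lambda>h k. word [inc h] * word [inc k] - word [inc (h * k)] :: 'm list \<Rightarrow>\<^sub>0 'k"
  have base: "?F h k \<in> K" if "h \<in> HB" "k \<in> HB" for h k
    using K_relations that by (auto simp: H_relations_def word_mult)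
  have left: "subspace {h. ?F h k \<in> K}" for k
  proof (rule lin)
    fix x y c
    have "?F (x + y) k - (?F x k + ?F y k) = (word [inc x + inc y] - (word [inc x] + word [inc y])) * word [inc k]
        - (word [inc (x * k) + inc (y * k)] - (word [inc (x * k)] + word [inc (y * k)]))"
      by (simp only: inc_add distrib_right left_diff_distrib) (simp add: algebra_simps)
    then show "?F (x + y) k - (?F x k + ?F y k) \<in> K"
      by (simp only: K_diff[OF K_mult(2)[OF K_letter_add] K_letter_add])
    have "?F (scaleH c x) k - free_scale c (?F x k) =
        (word [scaleM c (inc x)] - free_scale c (word [inc x])) * word [inc k]
        - (word [scaleM c (inc (x * k))] - free_scale c (word [inc (x * k)]))"
      by (simp only: inc_scale mult_scale left_diff_distrib free_scale_mult_left free.scale_right_diff_distrib)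
        (rule diff_diff_swap)
    then show "?F (scaleH c x) k - free_scale c (?F x k) \<in> K"
      by (simp only: K_diff[OF K_mult(2)[OF K_letter_scale] K_letter_scale])
  qed
  have right: "subspace {k. ?F h k \<in> K}" for h
  proof (rule lin)
    fix x y c
    have "?F h (x + y) - (?F h x + ?F h y) = word [inc h] * (word [inc x + inc y] - (word [inc x] + word [inc y]))
        - (word [inc (h * x) + inc (h * y)] - (word [inc (h * x)] + word [inc (h * y)]))"
      by (simp only: inc_add distrib_left right_diff_distrib) (simp add: algebra_simps)
    then show "?F h (x + y) - (?F h x + ?F h y) \<in> K"
      by (simp only: K_diff[OF K_mult(1)[OF K_letter_add] K_letter_add])
    have "?F h (scaleH c x) - free_scale c (?F h x) =
        word [inc h] * (word [scaleM c (inc x)] - free_scale c (word [inc x]))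
        - (word [scaleM c (inc (h * x))] - free_scale c (word [inc (h * x)]))"
      by (simp only: inc_scale mult_scale right_diff_distrib free_scale_mult_right free.scale_right_diff_distrib)
        (rule diff_diff_swap)
    then show "?F h (scaleH c x) - free_scale c (?F h x) \<in> K"
      by (simp only: K_diff[OF K_mult(1)[OF K_letter_scale] K_letter_scale])
  qed
  have inner: "?F h k \<in> K" if "h \<in> HB" for h
  proof -
    have "k \<in> span HB" by (simp add: HB_span)
    then show ?thesis using right[of h]
      by (rule span_induct) (rule base[OF that])
  qed
  have "h \<in> span HB" by (simp add: HB_span)
  then show ?thesis using left[of k]
    by (rule span_induct) (rule inner)
qed

text \<open>This is where the bijectivity of the antipode enters.\<close>

lemma K_straight_op:
  "word [m] * word [inc h] - (\<Sum>(a, b)\<leftarrow>comult h. word [inc b] * word [actM (antipode_inv a) m]) \<in> K"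
proof -
  \<comment> \<open>Modulo \<open>K\<close>, \<open>m h\<close> is
    \<open>(counit(h_(1)) m) h_(2)\<close> by 4, then
    \<open>(h_(2) S^{-1}(h_(1)) \<cdot> m) h_(3)\<close> by 3. After regrouping by 2, the relation
    read backwards gives \<open>h_(2) (S^{-1}(h_(1)) \<cdot> m)\<close> by 1.\<close>
  let ?f = "\<lambda>a1 a2 b. word [actM (a2 * antipode_inv a1) m] * word [inc b] :: 'm list \<Rightarrow>\<^sub>0 'k"
  have 1: "(\<Sum>(a, b)\<leftarrow>comult h. word [inc b] * word [actM (antipode_inv a) m]) -
      (\<Sum>(a, b)\<leftarrow>comult h. \<Sum>(b1, b2)\<leftarrow>comult b. ?f a b1 b2) \<in> K"
    unfolding split_def Mod.act_mult
    by (rule K_sum_list) (use K_straight in \<open>simp add: split_def\<close>)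
  have 2: "(\<Sum>(a, b)\<leftarrow>comult h. \<Sum>(a1, a2)\<leftarrow>comult a. ?f a1 a2 b) -
      (\<Sum>(a, b)\<leftarrow>comult h. \<Sum>(b1, b2)\<leftarrow>comult b. ?f a b1 b2) \<in> K"
  proof (rule coassoc_mod[OF vector_space_free_scale K_subspace])
    have d: "word [x + y] * q - word [x] * q - word [y] * q \<in> K" "q * word [x + y] - q * word [x] - q * word [y] \<in> K" for x y q
      using K_mult[OF K_letter_add[of x y], of q] by (simp_all add: algebra_simps)
    have s: "word [scaleM c x] * q - free_scale c (word [x] * q) \<in> K"
      "q * word [scaleM c x] - free_scale c (q * word [x]) \<in> K" for c x q
      using K_mult[OF K_letter_scale[of c x], of q]
      by (simp_all add: left_diff_distrib right_diff_distrib free_scale_mult_left free_scale_mult_right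
          del: free_scale_single)
    fix a1 a2 b x y :: 'h and c
    show "?f (x + y) a2 b - ?f x a2 b - ?f y a2 b \<in> K" "?f a1 (x + y) b - ?f a1 x b - ?f a1 y b \<in> K"
      "?f a1 a2 (x + y) - ?f a1 a2 x - ?f a1 a2 y \<in> K"
      unfolding antipode_inv_add distrib_left distrib_right Mod.act_add_left inc_add by (rule d)+
    show "?f (scaleH c x) a2 b - free_scale c (?f x a2 b) \<in> K" "?f a1 (scaleH c x) b - free_scale c (?f a1 x b) \<in> K"
      "?f a1 a2 (scaleH c x) - free_scale c (?f a1 a2 x) \<in> K"
      unfolding antipode_inv_scale mult_scale Mod.act_scale_left inc_scale by (rule s)+
  qed
  have 3: "(\<Sum>(a, b)\<leftarrow>comult h. word [scaleM (counit a) m] * word [inc b]) -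
     (\<Sum>(a, b)\<leftarrow>comult h. \<Sum>(a1, a2)\<leftarrow>comult a. ?f a1 a2 b) \<in> K"
    unfolding split_def
  proof (rule K_sum_list)
    fix x :: "'h \<times> 'h"
    let ?l = "[actM (a2 * antipode_inv a1) m. (a1, a2) \<leftarrow> comult (fst x)]"
    have "sum_list ?l = actM (\<Sum>(a1, a2)\<leftarrow>comult (fst x). a2 * antipode_inv a1) m"
      by (simp add: additive_sum_list[of "\<lambda>h. actM h m"] Mod.act_add_left o_def split_def)
    also have "\<dots> = scaleM (counit (fst x)) m"
      by (simp add: antipode_inv_right Mod.act_scale_left Mod.act_one)
    finally have "sum_list ?l = scaleM (counit (fst x)) m" .
    with K_mult(2)[OF K_linear_sum_list[of ?l], of "word [inc (snd x)]"]
    show "word [scaleM (counit (fst x)) m] * word [inc (snd x)] -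
        (\<Sum>p\<leftarrow>comult (fst x). ?f (fst p) (snd p) (snd x)) \<in> K"
      by (simp add: left_diff_distrib sum_list_mult_const o_def split_def)
  qed
  have 4: "word [m] * word [inc h] - (\<Sum>(a, b)\<leftarrow>comult h. word [scaleM (counit a) m] * word [inc b]) \<in> K"
  proof -
    let ?l = "[scaleM (counit a) (inc b). (a, b) \<leftarrow> comult h]"
    have "sum_list ?l = inc (\<Sum>(a, b)\<leftarrow>comult h. scaleH (counit a) b)"
      by (simp add: additive_sum_list[of inc] inc_add inc_scale o_def split_def)
    then have "sum_list ?l = inc h" by (simp add: counit_left)
    with K_mult(1)[OF K_linear_sum_list[of ?l], of "word [m]"]
    have a: "word [m] * word [inc h] - (\<Sum>(a, b)\<leftarrow>comult h. word [m] * word [scaleM (counit a) (inc b)]) \<in> K"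
      by (simp add: right_diff_distrib sum_list_const_mult o_def split_def)
    have b: "word [m] * word [scaleM c n] - word [scaleM c m] * word [n] \<in> K" for c n
    proof -
      have "word [m] * word [scaleM c n] - free_scale c (word [m] * word [n]) \<in> K"
        using K_mult(1)[OF K_letter_scale[of c n], of "word [m]"]
        by (simp add: right_diff_distrib free_scale_mult_right del: free_scale_single)
      moreover have "word [scaleM c m] * word [n] - free_scale c (word [m] * word [n]) \<in> K"
        using K_mult(2)[OF K_letter_scale[of c m], of "word [n]"]
        by (simp add: left_diff_distrib free_scale_mult_left del: free_scale_single)
      ultimately show ?thesis using K_trans K_sym by blast
    qed
    have "(\<Sum>(a, b)\<leftarrow>comult h. word [m] * word [scaleM (counit a) (inc b)]) -
        (\<Sum>(a, b)\<leftarrow>comult h. word [scaleM (counit a) m] * word [inc b]) \<in> K"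
      unfolding split_def by (rule K_sum_list) (rule b)
    with a show ?thesis by (rule K_trans)
  qed
  show ?thesis
    by (rule K_trans[OF 4 K_trans[OF 3 K_trans[OF 2 K_sym[OF 1]]]])
qed

section \<open>The two candidate bases and their spanning\<close>

definition basis_word :: "'m list \<times> 'h \<Rightarrow> ('m list \<Rightarrow>\<^sub>0 'k)" where
  "basis_word = (\<lambda>(A, h). word (A @ [inc h]))"

definition basis_word_op :: "'m list \<times> 'h \<Rightarrow> ('m list \<Rightarrow>\<^sub>0 'k)" where
  "basis_word_op = (\<lambda>(A, h). word (inc h # A))"

lemma foldr_word_left: "foldr (\<lambda>m p. word [m] * p) A 1 = (word A :: 'm list \<Rightarrow>\<^sub>0 'k)"
  by (induction A) (simp_all add: word_mult flip: word_Nil)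

lemma foldr_word_right: "foldr (\<lambda>m p. p * word [m]) A 1 = (word (rev A) :: 'm list \<Rightarrow>\<^sub>0 'k)"
  by (induction A) (simp_all add: word_mult flip: word_Nil)

lemma mod_K_subspace_UNIV:
  assumes "free.subspace S" "\<And>w. word w \<in> S"
  shows "p \<in> S"
proof (induction p rule: pm_induct)
  case (single w c)
  then show ?case using free.subspace_scale[OF assms(1) assms(2)[of w], of c] by simp
qed (simp_all add: free.subspace_0[OF assms(1)] free.subspace_add[OF assms(1)])

lemma spanning_left: "\<exists>q\<in>free.span (basis_word ` (lists X \<times> HB)). p - q \<in> K"
proof -
  let ?T = "\<lambda>m p. word [m] * p :: 'm list \<Rightarrow>\<^sub>0 'k"
  let ?S = "{q. \<exists>r\<in>free.span ((\<lambda>(A, h). foldr ?T (A @ [inc h]) 1) ` (lists X \<times> HB)). q - r \<in> K}"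
  have T_K: "\<forall>m. \<forall>p\<in>K. ?T m p \<in> K"
    by (simp add: K_mult)
  have T_add: "?T (m + n) p - (?T m p + ?T n p) \<in> K" for m n p
    using K_mult(2)[OF K_letter_add[of m n], of p] by (simp add: algebra_simps)
  have T_scale: "?T (scaleM c m) p - free_scale c (?T m p) \<in> K" for c m p
    using K_mult(2)[OF K_letter_scale[of c m], of p]
    by (simp add: left_diff_distrib free_scale_mult_left del: free_scale_single)
  have T_mul: "?T (inc h) (?T (inc k) p) - ?T (inc (h * k)) p \<in> K" for h k p
    using K_mult(2)[OF K_inc_mult[of h k], of p] by (simp add: left_diff_distrib flip: mult.assoc)
  have T_straight: "?T (inc h) (?T m p) - (\<Sum>(a, b)\<leftarrow>comult h. ?T (actM a m) (?T (inc b) p)) \<in> K" for h m p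
    using K_mult(2)[OF K_straight[of h m], of p]
    by (simp add: left_diff_distrib split_def flip: mult.assoc sum_list_mult_const)
  note * = L.straighten_span[where T = ?T and e = 1, OF vector_space_free_scale K_subspace HB_span
      distrib_left free_scale_mult_right T_K T_add T_scale T_mul T_straight]
  \<comment> \<open>Normal words end in a letter from H, so the empty word gets its normal form
    through \<open>inc 1\<close>, which is congruent to 1.\<close>
  have one: "1 \<in> ?S"
    using free.subspace_diff[OF *(3) *(1)[of 1], of "word [inc 1] - 1"] *(4) K_one by auto
  have "word w \<in> ?S" for w
  proof (induction w)
    case Nil
    show ?case using one by (simp only: word_Nil)
  next
    case (Cons m w)
    from *(2)[OF Cons.IH, of m] show ?case by (simp only: word_mult append.simps)
  qed
  from mod_K_subspace_UNIV[OF *(3) this, of p]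
  show ?thesis by (simp only: foldr_word_left basis_word_def mem_Collect_eq)
qed

text \<open>Right multiplications build words from the end, so the generators appear with reversed
  words; \<open>lists X\<close> is closed under reversal, hence the family is the same.\<close>

lemma spanning_right: "\<exists>q\<in>free.span (basis_word_op ` (lists X \<times> HB)). p - q \<in> K"
proof -
  let ?T = "\<lambda>m p. p * word [m] :: 'm list \<Rightarrow>\<^sub>0 'k"
  let ?S = "{q. \<exists>r\<in>free.span ((\<lambda>(A, h). foldr ?T (A @ [inc h]) 1) ` (lists X \<times> HB)). q - r \<in> K}"
  have T_K: "\<forall>m. \<forall>p\<in>K. ?T m p \<in> K"
    by (simp add: K_mult)
  have T_add: "?T (m + n) p - (?T m p + ?T n p) \<in> K" for m n p
    using K_mult(1)[OF K_letter_add[of m n], of p] by (simp add: algebra_simps)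
  have T_scale: "?T (scaleM c m) p - free_scale c (?T m p) \<in> K" for c m p
    using K_mult(1)[OF K_letter_scale[of c m], of p]
    by (simp add: right_diff_distrib free_scale_mult_right del: free_scale_single)
  have T_mul: "?T (inc h) (?T (inc k) p) - ?T (inc (k * h)) p \<in> K" for h k p
    using K_mult(1)[OF K_inc_mult[of k h], of p] by (simp add: right_diff_distrib mult.assoc)
  have T_straight: "?T (inc h) (?T m p) - (\<Sum>(a, b)\<leftarrow>comult h. ?T (actM (antipode_inv a) m) (?T (inc b) p)) \<in> K" for h m p
    using K_mult(1)[OF K_straight_op[of m h], of p]
    by (simp add: right_diff_distrib split_def mult.assoc flip: sum_list_const_mult)
  note * = R.straighten_span[where T = ?T and e = 1, OF vector_space_free_scale K_subspace HB_span
      distrib_right free_scale_mult_left T_K T_add T_scale T_mul T_straight]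
  have one: "1 \<in> ?S"
    using free.subspace_diff[OF *(3) *(1)[of 1], of "word [inc 1] - 1"] *(4) K_one by auto
  have "word w \<in> ?S" for w
  proof (induction w rule: rev_induct)
    case Nil
    show ?case using one by (simp only: word_Nil)
  next
    case (snoc m w)
    from *(2)[OF snoc.IH, of m] show ?case by (simp only: word_mult)
  qed
  from mod_K_subspace_UNIV[OF *(3) this, of p]
  have "\<exists>q\<in>free.span ((\<lambda>(A, h). word (inc h # rev A)) ` (lists X \<times> HB)). p - q \<in> K"
    by (simp only: foldr_word_right mem_Collect_eq rev_append rev.simps append.simps)
  moreover have "(\<lambda>(A, h). word (inc h # rev A)) ` (lists X \<times> HB) = basis_word_op ` (lists X \<times> HB)"
  proof -
    have "basis_word_op ` ((\<lambda>(A, h). (rev A, h)) ` (lists X \<times> HB)) = (\<lambda>(A, h). word (inc h # rev A)) ` (lists X \<times> HB)"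
      by (auto simp: basis_word_op_def image_image split_def)
    moreover have "(\<lambda>(A, h). (rev A, h)) ` (lists X \<times> HB) = lists X \<times> HB"
      by (auto simp: image_iff intro!: bexI[of _ "rev _"])
    ultimately show ?thesis by simp
  qed
  ultimately show ?thesis by (simp only:)
qed

lemma two_sided_kernel_le:
  assumes J: "two_sided J"
    and "\<And>m n. word [m + n] - word [m] - word [n] \<in> J"
    and "\<And>c m. word [scaleM c m] - free_scale c (word [m]) \<in> J"
    and "\<And>h k. word [inc h, inc k] - word [inc (h * k)] \<in> J"
    and "word [inc 1] - 1 \<in> J"
    and "\<And>h m. word [inc h, m] - (\<Sum>(a, b)\<leftarrow>comult h. word [actM a m, inc b]) \<in> J"
  shows "K \<subseteq> J"
proof (rule smash_kernel_minimal[OF J])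
  have "tensor_relations scaleM \<subseteq> J"
    by (rule two_sided_tensor_relations[OF J]) fact+
  then show "tensor_relations scaleM \<union> H_relations inc HB \<union> JM_relations comult actM inc \<subseteq> J"
    using assms by (auto simp: H_relations_def JM_relations_def)
qed

section \<open>The kernel acts by zero on normal forms\<close>

lemma lin_ext_sum_list: "lin_ext L.sE g (\<Sum>x\<leftarrow>xs. f x) = (\<Sum>x\<leftarrow>xs. lin_ext L.sE g (f x))"
  by (simp add: additive_sum_list[of "lin_ext L.sE g"] L.E.lin_ext_add o_def)

text \<open>The annihilator of the normal forms is a two-sided ideal containing every relation. The
  relation identifying \<open>inc 1\<close> with the unit is the one that forces the restriction to
  normal forms.\<close>

lemma K_acts_left:
  assumes "p \<in> K" "P \<in> L.normal_forms"
  shows "lin_ext L.sE (\<lambda>w. foldr L.mmul w P) p = 0"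
proof -
  let ?J = "{p. \<forall>P\<in>L.normal_forms. lin_ext L.sE (\<lambda>w. foldr L.mmul w P) p = 0}"
  have "two_sided ?J"
  proof (rule L.E.two_sided_ann)
    fix w P Q c
    show "foldr L.mmul w (P + Q) = foldr L.mmul w P + foldr L.mmul w Q"
      by (induction w) (simp_all add: L.mmul_add_right)
    show "foldr L.mmul w (L.sE c P) = L.sE c (foldr L.mmul w P)"
      by (induction w) (simp_all add: L.mmul_scale_right)
    show "P \<in> L.normal_forms \<Longrightarrow> foldr L.mmul w P \<in> L.normal_forms"
      by (induction w) (simp_all add: L.mmul_in_normal_forms)
  qed auto
  then have "K \<subseteq> ?J"
  proof (rule two_sided_kernel_le)
    show "word [inc 1] - 1 \<in> ?J"
      by (simp add: L.E.lin_ext_diff L.mmul_inc L.lmul_one flip: word_Nil)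
    show "word [inc h, inc k] - word [inc (h * k)] \<in> ?J" for h k
      by (simp add: L.E.lin_ext_diff L.mmul_inc_inc)
    show "word [inc h, m] - (\<Sum>(a, b)\<leftarrow>comult h. word [actM a m, inc b]) \<in> ?J" for h m
      by (simp add: L.E.lin_ext_diff lin_ext_sum_list L.mmul_inc_mmul split_def)
  qed (simp_all add: L.E.lin_ext_diff L.mmul_add_left L.mmul_scale_left)
  with assms show ?thesis by blast
qed

lemma K_acts_right:
  assumes "p \<in> K" "P \<in> R.normal_forms"
  shows "lin_ext L.sE (\<lambda>w. foldr R.mmul (rev w) P) p = 0"
proof -
  let ?J = "{p. \<forall>P\<in>R.normal_forms. lin_ext L.sE (\<lambda>w. foldr R.mmul (rev w) P) p = 0}"
  \<comment> \<open>For right multiplications \<open>R.mmul_inc_mmul\<close> expresses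
    \<open>m h = h_(2) (S^{-1}(h_(1)) \<cdot> m)\<close>. The relation that defines the ideal,
    \<open>h m = (h_(1) \<cdot> m) h_(2)\<close>, is recovered from it by contracting
    \<open>S^{-1}(h_(2)) h_(1)\<close>.\<close>
  have op: "R.mmul m (R.mmul (inc h) P) = (\<Sum>(a, b)\<leftarrow>comult h. R.mmul (inc b) (R.mmul (actM a m) P))" for m h P
  proof -
    have 1: "R.mmul (x + y) P = R.mmul x P + R.mmul y P" "R.mmul (scaleM c x) P = L.sE c (R.mmul x P)"
      "R.mmul x (P + P') = R.mmul x P + R.mmul x P'" "R.mmul x (L.sE c P) = L.sE c (R.mmul x P)" for x y c P P'
      by (rule R.mmul_add_left R.mmul_scale_left R.mmul_add_right R.mmul_scale_right)+
    let ?f = "\<lambda>a b c. R.mmul (actM (antipode_inv b * a) m) (R.mmul (inc c) P)"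
    have "(\<Sum>(a, b)\<leftarrow>comult h. R.mmul (inc b) (R.mmul (actM a m) P)) =
        (\<Sum>(a, b)\<leftarrow>comult h. \<Sum>(b1, b2)\<leftarrow>comult b. ?f a b1 b2)"
      by (simp only: R.mmul_inc_mmul Mod.act_mult)
    also have "\<dots> = (\<Sum>(a, b)\<leftarrow>comult h. \<Sum>(a1, a2)\<leftarrow>comult a. ?f a1 a2 b)"
      by (rule coassoc_sum[OF L.E.vector_space_axioms, symmetric])
        (simp_all only: antipode_inv_add antipode_inv_scale mult_scale distrib_left distrib_right
          Mod.act_add_left Mod.act_scale_left inc_add inc_scale 1)
    also have "\<dots> = (\<Sum>(a, b)\<leftarrow>comult h.
        R.mmul (actM (\<Sum>(a1, a2)\<leftarrow>comult a. antipode_inv a2 * a1) m) (R.mmul (inc b) P))"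
    proof -
      have "(\<Sum>x\<leftarrow>xs. R.mmul (actM (f x) m) P) = R.mmul (actM (\<Sum>x\<leftarrow>xs. f x) m) P"
        for xs :: "('h \<times> 'h) list" and f P
        by (simp add: additive_sum_list[of "\<lambda>h. R.mmul (actM h m) P"] Mod.act_add_left 1 o_def)
      then show ?thesis by (simp add: split_def)
    qed
    also have "\<dots> = (\<Sum>(a, b)\<leftarrow>comult h. R.mmul m (R.mmul (inc (scaleH (counit a) b)) P))"
      by (simp only: antipode_inv_left Mod.act_scale_left Mod.act_one inc_scale 1)
    also have "\<dots> = R.mmul m (R.mmul (inc (\<Sum>(a, b)\<leftarrow>comult h. scaleH (counit a) b)) P)"
      by (simp add: additive_sum_list[of "\<lambda>h. R.mmul m (R.mmul (inc h) P)"] inc_add 1 o_def split_def)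
    finally show ?thesis by (simp add: counit_left)
  qed
  have "two_sided ?J"
  proof (rule L.E.two_sided_ann)
    fix w P Q c
    show "foldr R.mmul (rev w) (P + Q) = foldr R.mmul (rev w) P + foldr R.mmul (rev w) Q"
      by (induction w rule: rev_induct) (simp_all add: R.mmul_add_right)
    show "foldr R.mmul (rev w) (L.sE c P) = L.sE c (foldr R.mmul (rev w) P)"
      by (induction w rule: rev_induct) (simp_all add: R.mmul_scale_right)
    show "P \<in> R.normal_forms \<Longrightarrow> foldr R.mmul (rev w) P \<in> R.normal_forms"
      by (induction w rule: rev_induct) (simp_all add: R.mmul_in_normal_forms)
  qed auto
  then have "K \<subseteq> ?J"
  proof (rule two_sided_kernel_le)
    show "word [inc 1] - 1 \<in> ?J"
      by (simp add: L.E.lin_ext_diff R.mmul_inc R.lmul_one flip: word_Nil)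
    show "word [inc h, inc k] - word [inc (h * k)] \<in> ?J" for h k
      by (simp add: L.E.lin_ext_diff R.mmul_inc_inc)
    show "word [inc h, m] - (\<Sum>(a, b)\<leftarrow>comult h. word [actM a m, inc b]) \<in> ?J" for h m
      by (simp add: L.E.lin_ext_diff lin_ext_sum_list op split_def)
  qed (simp_all add: L.E.lin_ext_diff R.mmul_add_left R.mmul_scale_left)
  with assms show ?thesis by blast
qed

lemma lin_ext_lin_ext:
  "lin_ext L.sE f (lin_ext free_scale \<beta> c) = lin_ext L.sE (\<lambda>j. lin_ext L.sE f (\<beta> j)) c"
  by (induction c rule: pm_induct)
    (simp_all add: free.lin_ext_zero L.E.lin_ext_zero free.lin_ext_add L.E.lin_ext_add L.E.lin_ext_scale)

lemma lin_ext_cong: "(\<And>j. j \<in> Poly_Mapping.keys c \<Longrightarrow> f j = g j) \<Longrightarrow> lin_ext s f c = lin_ext s g c"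
  by (simp add: lin_ext_def pm_sum_def)

sublocale B: presentation_basis cls Q basis_word "lists X \<times> HB"
proof
  show "\<exists>q\<in>free.span (basis_word ` (lists X \<times> HB)). p - q \<in> K" for p
    by (rule spanning_left)
  fix c :: "'m list \<times> 'h \<Rightarrow>\<^sub>0 'k"
  assume c: "Poly_Mapping.keys c \<subseteq> lists X \<times> HB" and k: "lin_ext free_scale basis_word c \<in> K"
  let ?v = "Poly_Mapping.single [] 1 :: 'm list \<Rightarrow>\<^sub>0 'h"
  have "0 = lin_ext L.sE (\<lambda>w. foldr L.mmul w ?v) (lin_ext free_scale basis_word c)"
    using K_acts_left[OF k, of ?v] L.single_in_normal_forms by simp
  also have "\<dots> = lin_ext L.sE (\<lambda>(A, h). Poly_Mapping.single (id A) h) c"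
    unfolding lin_ext_lin_ext
    by (rule lin_ext_cong) (use c L.foldr_mmul_normal in \<open>force simp: basis_word_def\<close>)
  finally show "c = 0"
    by (intro L.normal_form_independent[OF HB_independent inj_on_id c]) simp
qed

sublocale B_op: presentation_basis cls Q basis_word_op "lists X \<times> HB"
proof
  show "\<exists>q\<in>free.span (basis_word_op ` (lists X \<times> HB)). p - q \<in> K" for p
    by (rule spanning_right)
  fix c :: "'m list \<times> 'h \<Rightarrow>\<^sub>0 'k"
  assume c: "Poly_Mapping.keys c \<subseteq> lists X \<times> HB" and k: "lin_ext free_scale basis_word_op c \<in> K"
  let ?v = "Poly_Mapping.single [] 1 :: 'm list \<Rightarrow>\<^sub>0 'h"
  have "0 = lin_ext L.sE (\<lambda>w. foldr R.mmul (rev w) ?v) (lin_ext free_scale basis_word_op c)"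
    using K_acts_right[OF k, of ?v] R.single_in_normal_forms by simp
  \<comment> \<open>Reversing \<open>inc h # A\<close> puts \<open>inc h\<close> last, so the word h
    A acts on 1 \<otimes> 1 as the normal word for \<open>rev A\<close> and h.\<close>
  also have "\<dots> = lin_ext L.sE (\<lambda>(A, h). Poly_Mapping.single (rev A) h) c"
    unfolding lin_ext_lin_ext
  proof (rule lin_ext_cong)
    fix j assume "j \<in> Poly_Mapping.keys c"
    moreover obtain A h where "j = (A, h)" by force
    ultimately have j: "j = (A, h)" "rev A \<in> lists X" using c by auto
    show "lin_ext L.sE (\<lambda>w. foldr R.mmul (rev w) ?v) (basis_word_op j) = (case j of (A, h) \<Rightarrow> Poly_Mapping.single (rev A) h)"
      using R.foldr_mmul_normal[OF j(2), of h] by (simp add: j(1) basis_word_op_def)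
  qed
  finally show "c = 0"
    by (intro R.normal_form_independent[OF HB_independent _ c, of rev]) (auto simp: inj_def)
qed

section \<open>The embeddings of H and T(V)\<close>

abbreviation "emb h \<equiv> cls (word [inc h])"

lemma emb_hom: "alg_hom (type_algebra scaleH) Q emb"
  unfolding alg_hom_def
proof
  have add: "emb (x + y) = emb x \<oplus>\<^bsub>Q\<^esub> emb y" for x y
    using K_letter_add by (simp add: Q.add_eq Q.eq_iff_kernel inc_add)
  show "emb \<in> ring_hom (type_algebra scaleH) Q"
    by (rule ring_hom_memI)
      (use K_inc_mult K_sym K_one in \<open>auto simp: type_algebra_def add Q.mult_eq Q.one_eq Q.eq_iff_kernel\<close>)
  show "alg_linear (type_algebra scaleH) Q emb"
    using K_letter_scale by (auto simp: alg_linear_def type_algebra_def add inc_scale Q.smult_eq Q.eq_iff_kernel)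
qed

text \<open>Acting on 1 \<otimes> 1 returns h as the coefficient of the empty word.\<close>

lemma inj_emb: "inj emb"
proof (rule injI)
  fix h k assume "emb h = emb k"
  then have "word [inc h] - word [inc k] \<in> K" by (simp add: Q.eq_iff_kernel)
  from K_acts_left[OF this, of "Poly_Mapping.single [] 1"] L.single_in_normal_forms[of "[]" 1]
  have "Poly_Mapping.single [] h = (Poly_Mapping.single [] k :: 'm list \<Rightarrow>\<^sub>0 'h)"
    by (simp add: L.E.lin_ext_diff L.mmul_inc)
  then show "h = k" by (metis lookup_single_eq)
qed

context
  fixes scaleV :: "'k \<Rightarrow> 'v::ab_group_add \<Rightarrow> 'v" and pr :: "'m \<Rightarrow> 'v"
  assumes pr_linear: "Vector_Spaces.linear scaleM scaleV pr"
    and exact: "short_exact inc pr"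
begin

interpretation V: vector_space scaleV
  using pr_linear by (simp add: Vector_Spaces.linear_iff)

lemma pr_add: "pr (m + n) = pr m + pr n"
  and pr_scale: "pr (scaleM c m) = scaleV c (pr m)"
  using pr_linear by (simp_all add: Vector_Spaces.linear_iff)

text \<open>A linear section of \<open>pr\<close> with values in span X. Two preimages of v differ
  by an element of the image of H, which \<open>xpart\<close> removes, so the choice does not
  matter.\<close>

definition lift :: "'v \<Rightarrow> 'm" where
  "lift v = L.xpart (SOME m. pr m = v)"

lemma pr_inc [simp]: "pr (inc h) = 0"
  using exact by (auto simp: short_exact_def)

lemma pr_xpart: "pr (L.xpart m) = pr m"
  using pr_add[of "L.xpart m" "inc (L.hpart m)"] by (simp flip: L.decomp)

lemma pr_surj: "\<exists>m. pr m = v"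
  using exact by (metis short_exact_def surj_def)

lemma lift_pr: "lift (pr m) = L.xpart m"
proof -
  let ?n = "SOME n. pr n = pr m"
  have "pr ?n = pr m" by (rule someI[of _ m]) simp
  then have "pr (?n - m) = 0" using pr_add[of "?n - m" m] by simp
  then have "?n - m \<in> range inc" using exact by (auto simp: short_exact_def)
  then obtain h where "?n - m = inc h" by auto
  then have "?n = m + inc h" by (metis add.commute diff_add_cancel)
  then show ?thesis
    by (simp add: lift_def L.xpart_add) (simp add: L.xpart_def)
qed

lemma lift_add: "lift (u + v) = lift u + lift v"
proof -
  obtain m n where "pr m = u" "pr n = v" using pr_surj by metis
  then show ?thesis by (metis lift_pr pr_add L.xpart_add)
qed

lemma lift_scale: "lift (scaleV c v) = scaleM c (lift v)"
proof -
  obtain m where "pr m = v" using pr_surj by metis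
  then show ?thesis by (metis lift_pr pr_scale L.xpart_scale)
qed

lemma tensor_hom_exists:
  "\<exists>f. alg_hom (tensor_algebra scaleV) Q f \<and>
     (\<forall>x\<in>X. f (tensor_class scaleV (word [pr x])) = cls (word [x]))"
proof -
  define \<psi> :: "('v list \<Rightarrow>\<^sub>0 'k) \<Rightarrow> ('m list \<Rightarrow>\<^sub>0 'k)"
    where "\<psi> = lin_ext free_scale (\<lambda>w. word (map lift w))"
  have \<psi>_word: "\<psi> (word w) = word (map lift w)" for w by (simp add: \<psi>_def)
  have add: "\<psi> (p + q) = \<psi> p + \<psi> q" and scale: "\<psi> (free_scale c p) = free_scale c (\<psi> p)"
    and zero: "\<psi> 0 = 0" and diff: "\<psi> (p - q) = \<psi> p - \<psi> q" for p q c
    by (simp_all add: \<psi>_def free.lin_ext_add free.lin_ext_scale free.lin_ext_zero free.lin_ext_diff)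
  have mult: "\<psi> (p * q) = \<psi> p * \<psi> q" for p q
  proof (induction p rule: pm_induct)
    case (single u c)
    show ?case
      by (induction q rule: pm_induct)
        (simp_all add: zero distrib_left add, simp add: \<psi>_def mult_single plus_list_def)
  qed (simp_all add: zero add distrib_right)
  have one: "\<psi> 1 = 1" using \<psi>_word[of "[]"] by (simp add: word_Nil)
  let ?J = "{p. \<psi> p \<in> K}"
  have J: "two_sided ?J"
  proof -
    have "free.subspace ?J"
      by (rule free.subspaceI) (simp_all add: zero add scale K_zero K_add K_scale)
    then show ?thesis by (simp add: two_sided_def mult K_mult)
  qed
  have "tensor_kernel scaleV \<subseteq> ?J"
  proof (rule tensor_kernel_minimal[OF J two_sided_tensor_relations[OF J]])
    show "word [x + y] - word [x] - word [y] \<in> ?J" for x y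
      using K_letter_add[of "lift x" "lift y"] by (simp add: diff \<psi>_word lift_add diff_diff_eq add)
    show "word [scaleV c x] - free_scale c (word [x]) \<in> ?J" for c x
      using K_letter_scale[of c "lift x"]
      by (simp add: diff scale \<psi>_word lift_scale del: free_scale_single)
  qed
  from alg_hom_lift[OF presentation_tensor Q.presentation_axioms add scale mult one this]
  obtain f where f: "alg_hom (tensor_algebra scaleV) Q f" "\<And>p. f (tensor_class scaleV p) = cls (\<psi> p)"
    by blast
  moreover have "\<psi> (word [pr x]) = word [x]" if "x \<in> X" for x
    using that by (simp add: \<psi>_word lift_pr L.xpart_span Mod.span_base)
  ultimately show ?thesis by auto
qed

lemma span_pr_X: "V.span (pr ` X) = UNIV"
proof -
  interpret pr: Vector_Spaces.linear scaleM scaleV pr by (rule pr_linear)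
  have "v \<in> V.span (pr ` X)" for v
  proof -
    obtain m where "pr m = v" using pr_surj by metis
    then have "v = pr (L.xpart m)" by (simp add: pr_xpart)
    then show ?thesis using L.xpart_in_span pr.span_image by blast
  qed
  then show ?thesis by blast
qed

text \<open>The prescribed values determine f on words in the images of X, which span T(V). Such
  words go to the basis elements A 1, so independence of the basis rules out a kernel.\<close>

lemma tensor_hom_inj:
  assumes f: "alg_hom (tensor_algebra scaleV) Q f"
    and fX: "\<And>x. x \<in> X \<Longrightarrow> f (tensor_class scaleV (word [pr x])) = cls (word [x])"
  shows "inj_on f (carrier (tensor_algebra scaleV))"
proof (rule inj_onI)
  let ?t = "tensor_class scaleV"
  have f_add: "f (?t (p + q)) = f (?t p) \<oplus>\<^bsub>Q\<^esub> f (?t q)" for p q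
    using f by (simp add: alg_hom_def alg_linear_def flip: tens.add_eq)
  have f_scale: "f (?t (free_scale c p)) = c \<odot>\<^bsub>Q\<^esub> f (?t p)" for c p
    using f by (simp add: alg_hom_def alg_linear_def flip: tens.smult_eq)
  have f_mult: "f (?t (p * q)) = f (?t p) \<otimes>\<^bsub>Q\<^esub> f (?t q)" for p q
    using f by (simp add: alg_hom_def ring_hom_def flip: tens.mult_eq)
  have f_one: "f (?t 1) = cls 1"
    using f by (simp add: alg_hom_def ring_hom_def flip: tens.one_eq Q.one_eq)
  have f_closed: "f (?t p) \<in> carrier Q" for p
    using f by (auto simp: alg_hom_def ring_hom_def)
  have f_zero: "f (?t 0) = cls 0"
    using f_scale[of 0 0] f_closed[of 0] by (auto simp: Q.carrier_eq Q.smult_eq)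
  have f_word: "f (?t (word (map pr A))) = cls (word A)" if "A \<in> lists X" for A
    using that
  proof (induction A)
    case Nil
    show ?case using f_one by (simp add: word_Nil)
  next
    case (Cons x A)
    then show ?case
      using f_mult[of "word [pr x]" "word (map pr A)"] by (simp add: fX word_mult Q.mult_eq)
  qed
  let ?w = "\<lambda>A. word (map pr A) :: 'v list \<Rightarrow>\<^sub>0 'k"
  have f_comb: "f (?t (lin_ext free_scale ?w c)) = cls (lin_ext free_scale word c)"
    if "Poly_Mapping.keys c \<subseteq> lists X" for c
  proof (induction c rule: pm_induct)
    case (single A b)
    then have "A \<in> lists X" using that by blast
    then have "f (?t (free_scale b (?w A))) = cls (free_scale b (word A))"
      by (simp only: f_scale f_word Q.smult_eq)
    then show ?case by simp
  qed (simp_all add: free.lin_ext_zero f_zero free.lin_ext_add f_add Q.add_eq)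
  have ker: "p \<in> tensor_kernel scaleV" if p: "f (?t p) = cls 0" for p
  proof -
    obtain q where q: "q \<in> free.span (word ` lists (pr ` X))" "p - q \<in> tensor_kernel scaleV"
      using V.words_span_tensor[OF span_pr_X, of p] by blast
    have "word ` lists (pr ` X) = ?w ` lists X"
      by (simp add: lists_image image_image)
    with q(1) obtain c where c: "Poly_Mapping.keys c \<subseteq> lists X" "q = lin_ext free_scale ?w c"
      by (auto simp: free.span_image_eq_lin_ext)
    have "?t p = ?t q" using q(2) by (simp add: tens.eq_iff_kernel)
    then have "cls (lin_ext free_scale word c) = cls 0"
      using p f_comb[OF c(1)] by (simp add: c(2))
    then have c0: "lin_ext free_scale word c \<in> K" by (simp add: Q.eq_iff_kernel)
    \<comment> \<open>The coefficients are moved to the indices (A, 1), which are available because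
      \<open>HB\<close> contains 1; modulo \<open>K\<close> the extra letter \<open>inc 1\<close>
      changes nothing.\<close>
    let ?d = "lin_ext free_scale (\<lambda>A. Poly_Mapping.single (A, 1) 1) c :: ('m list \<times> 'h) \<Rightarrow>\<^sub>0 'k"
    have look: "Poly_Mapping.lookup ?d (A, h) = (Poly_Mapping.lookup c A when h = 1)" for A h
      by (induction c rule: pm_induct)
        (auto simp: free.lin_ext_zero free.lin_ext_add lookup_add when_add_distrib lookup_single when_def)
    have "lin_ext free_scale basis_word ?d - lin_ext free_scale word c \<in> K"
    proof (induction c rule: pm_induct)
      case (single A b)
      have "word A * word [inc 1] - word A \<in> K"
        using K_mult(1)[OF K_one, of "word A"] by (simp add: right_diff_distrib)
      then have "free_scale b (word A * word [inc 1] - word A) \<in> K" by (rule K_scale)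
      then show ?case by (simp add: basis_word_def word_mult free.scale_right_diff_distrib)
    next
      case (add c d)
      from K_add[OF this] show ?case by (simp add: free.lin_ext_add algebra_simps)
    qed (simp add: free.lin_ext_zero K_zero)
    then have "lin_ext free_scale basis_word ?d \<in> K" using K_add[OF _ c0] by fastforce
    moreover have "Poly_Mapping.keys ?d \<subseteq> lists X \<times> HB"
    proof
      fix j assume "j \<in> Poly_Mapping.keys ?d"
      moreover obtain A h where "j = (A, h)" by force
      ultimately show "j \<in> lists X \<times> HB"
        using c(1) HB_one by (auto simp: in_keys_iff look when_def subset_iff split: if_splits)
    qed
    ultimately have "?d = 0" by (intro B.independent)
    have "c = 0"
    proof (rule poly_mapping_eqI)
      fix A show "Poly_Mapping.lookup c A = Poly_Mapping.lookup 0 A"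
        using look[of A 1] \<open>?d = 0\<close> by simp
    qed
    then have "q = 0" by (simp add: c(2) free.lin_ext_zero)
    with q(2) show ?thesis by simp
  qed
  fix x y assume "x \<in> carrier (tensor_algebra scaleV)" "y \<in> carrier (tensor_algebra scaleV)" "f x = f y"
  then obtain p q where pq: "x = ?t p" "y = ?t q" "f (?t p) = f (?t q)" by (auto simp: tens.carrier_eq)
  have "f (?t (p - q)) = f (?t p) \<oplus>\<^bsub>Q\<^esub> (- 1) \<odot>\<^bsub>Q\<^esub> f (?t q)"
    by (simp flip: f_scale f_add)
  also have "\<dots> = cls 0"
    using f_closed[of q] unfolding pq(3) by (auto simp: Q.carrier_eq Q.smult_eq Q.add_eq)
  finally have "p - q \<in> tensor_kernel scaleV" by (rule ker)
  then show "x = y" by (simp add: pq tens.eq_iff_kernel)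
qed

end

end

theorem proposition2p2:
  fixes scaleH :: "'k::field \<Rightarrow> 'h::ring_1 \<Rightarrow> 'h"
    and comult :: "'h \<Rightarrow> ('h \<times> 'h) list"
    and counit :: "'h \<Rightarrow> 'k"
    and antipode :: "'h \<Rightarrow> 'h"
    and scaleV :: "'k \<Rightarrow> 'v::ab_group_add \<Rightarrow> 'v"
    and actV :: "'h \<Rightarrow> 'v \<Rightarrow> 'v"
    and scaleM :: "'k \<Rightarrow> 'm::ab_group_add \<Rightarrow> 'm"
    and actM :: "'h \<Rightarrow> 'm \<Rightarrow> 'm"
    and inc :: "'h \<Rightarrow> 'm"
    and pr :: "'m \<Rightarrow> 'v"
    and X :: "'m set"
    and HB :: "'h set"
    and Q :: "('k, ('m list \<Rightarrow>\<^sub>0 'k) set set set) module"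
    and wd :: "'m list \<Rightarrow> ('m list \<Rightarrow>\<^sub>0 'k) set set set"
    and emb :: "'h \<Rightarrow> ('m list \<Rightarrow>\<^sub>0 'k) set set set"
  assumes hopf: "hopf_algebra scaleH comult counit antipode"
    and bij_antipode: "bij antipode"
    and V_module: "algebra_module scaleH scaleV actV"
    and M_module: "algebra_module scaleH scaleM actM"
    and inc_map: "module_map scaleH (adjoint_action comult antipode) scaleM actM inc"
    and pr_map: "module_map scaleM actM scaleV actV pr"
    and exact: "short_exact inc pr"
    and X_independent: "\<not> Modules.module.dependent scaleM X"
    and X_complement: "direct_complement scaleM (Modules.module.span scaleM X) (range inc)"
    and HB_basis: "vs_basis scaleH HB"
    and HB_one: "1 \<in> HB"
    and Q_def: "Q = smash_algebra comult scaleM actM inc HB"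
    and wd_def: "\<And>A. wd A = smash_class comult scaleM actM inc HB (word A)"
    and emb_def: "\<And>h. emb h = smash_class comult scaleM actM inc HB (word [inc h])"
  shows
    "(inj_on (\<lambda>(A, h). wd A \<otimes>\<^bsub>Q\<^esub> emb h) (lists X \<times> HB) \<and>
      alg_basis Q {wd A \<otimes>\<^bsub>Q\<^esub> emb h | A h. A \<in> lists X \<and> h \<in> HB}) \<and>
     ((\<exists>\<phi>. alg_linear Q Q \<phi> \<and>
         (\<forall>A\<in>lists X. \<forall>h\<in>HB. \<phi> (wd A \<otimes>\<^bsub>Q\<^esub> emb h) = emb h \<otimes>\<^bsub>Q\<^esub> wd A)) \<and>
      (\<forall>\<phi>. alg_linear Q Q \<phi> \<and>
         (\<forall>A\<in>lists X. \<forall>h\<in>HB. \<phi> (wd A \<otimes>\<^bsub>Q\<^esub> emb h) = emb h \<otimes>\<^bsub>Q\<^esub> wd A) \<longrightarrow>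
         bij_betw \<phi> (carrier Q) (carrier Q))) \<and>
     graded_with Q
       (\<lambda>n. alg_span Q {wd A \<otimes>\<^bsub>Q\<^esub> emb h | A h. A \<in> lists X \<and> length A = n \<and> h \<in> HB}) \<and>
     ((\<exists>f. alg_hom (tensor_algebra scaleV) Q f \<and>
         (\<forall>x\<in>X. f (tensor_class scaleV (word [pr x])) = wd [x])) \<and>
      (\<forall>f. alg_hom (tensor_algebra scaleV) Q f \<and>
         (\<forall>x\<in>X. f (tensor_class scaleV (word [pr x])) = wd [x]) \<longrightarrow>
         inj_on f (carrier (tensor_algebra scaleV))) \<and>
      alg_hom (type_algebra scaleH) Q emb \<and> inj emb)"
proof -
  interpret E: hopf_extension scaleH comult counit antipode scaleM actM inc X HB
  proof (intro hopf_extension.intro hopf_algebra_bij.intro hopf_algebra_bij_axioms.intro hopf_extension_axioms.intro)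
    show "inj inc" using exact by (simp add: short_exact_def)
  qed fact+
  have pr_linear: "Vector_Spaces.linear scaleM scaleV pr"
    using pr_map by (simp add: module_map_def)
  let ?b = "\<lambda>j. smash_class comult scaleM actM inc HB (E.basis_word j)"
  have left: "wd A \<otimes>\<^bsub>Q\<^esub> emb h = ?b (A, h)" for A h
    by (simp add: Q_def wd_def emb_def E.Q.mult_eq word_mult E.basis_word_def)
  have right: "emb h \<otimes>\<^bsub>Q\<^esub> wd A = smash_class comult scaleM actM inc HB (E.basis_word_op (A, h))" for A h
    by (simp add: Q_def wd_def emb_def E.Q.mult_eq word_mult E.basis_word_op_def)
  have set: "{?b (A, h) | A h. A \<in> lists X \<and> h \<in> HB} = ?b ` (lists X \<times> HB)"
    by auto
  have set_n: "{?b (A, h) | A h. A \<in> lists X \<and> length A = n \<and> h \<in> HB} =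
      ?b ` {j \<in> lists X \<times> HB. length (fst j) = n}" for n
    by force
  have a: "inj_on (\<lambda>(A, h). wd A \<otimes>\<^bsub>Q\<^esub> emb h) (lists X \<times> HB)"
    "alg_basis Q {wd A \<otimes>\<^bsub>Q\<^esub> emb h | A h. A \<in> lists X \<and> h \<in> HB}"
    using E.B.inj_on_basis E.B.alg_basis unfolding left set by (simp_all add: Q_def split_def)
  \<comment> \<open>The two quantifiers over A and h are merged into one over the common index set
    of both bases, the form used in \<open>basis_change\<close>.\<close>
  have ball: "(\<forall>A\<in>lists X. \<forall>h\<in>HB. P (A, h)) \<longleftrightarrow> (\<forall>j\<in>lists X \<times> HB. P j)"
    for P :: "'m list \<times> 'h \<Rightarrow> bool"
    by blast
  have b: "\<exists>\<phi>. alg_linear Q Q \<phi> \<and> (\<forall>A\<in>lists X. \<forall>h\<in>HB. \<phi> (wd A \<otimes>\<^bsub>Q\<^esub> emb h) = emb h \<otimes>\<^bsub>Q\<^esub> wd A)"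
    "\<forall>\<phi>. alg_linear Q Q \<phi> \<and> (\<forall>A\<in>lists X. \<forall>h\<in>HB. \<phi> (wd A \<otimes>\<^bsub>Q\<^esub> emb h) = emb h \<otimes>\<^bsub>Q\<^esub> wd A) \<longrightarrow>
         bij_betw \<phi> (carrier Q) (carrier Q)"
    using basis_change[OF E.B.presentation_basis_axioms E.B_op.presentation_basis_axioms]
    unfolding left right ball unfolding Q_def by simp_all
  have c: "graded_with Q
       (\<lambda>n. alg_span Q {wd A \<otimes>\<^bsub>Q\<^esub> emb h | A h. A \<in> lists X \<and> length A = n \<and> h \<in> HB})"
    using E.B.graded[of "\<lambda>j. length (fst j)"] unfolding left set_n by (simp add: Q_def)
  have d: "\<exists>f. alg_hom (tensor_algebra scaleV) Q f \<and> (\<forall>x\<in>X. f (tensor_class scaleV (word [pr x])) = wd [x])"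
    "\<forall>f. alg_hom (tensor_algebra scaleV) Q f \<and> (\<forall>x\<in>X. f (tensor_class scaleV (word [pr x])) = wd [x]) \<longrightarrow>
         inj_on f (carrier (tensor_algebra scaleV))"
    using E.tensor_hom_exists[OF pr_linear exact] E.tensor_hom_inj[OF pr_linear exact]
    unfolding Q_def wd_def by blast+
  have e: "alg_hom (type_algebra scaleH) Q emb" "inj emb"
    using E.emb_hom E.inj_emb unfolding Q_def emb_def by auto
  show ?thesis
    using a b c d e by blast
qed

end
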